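(* Let $n\ge1$, let $\mathscr C$ be an additive category with an automorphism $\Sigma$, and let $\mathbb E_\Sigma=\mathscr C(-,\Sigma-):\mathscr C^{op}\times\mathscr C\to Ab$, i.e. $\mathbb E_\Sigma(C,A)=\mathscr C(C,\Sigma A)$ and $\mathbb E_\Sigma(c,a)(\delta)=(\Sigma a)\circ\delta\circ c$. Suppose $\mathfrak s$ is an exact realization of $\mathbb E_\Sigma$ such that $(\mathscr C,\mathbb E_\Sigma,\mathfrak s)$ is an $n$-exangulated category. Let $\square_{\mathfrak s}$ be the class of all $(n+2)$-$\Sigma$-sequences $$X^0\xrightarrow{d_X^0}X^1\xrightarrow{d_X^1}\cdots\xrightarrow{d_X^n}X^{n+1}\xrightarrow{\delta}\Sigma X^0$$ such that $\langle X^\bullet,\delta\rangle$ is an $\mathfrak s$-distinguished $n$-exangle. Then $(\mathscr C,\Sigma,\square_{\mathfrak s})$ is an $(n+2)$-angulated category.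
   Context: **$(n+2)$-angulated categories (Geiss–Keller–Oppermann).** Let $\mathscr C$ be additive with an automorphism $\Sigma$. An $(n+2)$-$\Sigma$-sequence is a sequence $X^0\xrightarrow{d_X^0}X^1\to\cdots\xrightarrow{d_X^n}X^{n+1}\xrightarrow{\delta}\Sigma X^0$; a morphism to $Y^0\to\cdots\to Y^{n+1}\xrightarrow{\rho}\Sigma Y^0$ is a tuple $(f^0,\dots,f^{n+1})$ making all squares, including $(\Sigma f^0)\delta=\rho f^{n+1}$, commute. $(\mathscr C,\Sigma,\square)$ is $(n+2)$-angulated if $\square$ is a class of $(n+2)$-$\Sigma$-sequences (called $(n+2)$-angles), closed under isomorphism, with: (F1) (a) $\square$ is closed under direct sums and direct summands; (b) $X\xrightarrow{1}X\to0\to\cdots\to0\to\Sigma X$ is in $\square$ for all $X$; (c) every morphism $X^0\to X^1$ is the first morphism of some $(n+2)$-angle. (F2) An $(n+2)$-$\Sigma$-sequence $X^0\xrightarrow{d_X^0}X^1\xrightarrow{d_X^1}\cdots\xrightarrow{d_X^n}X^{n+1}\xrightarrow{\delta}\Sigma X^0$ is in $\square$ iff its rotation $X^1\xrightarrow{d_X^1}\cdots\xrightarrow{d_X^n}X^{n+1}\xrightarrow{\delta}\Sigma X^0\xrightarrow{(-1)^n\Sigma d_X^0}\Sigma X^1$ is. (F3) Given two $(n+2)$-angles and $f^0,f^1$ with $f^1d_X^0=d_Y^0f^0$, there are $f^2,\dots,f^{n+1}$ making $(f^0,\dots,f^{n+1})$ a morphism. (F4) In (F3), $f^2,\dots,f^{n+1}$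 can be chosen such that the cone $X^1\oplus Y^0\to X^2\oplus Y^1\to\cdots\to\Sigma X^0\oplus Y^{n+1}\to\Sigma X^1\oplus\Sigma Y^0$, with maps $\begin{bmatrix}-d_X^{i+1}&0\\ f^{i+1}&d_Y^i\end{bmatrix}$ ($0\le i\le n$, $d_X^{n+1}:=\delta$) and $\begin{bmatrix}-\Sigma d_X^0&0\\ \Sigma f^0&\rho\end{bmatrix}$, is in $\square$. **$n$-exangulated categories.** Let $n\ge1$, $\mathscr C$ additive, $\mathbb E:\mathscr C^{op}\times\mathscr C\to Ab$ biadditive. Extensions: an element $\delta\in\mathbb E(C,A)$ is an extension; for $a:A\to A'$, $c:C'\to C$ put $a_*\delta=\mathbb E(C,a)(\delta)$, $c^*\delta=\mathbb E(c,A)(\delta)$. For $\delta\in\mathbb E(C,A)$, $\rho\in\mathbb E(D,B)$ a morphism of extensions $(a,c):\delta\to\rho$ is a pair $a:A\to B$, $c:C\to D$ with $a_*\delta=c^*\rho$. Put $\delta_\sharp:\mathscr C(-,C)\to\mathbb E(-,A)$, $f\mapsto f^*\delta$, and $\delta^\sharp:\mathscr C(A,-)\to\mathbb E(C,-)$, $g\mapsto g_*\delta$. Complexes: $\mathbf C^{n+2}_{\mathscr C}$ is the category of complexes $X^\bullet=(X^0\xrightarrow{d_X^0}\cdots\xrightarrow{d_X^n}X^{n+1})$ concentrated in degrees $0,\dots,n+1$, with usual chain homotopy. $\mathbf C^{n+2}_{(A,C)}$ has as objects the complexes with $X^0=A$, $X^{n+1}=C$ and as morphisms the chain maps with $f^0=1_A$,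 $f^{n+1}=1_C$; homotopy is the same relation, homotopy equivalences are taken within this category, and $[X^\bullet]$ is the homotopy equivalence class in it. $n$-exangles: a pair $\langle X^\bullet,\delta\rangle$ with $\delta\in\mathbb E(X^{n+1},X^0)$ is an $n$-exangle if $\mathscr C(-,X^0)\to\cdots\to\mathscr C(-,X^{n+1})\xrightarrow{\delta_\sharp}\mathbb E(-,X^0)$ and $\mathscr C(X^{n+1},-)\to\cdots\to\mathscr C(X^0,-)\xrightarrow{\delta^\sharp}\mathbb E(X^{n+1},-)$ are exact (at all inner terms). Exact realization: a correspondence $\mathfrak s$ assigning to each $\delta\in\mathbb E(C,A)$ a class $\mathfrak s(\delta)=[X^\bullet]$ of an object of $\mathbf C^{n+2}_{(A,C)}$ such that: (R0) if $\mathfrak s(\delta)=[X^\bullet]$, $\mathfrak s(\rho)=[Y^\bullet]$, every morphism $(a,c):\delta\to\rho$ has a lift, i.e. a chain map $f^\bullet:X^\bullet\to Y^\bullet$ with $f^0=a$, $f^{n+1}=c$; (R1) $\mathfrak s(\delta)=[X^\bullet]$ implies $\langle X^\bullet,\delta\rangle$ is an $n$-exangle; (R2) $0\in\mathbb E(0,A)$ has $\mathfrak s(0)=[A\xrightarrow{1}A\to0\to\cdots\to0]$ and $0\in\mathbb E(A,0)$ has $\mathfrak s(0)=[0\to\cdots\to0\to A\xrightarrow{1}A]$. If $\mathfrak s(\delta)=[X^\bullet]$, $\langle X^\bullet,\delta\rangle$ is called ($\mathfrak s$-)distinguished, $d_X^0$ an inflation, $d_X^n$ a deflation. Cones: for $f^\bullet:X^\bullet\to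 Y^\bullet$ with $f^0=1$, $M_f^\bullet$ is $X^1\to X^2\oplus Y^1\to\cdots\to X^{n+1}\oplus Y^n\to Y^{n+1}$ with $d^0=\begin{bmatrix}-d_X^1\\ f^1\end{bmatrix}$, $d^i=\begin{bmatrix}-d_X^{i+1}&0\\ f^{i+1}&d_Y^i\end{bmatrix}$ ($1\le i\le n-1$), $d^n=[f^{n+1}\ d_Y^n]$. Dually for $h^\bullet$ with $h^{n+1}=1$, the mapping cocone is $X^0\to X^1\oplus Y^0\to\cdots\to X^n\oplus Y^{n-1}\to Y^n$ with $\begin{bmatrix}d_X^0\\ h^0\end{bmatrix}$, $\begin{bmatrix}d_X^i&0\\ h^i&-d_Y^{i-1}\end{bmatrix}$, $[h^n\ -d_Y^{n-1}]$. $(\mathscr C,\mathbb E,\mathfrak s)$ is $n$-exangulated if $\mathfrak s$ is an exact realization and: (EA1) inflations are closed under composition, and so are deflations; (EA2) for $\rho\in\mathbb E(D,A)$, $c:C\to D$ and distinguished $\langle X^\bullet,c^*\rho\rangle$, $\langle Y^\bullet,\rho\rangle$, $(1_A,c)$ has a lift $f^\bullet$ such that $\langle M_f^\bullet,(d_X^0)_*\rho\rangle$ is distinguished; (EA2$^{op}$) for $\delta\in\mathbb E(C,A)$, $a:A\to B$ and distinguished $\langle X^\bullet,\delta\rangle$, $\langle Y^\bullet,a_*\delta\rangle$, $(a,1_C)$ has a lift whose mapping cocone with extension $(d_Y^n)^*\delta$ is distinguished. *)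

theory Defs
  imports "HOL-Algebra.Coset"
begin

section \<open>Additive categories\<close>

text \<open>
  Objects and arrows are carved out of types \<open>'o\<close> and \<open>'m\<close> by carrier sets, as in HOL-Algebra.
  The fields \<open>add\<close> and \<open>zero\<close> are the preadditive structure; \<open>zero A B\<close> is the zero map
  from \<open>A\<close> to \<open>B\<close>. As usual, \<open>g \<cdot> f\<close> means \<open>f\<close> first.
\<close>

record ('o, 'm) cat =
  Obj :: "'o set"
  Arr :: "'m set"
  src :: "'m \<Rightarrow> 'o"
  tgt :: "'m \<Rightarrow> 'o"
  cmp :: "'m \<Rightarrow> 'm \<Rightarrow> 'm"  (infixl "\<cdot>\<index>" 70)
  idt :: "'o \<Rightarrow> 'm"
  addm :: "'m \<Rightarrow> 'm \<Rightarrow> 'm"  (infixl "\<boxplus>\<index>" 65)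
  zerom :: "'o \<Rightarrow> 'o \<Rightarrow> 'm"

definition Mor :: "('o, 'm) cat \<Rightarrow> 'o \<Rightarrow> 'o \<Rightarrow> 'm set" where
  "Mor \<C> A B = {f \<in> Arr \<C>. src \<C> f = A \<and> tgt \<C> f = B}"

definition Mor_group :: "('o, 'm) cat \<Rightarrow> 'o \<Rightarrow> 'o \<Rightarrow> 'm monoid" where
  "Mor_group \<C> A B = \<lparr>carrier = Mor \<C> A B, mult = addm \<C>, one = zerom \<C> A B\<rparr>"

definition neg :: "('o, 'm) cat \<Rightarrow> 'm \<Rightarrow> 'm" where
  "neg \<C> f = inv\<^bsub>Mor_group \<C> (src \<C> f) (tgt \<C> f)\<^esub> f"

locale category =
  fixes \<C> :: "('o, 'm) cat" (structure)
  assumes src_Obj: "f \<in> Arr \<C> \<Longrightarrow> src \<C> f \<in> Obj \<C>"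
    and tgt_Obj: "f \<in> Arr \<C> \<Longrightarrow> tgt \<C> f \<in> Obj \<C>"
    and idt_Mor: "A \<in> Obj \<C> \<Longrightarrow> idt \<C> A \<in> Mor \<C> A A"
    and cmp_Mor: "\<lbrakk>f \<in> Mor \<C> A B; g \<in> Mor \<C> B D\<rbrakk> \<Longrightarrow> g \<cdot> f \<in> Mor \<C> A D"
    and cmp_assoc: "\<lbrakk>f \<in> Mor \<C> A B; g \<in> Mor \<C> B D; h \<in> Mor \<C> D F\<rbrakk>
      \<Longrightarrow> h \<cdot> (g \<cdot> f) = (h \<cdot> g) \<cdot> f"
    and cmp_idt_right: "f \<in> Mor \<C> A B \<Longrightarrow> f \<cdot> idt \<C> A = f"
    and cmp_idt_left: "f \<in> Mor \<C> A B \<Longrightarrow> idt \<C> B \<cdot> f = f"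

locale preadditive_category = category +
  assumes Mor_comm_group: "\<lbrakk>A \<in> Obj \<C>; B \<in> Obj \<C>\<rbrakk> \<Longrightarrow> comm_group (Mor_group \<C> A B)"
    and cmp_add_left: "\<lbrakk>f \<in> Mor \<C> A B; g \<in> Mor \<C> B D; g' \<in> Mor \<C> B D\<rbrakk>
      \<Longrightarrow> (g \<boxplus> g') \<cdot> f = (g \<cdot> f) \<boxplus> (g' \<cdot> f)"
    and cmp_add_right: "\<lbrakk>f \<in> Mor \<C> A B; f' \<in> Mor \<C> A B; g \<in> Mor \<C> B D\<rbrakk>
      \<Longrightarrow> g \<cdot> (f \<boxplus> f') = (g \<cdot> f) \<boxplus> (g \<cdot> f')"

definition is_zero_object :: "('o, 'm) cat \<Rightarrow> 'o \<Rightarrow> bool" where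
  "is_zero_object \<C> Z \<longleftrightarrow> Z \<in> Obj \<C> \<and>
     (\<forall>A\<in>Obj \<C>. (\<exists>!f. f \<in> Mor \<C> A Z) \<and> (\<exists>!f. f \<in> Mor \<C> Z A))"

definition is_biproduct ::
  "('o, 'm) cat \<Rightarrow> 'o \<Rightarrow> 'o \<Rightarrow> 'o \<times> 'm \<times> 'm \<times> 'm \<times> 'm \<Rightarrow> bool" where
  "is_biproduct \<C> A B = (\<lambda>(P, i1, i2, p1, p2). P \<in> Obj \<C> \<and>
     i1 \<in> Mor \<C> A P \<and> i2 \<in> Mor \<C> B P \<and> p1 \<in> Mor \<C> P A \<and> p2 \<in> Mor \<C> P B \<and>
     p1 \<cdot>\<^bsub>\<C>\<^esub> i1 = idt \<C> A \<and> p2 \<cdot>\<^bsub>\<C>\<^esub> i2 = idt \<C> B \<and>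
     p1 \<cdot>\<^bsub>\<C>\<^esub> i2 = zerom \<C> B A \<and> p2 \<cdot>\<^bsub>\<C>\<^esub> i1 = zerom \<C> A B \<and>
     (i1 \<cdot>\<^bsub>\<C>\<^esub> p1) \<boxplus>\<^bsub>\<C>\<^esub> (i2 \<cdot>\<^bsub>\<C>\<^esub> p2) = idt \<C> P)"

locale additive_category = preadditive_category +
  assumes ex_zero_object: "\<exists>Z. is_zero_object \<C> Z"
    and ex_biproduct: "\<lbrakk>A \<in> Obj \<C>; B \<in> Obj \<C>\<rbrakk> \<Longrightarrow> \<exists>b. is_biproduct \<C> A B b"

text \<open>
  \<open>0\<close> and \<open>A \<oplus> B\<close> (with its injections and projections) denote one fixed choice throughout.
\<close>

definition zero_object :: "('o, 'm) cat \<Rightarrow> 'o" where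
  "zero_object \<C> = (SOME Z. is_zero_object \<C> Z)"

definition biproduct :: "('o, 'm) cat \<Rightarrow> 'o \<Rightarrow> 'o \<Rightarrow> 'o \<times> 'm \<times> 'm \<times> 'm \<times> 'm" where
  "biproduct \<C> A B = (SOME b. is_biproduct \<C> A B b)"

definition dsum :: "('o, 'm) cat \<Rightarrow> 'o \<Rightarrow> 'o \<Rightarrow> 'o" where
  "dsum \<C> A B = (case biproduct \<C> A B of (P, i1, i2, p1, p2) \<Rightarrow> P)"

definition inj1 :: "('o, 'm) cat \<Rightarrow> 'o \<Rightarrow> 'o \<Rightarrow> 'm" where
  "inj1 \<C> A B = (case biproduct \<C> A B of (P, i1, i2, p1, p2) \<Rightarrow> i1)"

definition inj2 :: "('o, 'm) cat \<Rightarrow> 'o \<Rightarrow> 'o \<Rightarrow> 'm" where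
  "inj2 \<C> A B = (case biproduct \<C> A B of (P, i1, i2, p1, p2) \<Rightarrow> i2)"

definition pr1 :: "('o, 'm) cat \<Rightarrow> 'o \<Rightarrow> 'o \<Rightarrow> 'm" where
  "pr1 \<C> A B = (case biproduct \<C> A B of (P, i1, i2, p1, p2) \<Rightarrow> p1)"

definition pr2 :: "('o, 'm) cat \<Rightarrow> 'o \<Rightarrow> 'o \<Rightarrow> 'm" where
  "pr2 \<C> A B = (case biproduct \<C> A B of (P, i1, i2, p1, p2) \<Rightarrow> p2)"

text \<open>
  The row \<open>[f g]\<close>, the column with entries \<open>f\<close> (top) and \<open>g\<close> (bottom), and 2 by 2 matrices,
  listed row by row.
\<close>

definition rowm :: "('o, 'm) cat \<Rightarrow> 'm \<Rightarrow> 'm \<Rightarrow> 'm" where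
  "rowm \<C> f g = (f \<cdot>\<^bsub>\<C>\<^esub> pr1 \<C> (src \<C> f) (src \<C> g)) \<boxplus>\<^bsub>\<C>\<^esub> (g \<cdot>\<^bsub>\<C>\<^esub> pr2 \<C> (src \<C> f) (src \<C> g))"

definition colm :: "('o, 'm) cat \<Rightarrow> 'm \<Rightarrow> 'm \<Rightarrow> 'm" where
  "colm \<C> f g = (inj1 \<C> (tgt \<C> f) (tgt \<C> g) \<cdot>\<^bsub>\<C>\<^esub> f) \<boxplus>\<^bsub>\<C>\<^esub> (inj2 \<C> (tgt \<C> f) (tgt \<C> g) \<cdot>\<^bsub>\<C>\<^esub> g)"

definition matm :: "('o, 'm) cat \<Rightarrow> 'm \<Rightarrow> 'm \<Rightarrow> 'm \<Rightarrow> 'm \<Rightarrow> 'm" where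
  "matm \<C> f11 f12 f21 f22 = colm \<C> (rowm \<C> f11 f12) (rowm \<C> f21 f22)"


section \<open>Automorphisms\<close>

record ('o, 'm) endo =
  on_ob :: "'o \<Rightarrow> 'o"
  on_arr :: "'m \<Rightarrow> 'm"

definition endofunctor :: "('o, 'm) cat \<Rightarrow> ('o, 'm) endo \<Rightarrow> bool" where
  "endofunctor \<C> F \<longleftrightarrow>
     (\<forall>A\<in>Obj \<C>. on_ob F A \<in> Obj \<C>) \<and>
     (\<forall>A\<in>Obj \<C>. \<forall>B\<in>Obj \<C>. \<forall>f\<in>Mor \<C> A B. on_arr F f \<in> Mor \<C> (on_ob F A) (on_ob F B)) \<and>
     (\<forall>A\<in>Obj \<C>. on_arr F (idt \<C> A) = idt \<C> (on_ob F A)) \<and>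
     (\<forall>f\<in>Arr \<C>. \<forall>g\<in>Arr \<C>. tgt \<C> f = src \<C> g \<longrightarrow>
        on_arr F (g \<cdot>\<^bsub>\<C>\<^esub> f) = on_arr F g \<cdot>\<^bsub>\<C>\<^esub> on_arr F f)"

text \<open>
  Additivity is not required separately: an automorphism of an additive category preserves
  biproducts, hence sums of morphisms.
\<close>

definition automorphism :: "('o, 'm) cat \<Rightarrow> ('o, 'm) endo \<Rightarrow> bool" where
  "automorphism \<C> \<Sigma> \<longleftrightarrow> endofunctor \<C> \<Sigma> \<and>
     (\<exists>\<Omega>. endofunctor \<C> \<Omega> \<and>
        (\<forall>A\<in>Obj \<C>. on_ob \<Omega> (on_ob \<Sigma> A) = A \<and> on_ob \<Sigma> (on_ob \<Omega> A) = A) \<and>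
        (\<forall>f\<in>Arr \<C>. on_arr \<Omega> (on_arr \<Sigma> f) = f \<and> on_arr \<Sigma> (on_arr \<Omega> f) = f))"


section \<open>Sequences and complexes\<close>

text \<open>
  A sequence in degrees \<open>0, \<dots>, n + 1\<close>. Only \<open>ob X i\<close> for \<open>i \<le> n + 1\<close> and \<open>df X i\<close> for \<open>i \<le> n\<close>
  carry meaning. The remaining values are arbitrary and ignored by every notion below: two
  records that differ only there are isomorphic, and homotopy equivalent with fixed ends.
\<close>

record ('o, 'm) seq =
  ob :: "nat \<Rightarrow> 'o"
  df :: "nat \<Rightarrow> 'm"

definition sequence :: "('o, 'm) cat \<Rightarrow> nat \<Rightarrow> ('o, 'm) seq \<Rightarrow> bool" where
  "sequence \<C> n X \<longleftrightarrow> (\<forall>i\<le>n + 1. ob X i \<in> Obj \<C>) \<and>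
     (\<forall>i\<le>n. df X i \<in> Mor \<C> (ob X i) (ob X (i + 1)))"

definition complex :: "('o, 'm) cat \<Rightarrow> nat \<Rightarrow> ('o, 'm) seq \<Rightarrow> bool" where
  "complex \<C> n X \<longleftrightarrow> sequence \<C> n X \<and>
     (\<forall>i<n. df X (i + 1) \<cdot>\<^bsub>\<C>\<^esub> df X i = zerom \<C> (ob X i) (ob X (i + 2)))"

definition chain_map ::
  "('o, 'm) cat \<Rightarrow> nat \<Rightarrow> ('o, 'm) seq \<Rightarrow> ('o, 'm) seq \<Rightarrow> (nat \<Rightarrow> 'm) \<Rightarrow> bool" where
  "chain_map \<C> n X Y f \<longleftrightarrow> (\<forall>i\<le>n + 1. f i \<in> Mor \<C> (ob X i) (ob Y i)) \<and>
     (\<forall>i\<le>n. f (i + 1) \<cdot>\<^bsub>\<C>\<^esub> df X i = df Y i \<cdot>\<^bsub>\<C>\<^esub> f i)"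

definition homotopic ::
  "('o, 'm) cat \<Rightarrow> nat \<Rightarrow> ('o, 'm) seq \<Rightarrow> ('o, 'm) seq \<Rightarrow> (nat \<Rightarrow> 'm) \<Rightarrow> (nat \<Rightarrow> 'm) \<Rightarrow> bool" where
  "homotopic \<C> n X Y f g \<longleftrightarrow> (\<exists>\<phi>.
     (\<forall>i\<in>{1..n + 1}. \<phi> i \<in> Mor \<C> (ob X i) (ob Y (i - 1))) \<and>
     g 0 = f 0 \<boxplus>\<^bsub>\<C>\<^esub> (\<phi> 1 \<cdot>\<^bsub>\<C>\<^esub> df X 0) \<and>
     (\<forall>i\<in>{1..n}. g i = f i \<boxplus>\<^bsub>\<C>\<^esub> ((\<phi> (i + 1) \<cdot>\<^bsub>\<C>\<^esub> df X i) \<boxplus>\<^bsub>\<C>\<^esub> (df Y (i - 1) \<cdot>\<^bsub>\<C>\<^esub> \<phi> i))) \<and>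
     g (n + 1) = f (n + 1) \<boxplus>\<^bsub>\<C>\<^esub> (df Y n \<cdot>\<^bsub>\<C>\<^esub> \<phi> (n + 1)))"

definition complexes_between :: "('o, 'm) cat \<Rightarrow> nat \<Rightarrow> 'o \<Rightarrow> 'o \<Rightarrow> ('o, 'm) seq set" where
  "complexes_between \<C> n A C = {X. complex \<C> n X \<and> ob X 0 = A \<and> ob X (n + 1) = C}"

definition chain_map_fixing_ends ::
  "('o, 'm) cat \<Rightarrow> nat \<Rightarrow> 'o \<Rightarrow> 'o \<Rightarrow> ('o, 'm) seq \<Rightarrow> ('o, 'm) seq \<Rightarrow> (nat \<Rightarrow> 'm) \<Rightarrow> bool" where
  "chain_map_fixing_ends \<C> n A C X Y f \<longleftrightarrow>
     chain_map \<C> n X Y f \<and> f 0 = idt \<C> A \<and> f (n + 1) = idt \<C> C"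

definition homotopy_equivalent ::
  "('o, 'm) cat \<Rightarrow> nat \<Rightarrow> 'o \<Rightarrow> 'o \<Rightarrow> ('o, 'm) seq \<Rightarrow> ('o, 'm) seq \<Rightarrow> bool" where
  "homotopy_equivalent \<C> n A C X Y \<longleftrightarrow> (\<exists>f g.
     chain_map_fixing_ends \<C> n A C X Y f \<and> chain_map_fixing_ends \<C> n A C Y X g \<and>
     homotopic \<C> n X X (\<lambda>i. g i \<cdot>\<^bsub>\<C>\<^esub> f i) (\<lambda>i. idt \<C> (ob X i)) \<and>
     homotopic \<C> n Y Y (\<lambda>i. f i \<cdot>\<^bsub>\<C>\<^esub> g i) (\<lambda>i. idt \<C> (ob Y i)))"

definition homotopy_class ::
  "('o, 'm) cat \<Rightarrow> nat \<Rightarrow> 'o \<Rightarrow> 'o \<Rightarrow> ('o, 'm) seq \<Rightarrow> ('o, 'm) seq set" where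
  "homotopy_class \<C> n A C X =
     {Y \<in> complexes_between \<C> n A C. homotopy_equivalent \<C> n A C X Y}"


section \<open>\<open>n\<close>-exangulated categories\<close>

text \<open>
  \<open>egrp E C A\<close> is the abelian group \<open>E(C, A)\<close>, written multiplicatively as in HOL-Algebra, and
  \<open>eact E c a\<close> is the homomorphism \<open>E(c, a)\<close>.
\<close>

record ('o, 'm, 'e) bifunctor =
  egrp :: "'o \<Rightarrow> 'o \<Rightarrow> 'e monoid"
  eact :: "'m \<Rightarrow> 'm \<Rightarrow> 'e \<Rightarrow> 'e"

locale biadditive_bifunctor =
  fixes \<C> :: "('o, 'm) cat" (structure) and E :: "('o, 'm, 'e) bifunctor"
  assumes egrp_comm_group: "\<lbrakk>C \<in> Obj \<C>; A \<in> Obj \<C>\<rbrakk> \<Longrightarrow> comm_group (egrp E C A)"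
    and eact_hom: "\<lbrakk>c \<in> Mor \<C> C' C; a \<in> Mor \<C> A A'\<rbrakk>
      \<Longrightarrow> eact E c a \<in> hom (egrp E C A) (egrp E C' A')"
    and eact_idt: "\<lbrakk>C \<in> Obj \<C>; A \<in> Obj \<C>; \<delta> \<in> carrier (egrp E C A)\<rbrakk>
      \<Longrightarrow> eact E (idt \<C> C) (idt \<C> A) \<delta> = \<delta>"
    and eact_cmp: "\<lbrakk>c \<in> Mor \<C> C' C; c' \<in> Mor \<C> C'' C'; a \<in> Mor \<C> A A'; a' \<in> Mor \<C> A' A'';
        \<delta> \<in> carrier (egrp E C A)\<rbrakk>
      \<Longrightarrow> eact E (c \<cdot> c') (a' \<cdot> a) \<delta> = eact E c' a' (eact E c a \<delta>)"
    and eact_add_left: "\<lbrakk>c \<in> Mor \<C> C' C; c' \<in> Mor \<C> C' C; a \<in> Mor \<C> A A';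
        \<delta> \<in> carrier (egrp E C A)\<rbrakk>
      \<Longrightarrow> eact E (c \<boxplus> c') a \<delta> = eact E c a \<delta> \<otimes>\<^bsub>egrp E C' A'\<^esub> eact E c' a \<delta>"
    and eact_add_right: "\<lbrakk>c \<in> Mor \<C> C' C; a \<in> Mor \<C> A A'; a' \<in> Mor \<C> A A';
        \<delta> \<in> carrier (egrp E C A)\<rbrakk>
      \<Longrightarrow> eact E c (a \<boxplus> a') \<delta> = eact E c a \<delta> \<otimes>\<^bsub>egrp E C' A'\<^esub> eact E c a' \<delta>"

text \<open>
  For \<open>\<delta>\<close> in \<open>E(C, A)\<close>: \<open>push \<C> E C a \<delta>\<close> is the push-forward of \<open>\<delta>\<close> along \<open>a\<close> and
  \<open>pull \<C> E A c \<delta>\<close> is the pull-back of \<open>\<delta>\<close> along \<open>c\<close>. The object argument is the one the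
  operation leaves fixed.
\<close>

definition push :: "('o, 'm) cat \<Rightarrow> ('o, 'm, 'e) bifunctor \<Rightarrow> 'o \<Rightarrow> 'm \<Rightarrow> 'e \<Rightarrow> 'e" where
  "push \<C> E C a \<delta> = eact E (idt \<C> C) a \<delta>"

definition pull :: "('o, 'm) cat \<Rightarrow> ('o, 'm, 'e) bifunctor \<Rightarrow> 'o \<Rightarrow> 'm \<Rightarrow> 'e \<Rightarrow> 'e" where
  "pull \<C> E A c \<delta> = eact E c (idt \<C> A) \<delta>"

definition n_exangle ::
  "('o, 'm) cat \<Rightarrow> ('o, 'm, 'e) bifunctor \<Rightarrow> nat \<Rightarrow> ('o, 'm) seq \<Rightarrow> 'e \<Rightarrow> bool" where
  "n_exangle \<C> E n X \<delta> \<longleftrightarrow>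
     complex \<C> n X \<and> \<delta> \<in> carrier (egrp E (ob X (n + 1)) (ob X 0)) \<and>
     (\<forall>Z\<in>Obj \<C>.
        (\<forall>i\<in>{1..n}.
           kernel (Mor_group \<C> Z (ob X i)) (Mor_group \<C> Z (ob X (i + 1))) (\<lambda>f. df X i \<cdot>\<^bsub>\<C>\<^esub> f)
           = (\<lambda>f. df X (i - 1) \<cdot>\<^bsub>\<C>\<^esub> f) ` Mor \<C> Z (ob X (i - 1))) \<and>
        kernel (Mor_group \<C> Z (ob X (n + 1))) (egrp E Z (ob X 0)) (\<lambda>f. pull \<C> E (ob X 0) f \<delta>)
        = (\<lambda>f. df X n \<cdot>\<^bsub>\<C>\<^esub> f) ` Mor \<C> Z (ob X n)) \<and>
     (\<forall>Z\<in>Obj \<C>.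
        (\<forall>i\<in>{1..n}.
           kernel (Mor_group \<C> (ob X i) Z) (Mor_group \<C> (ob X (i - 1)) Z) (\<lambda>g. g \<cdot>\<^bsub>\<C>\<^esub> df X (i - 1))
           = (\<lambda>g. g \<cdot>\<^bsub>\<C>\<^esub> df X i) ` Mor \<C> (ob X (i + 1)) Z) \<and>
        kernel (Mor_group \<C> (ob X 0) Z) (egrp E (ob X (n + 1)) Z)
          (\<lambda>g. push \<C> E (ob X (n + 1)) g \<delta>)
        = (\<lambda>g. g \<cdot>\<^bsub>\<C>\<^esub> df X 0) ` Mor \<C> (ob X 1) Z)"

text \<open>
  A correspondence \<open>s\<close> takes \<open>C\<close>, \<open>A\<close> and \<open>\<delta>\<close> in \<open>E(C, A)\<close> to a homotopy class. The ends are
  explicit arguments because the groups \<open>E(C, A)\<close> need not be disjoint.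
  \<open>distinguished \<C> E n s X \<delta>\<close> says that \<open>\<delta>\<close> is in \<open>E(X\<^sup>n\<^sup>+\<^sup>1, X\<^sup>0)\<close> and \<open>s(\<delta>) = [X]\<close>.
\<close>

definition distinguished ::
  "('o, 'm) cat \<Rightarrow> ('o, 'm, 'e) bifunctor \<Rightarrow> nat \<Rightarrow> ('o \<Rightarrow> 'o \<Rightarrow> 'e \<Rightarrow> ('o, 'm) seq set)
   \<Rightarrow> ('o, 'm) seq \<Rightarrow> 'e \<Rightarrow> bool" where
  "distinguished \<C> E n s X \<delta> \<longleftrightarrow>
     complex \<C> n X \<and> \<delta> \<in> carrier (egrp E (ob X (n + 1)) (ob X 0)) \<and>
     s (ob X (n + 1)) (ob X 0) \<delta> = homotopy_class \<C> n (ob X 0) (ob X (n + 1)) X"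

text \<open>The complexes \<open>A = A \<rightarrow> 0 \<rightarrow> \<dots> \<rightarrow> 0\<close> and \<open>0 \<rightarrow> \<dots> \<rightarrow> 0 \<rightarrow> A = A\<close>.\<close>

definition initial_trivial :: "('o, 'm) cat \<Rightarrow> 'o \<Rightarrow> ('o, 'm) seq" where
  "initial_trivial \<C> A =
     (let X = (\<lambda>i. if i \<le> 1 then A else zero_object \<C>)
      in \<lparr>ob = X, df = (\<lambda>i. if i = 0 then idt \<C> A else zerom \<C> (X i) (X (i + 1)))\<rparr>)"

definition final_trivial :: "('o, 'm) cat \<Rightarrow> nat \<Rightarrow> 'o \<Rightarrow> ('o, 'm) seq" where
  "final_trivial \<C> n A =
     (let X = (\<lambda>i. if i < n then zero_object \<C> else A)
      in \<lparr>ob = X, df = (\<lambda>i. if i = n then idt \<C> A else zerom \<C> (X i) (X (i + 1)))\<rparr>)"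

locale exact_realization = biadditive_bifunctor \<C> E
  for \<C> :: "('o, 'm) cat" (structure) and E :: "('o, 'm, 'e) bifunctor" +
  fixes n :: nat and s :: "'o \<Rightarrow> 'o \<Rightarrow> 'e \<Rightarrow> ('o, 'm) seq set"
  assumes realizes: "\<lbrakk>C \<in> Obj \<C>; A \<in> Obj \<C>; \<delta> \<in> carrier (egrp E C A)\<rbrakk>
      \<Longrightarrow> \<exists>X \<in> complexes_between \<C> n A C. s C A \<delta> = homotopy_class \<C> n A C X"
    and R0: "\<lbrakk>distinguished \<C> E n s X \<delta>; distinguished \<C> E n s Y \<rho>;
        a \<in> Mor \<C> (ob X 0) (ob Y 0); c \<in> Mor \<C> (ob X (n + 1)) (ob Y (n + 1));
        push \<C> E (ob X (n + 1)) a \<delta> = pull \<C> E (ob Y 0) c \<rho>\<rbrakk>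
      \<Longrightarrow> \<exists>f. chain_map \<C> n X Y f \<and> f 0 = a \<and> f (n + 1) = c"
    and R1: "distinguished \<C> E n s X \<delta> \<Longrightarrow> n_exangle \<C> E n X \<delta>"
    and R2_initial: "A \<in> Obj \<C> \<Longrightarrow>
        s (zero_object \<C>) A \<one>\<^bsub>egrp E (zero_object \<C>) A\<^esub>
        = homotopy_class \<C> n A (zero_object \<C>) (initial_trivial \<C> A)"
    and R2_final: "A \<in> Obj \<C> \<Longrightarrow>
        s A (zero_object \<C>) \<one>\<^bsub>egrp E A (zero_object \<C>)\<^esub>
        = homotopy_class \<C> n (zero_object \<C>) A (final_trivial \<C> n A)"

definition inflation ::
  "('o, 'm) cat \<Rightarrow> ('o, 'm, 'e) bifunctor \<Rightarrow> nat \<Rightarrow> ('o \<Rightarrow> 'o \<Rightarrow> 'e \<Rightarrow> ('o, 'm) seq set) \<Rightarrow> 'm \<Rightarrow> bool" where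
  "inflation \<C> E n s f \<longleftrightarrow> (\<exists>X \<delta>. distinguished \<C> E n s X \<delta> \<and> f = df X 0)"

definition deflation ::
  "('o, 'm) cat \<Rightarrow> ('o, 'm, 'e) bifunctor \<Rightarrow> nat \<Rightarrow> ('o \<Rightarrow> 'o \<Rightarrow> 'e \<Rightarrow> ('o, 'm) seq set) \<Rightarrow> 'm \<Rightarrow> bool" where
  "deflation \<C> E n s f \<longleftrightarrow> (\<exists>X \<delta>. distinguished \<C> E n s X \<delta> \<and> f = df X n)"

definition mapping_cone ::
  "('o, 'm) cat \<Rightarrow> nat \<Rightarrow> ('o, 'm) seq \<Rightarrow> ('o, 'm) seq \<Rightarrow> (nat \<Rightarrow> 'm) \<Rightarrow> ('o, 'm) seq" where
  "mapping_cone \<C> n X Y f =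
     \<lparr>ob = (\<lambda>i. if i = 0 then ob X 1
                else if i \<le> n then dsum \<C> (ob X (i + 1)) (ob Y i)
                else ob Y (n + 1)),
      df = (\<lambda>i. if i = 0 then colm \<C> (neg \<C> (df X 1)) (f 1)
                else if i < n then
                  matm \<C> (neg \<C> (df X (i + 1))) (zerom \<C> (ob Y i) (ob X (i + 2)))
                         (f (i + 1))           (df Y i)
                else rowm \<C> (f (n + 1)) (df Y n))\<rparr>"

definition mapping_cocone ::
  "('o, 'm) cat \<Rightarrow> nat \<Rightarrow> ('o, 'm) seq \<Rightarrow> ('o, 'm) seq \<Rightarrow> (nat \<Rightarrow> 'm) \<Rightarrow> ('o, 'm) seq" where
  "mapping_cocone \<C> n X Y h =
     \<lparr>ob = (\<lambda>i. if i = 0 then ob X 0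
                else if i \<le> n then dsum \<C> (ob X i) (ob Y (i - 1))
                else ob Y n),
      df = (\<lambda>i. if i = 0 then colm \<C> (df X 0) (h 0)
                else if i < n then
                  matm \<C> (df X i) (zerom \<C> (ob Y (i - 1)) (ob X (i + 1)))
                         (h i)    (neg \<C> (df Y (i - 1)))
                else rowm \<C> (h n) (neg \<C> (df Y (n - 1))))\<rparr>"

locale n_exangulated_category =
  additive_category \<C> + exact_realization \<C> E n s
  for \<C> :: "('o, 'm) cat" (structure) and E :: "('o, 'm, 'e) bifunctor"
    and n :: nat and s :: "'o \<Rightarrow> 'o \<Rightarrow> 'e \<Rightarrow> ('o, 'm) seq set" +
  assumes n_pos: "n \<ge> 1"
    and EA1_inflation: "\<lbrakk>inflation \<C> E n s f; inflation \<C> E n s g; tgt \<C> f = src \<C> g\<rbrakk>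
      \<Longrightarrow> inflation \<C> E n s (g \<cdot> f)"
    and EA1_deflation: "\<lbrakk>deflation \<C> E n s f; deflation \<C> E n s g; tgt \<C> f = src \<C> g\<rbrakk>
      \<Longrightarrow> deflation \<C> E n s (g \<cdot> f)"
    and EA2: "\<lbrakk>A \<in> Obj \<C>; C \<in> Obj \<C>; D \<in> Obj \<C>; \<rho> \<in> carrier (egrp E D A); c \<in> Mor \<C> C D;
        distinguished \<C> E n s X (pull \<C> E A c \<rho>); ob X 0 = A; ob X (n + 1) = C;
        distinguished \<C> E n s Y \<rho>; ob Y 0 = A; ob Y (n + 1) = D\<rbrakk>
      \<Longrightarrow> \<exists>f. chain_map \<C> n X Y f \<and> f 0 = idt \<C> A \<and> f (n + 1) = c \<and>
            distinguished \<C> E n s (mapping_cone \<C> n X Y f) (push \<C> E D (df X 0) \<rho>)"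
    and EA2_op: "\<lbrakk>A \<in> Obj \<C>; B \<in> Obj \<C>; C \<in> Obj \<C>; \<delta> \<in> carrier (egrp E C A); a \<in> Mor \<C> A B;
        distinguished \<C> E n s X \<delta>; ob X 0 = A; ob X (n + 1) = C;
        distinguished \<C> E n s Y (push \<C> E C a \<delta>); ob Y 0 = B; ob Y (n + 1) = C\<rbrakk>
      \<Longrightarrow> \<exists>h. chain_map \<C> n X Y h \<and> h 0 = a \<and> h (n + 1) = idt \<C> C \<and>
            distinguished \<C> E n s (mapping_cocone \<C> n X Y h) (pull \<C> E A (df Y n) \<delta>)"


section \<open>\<open>(n + 2)\<close>-angulated categories\<close>

text \<open>
  An \<open>(n + 2)\<close>-\<open>\<Sigma>\<close>-sequence is a pair of a sequence \<open>X\<close>, not assumed to be a complex, and a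
  morphism from \<open>X\<^sup>n\<^sup>+\<^sup>1\<close> to \<open>\<Sigma> X\<^sup>0\<close>.
\<close>

type_synonym ('o, 'm) sigma_seq = "('o, 'm) seq \<times> 'm"

definition sigma_sequences ::
  "('o, 'm) cat \<Rightarrow> ('o, 'm) endo \<Rightarrow> nat \<Rightarrow> ('o, 'm) sigma_seq set" where
  "sigma_sequences \<C> \<Sigma> n =
     {(X, \<delta>). sequence \<C> n X \<and> \<delta> \<in> Mor \<C> (ob X (n + 1)) (on_ob \<Sigma> (ob X 0))}"

definition sigma_morphism ::
  "('o, 'm) cat \<Rightarrow> ('o, 'm) endo \<Rightarrow> nat \<Rightarrow> ('o, 'm) sigma_seq \<Rightarrow> ('o, 'm) sigma_seq
   \<Rightarrow> (nat \<Rightarrow> 'm) \<Rightarrow> bool" where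
  "sigma_morphism \<C> \<Sigma> n = (\<lambda>(X, \<delta>) (Y, \<rho>) f.
     (\<forall>i\<le>n + 1. f i \<in> Mor \<C> (ob X i) (ob Y i)) \<and>
     (\<forall>i\<le>n. f (i + 1) \<cdot>\<^bsub>\<C>\<^esub> df X i = df Y i \<cdot>\<^bsub>\<C>\<^esub> f i) \<and>
     on_arr \<Sigma> (f 0) \<cdot>\<^bsub>\<C>\<^esub> \<delta> = \<rho> \<cdot>\<^bsub>\<C>\<^esub> f (n + 1))"

definition sigma_isomorphic ::
  "('o, 'm) cat \<Rightarrow> ('o, 'm) endo \<Rightarrow> nat \<Rightarrow> ('o, 'm) sigma_seq \<Rightarrow> ('o, 'm) sigma_seq \<Rightarrow> bool" where
  "sigma_isomorphic \<C> \<Sigma> n S T \<longleftrightarrow> (\<exists>f g.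
     sigma_morphism \<C> \<Sigma> n S T f \<and> sigma_morphism \<C> \<Sigma> n T S g \<and>
     (\<forall>i\<le>n + 1. g i \<cdot>\<^bsub>\<C>\<^esub> f i = idt \<C> (ob (fst S) i) \<and> f i \<cdot>\<^bsub>\<C>\<^esub> g i = idt \<C> (ob (fst T) i)))"

text \<open>
  The column with entries \<open>f\<close> and \<open>g\<close> into \<open>\<Sigma> A \<oplus> \<Sigma> B\<close>, read as a morphism into \<open>\<Sigma> (A \<oplus> B)\<close>
  through the canonical identification of these two objects.
\<close>

definition sigma_colm ::
  "('o, 'm) cat \<Rightarrow> ('o, 'm) endo \<Rightarrow> 'o \<Rightarrow> 'o \<Rightarrow> 'm \<Rightarrow> 'm \<Rightarrow> 'm" where
  "sigma_colm \<C> \<Sigma> A B f g =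
     (on_arr \<Sigma> (inj1 \<C> A B) \<cdot>\<^bsub>\<C>\<^esub> f) \<boxplus>\<^bsub>\<C>\<^esub> (on_arr \<Sigma> (inj2 \<C> A B) \<cdot>\<^bsub>\<C>\<^esub> g)"

definition sigma_dsum ::
  "('o, 'm) cat \<Rightarrow> ('o, 'm) endo \<Rightarrow> nat \<Rightarrow> ('o, 'm) sigma_seq \<Rightarrow> ('o, 'm) sigma_seq
   \<Rightarrow> ('o, 'm) sigma_seq" where
  "sigma_dsum \<C> \<Sigma> n = (\<lambda>(X, \<delta>) (Y, \<rho>).
     (\<lparr>ob = (\<lambda>i. dsum \<C> (ob X i) (ob Y i)),
       df = (\<lambda>i. matm \<C> (df X i) (zerom \<C> (ob Y i) (ob X (i + 1)))
                        (zerom \<C> (ob X i) (ob Y (i + 1))) (df Y i))\<rparr>,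
      sigma_colm \<C> \<Sigma> (ob X 0) (ob Y 0)
        (rowm \<C> \<delta> (zerom \<C> (ob Y (n + 1)) (on_ob \<Sigma> (ob X 0))))
        (rowm \<C> (zerom \<C> (ob X (n + 1)) (on_ob \<Sigma> (ob Y 0))) \<rho>)))"

definition rotation ::
  "('o, 'm) cat \<Rightarrow> ('o, 'm) endo \<Rightarrow> nat \<Rightarrow> ('o, 'm) sigma_seq \<Rightarrow> ('o, 'm) sigma_seq" where
  "rotation \<C> \<Sigma> n = (\<lambda>(X, \<delta>).
     (\<lparr>ob = (\<lambda>i. if i \<le> n then ob X (i + 1) else on_ob \<Sigma> (ob X 0)),
       df = (\<lambda>i. if i < n then df X (i + 1) else \<delta>)\<rparr>,
      (neg \<C> ^^ n) (on_arr \<Sigma> (df X 0))))"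

definition sigma_cone ::
  "('o, 'm) cat \<Rightarrow> ('o, 'm) endo \<Rightarrow> nat \<Rightarrow> ('o, 'm) sigma_seq \<Rightarrow> ('o, 'm) sigma_seq
   \<Rightarrow> (nat \<Rightarrow> 'm) \<Rightarrow> ('o, 'm) sigma_seq" where
  "sigma_cone \<C> \<Sigma> n = (\<lambda>(X, \<delta>) (Y, \<rho>) f.
     (let X' = (\<lambda>i. if i \<le> n + 1 then ob X i else on_ob \<Sigma> (ob X 0));
          d' = (\<lambda>i. if i \<le> n then df X i else \<delta>)
      in (\<lparr>ob = (\<lambda>i. dsum \<C> (X' (i + 1)) (ob Y i)),
           df = (\<lambda>i. matm \<C> (neg \<C> (d' (i + 1))) (zerom \<C> (ob Y i) (X' (i + 2)))
                            (f (i + 1))          (df Y i))\<rparr>,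
          sigma_colm \<C> \<Sigma> (ob X 1) (ob Y 0)
            (rowm \<C> (neg \<C> (on_arr \<Sigma> (df X 0))) (zerom \<C> (ob Y (n + 1)) (on_ob \<Sigma> (ob X 1))))
            (rowm \<C> (on_arr \<Sigma> (f 0)) \<rho>))))"

locale n_angulated_category = additive_category \<C>
  for \<C> :: "('o, 'm) cat" (structure) +
  fixes \<Sigma> :: "('o, 'm) endo" and n :: nat and angles :: "('o, 'm) sigma_seq set"
  assumes n_pos: "n \<ge> 1"
    and automorphism: "automorphism \<C> \<Sigma>"
    and angles_sub: "angles \<subseteq> sigma_sequences \<C> \<Sigma> n"
    and angles_iso: "\<lbrakk>S \<in> angles; T \<in> sigma_sequences \<C> \<Sigma> n; sigma_isomorphic \<C> \<Sigma> n S T\<rbrakk>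
      \<Longrightarrow> T \<in> angles"
    and F1a_sum: "\<lbrakk>S \<in> angles; T \<in> angles\<rbrakk> \<Longrightarrow> sigma_dsum \<C> \<Sigma> n S T \<in> angles"
    and F1a_summand: "\<lbrakk>S \<in> sigma_sequences \<C> \<Sigma> n; S' \<in> sigma_sequences \<C> \<Sigma> n; T \<in> angles;
        sigma_isomorphic \<C> \<Sigma> n T (sigma_dsum \<C> \<Sigma> n S S')\<rbrakk> \<Longrightarrow> S \<in> angles"
    and F1b: "A \<in> Obj \<C> \<Longrightarrow>
        (initial_trivial \<C> A, zerom \<C> (zero_object \<C>) (on_ob \<Sigma> A)) \<in> angles"
    and F1c: "\<lbrakk>A \<in> Obj \<C>; B \<in> Obj \<C>; f \<in> Mor \<C> A B\<rbrakk> \<Longrightarrow> \<exists>X \<delta>. (X, \<delta>) \<in> angles \<and> df X 0 = f"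
    and F2: "S \<in> sigma_sequences \<C> \<Sigma> n \<Longrightarrow> S \<in> angles \<longleftrightarrow> rotation \<C> \<Sigma> n S \<in> angles"
    and F3: "\<lbrakk>(X, \<delta>) \<in> angles; (Y, \<rho>) \<in> angles;
        f0 \<in> Mor \<C> (ob X 0) (ob Y 0); f1 \<in> Mor \<C> (ob X 1) (ob Y 1);
        f1 \<cdot> df X 0 = df Y 0 \<cdot> f0\<rbrakk>
      \<Longrightarrow> \<exists>f. f 0 = f0 \<and> f 1 = f1 \<and> sigma_morphism \<C> \<Sigma> n (X, \<delta>) (Y, \<rho>) f"
    and F4: "\<lbrakk>(X, \<delta>) \<in> angles; (Y, \<rho>) \<in> angles;
        f0 \<in> Mor \<C> (ob X 0) (ob Y 0); f1 \<in> Mor \<C> (ob X 1) (ob Y 1);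
        f1 \<cdot> df X 0 = df Y 0 \<cdot> f0\<rbrakk>
      \<Longrightarrow> \<exists>f. f 0 = f0 \<and> f 1 = f1 \<and> sigma_morphism \<C> \<Sigma> n (X, \<delta>) (Y, \<rho>) f \<and>
            sigma_cone \<C> \<Sigma> n (X, \<delta>) (Y, \<rho>) f \<in> angles"


section \<open>The bifunctor and the class of sequences induced by \<open>\<Sigma>\<close>\<close>

definition sigma_bifunctor :: "('o, 'm) cat \<Rightarrow> ('o, 'm) endo \<Rightarrow> ('o, 'm, 'm) bifunctor" where
  "sigma_bifunctor \<C> \<Sigma> =
     \<lparr>egrp = (\<lambda>C A. Mor_group \<C> C (on_ob \<Sigma> A)),
      eact = (\<lambda>c a \<delta>. (on_arr \<Sigma> a \<cdot>\<^bsub>\<C>\<^esub> \<delta>) \<cdot>\<^bsub>\<C>\<^esub> c)\<rparr>"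

definition distinguished_sigma_sequences ::
  "('o, 'm) cat \<Rightarrow> ('o, 'm) endo \<Rightarrow> nat \<Rightarrow> ('o \<Rightarrow> 'o \<Rightarrow> 'm \<Rightarrow> ('o, 'm) seq set)
   \<Rightarrow> ('o, 'm) sigma_seq set" where
  "distinguished_sigma_sequences \<C> \<Sigma> n s =
     {(X, \<delta>) \<in> sigma_sequences \<C> \<Sigma> n. distinguished \<C> (sigma_bifunctor \<C> \<Sigma>) n s X \<delta>}"

end

theory Submission
  imports Defs
begin

text \<open>
  Since \<open>E(C, A) = C(C, \<Sigma> A)\<close>, the identity of \<open>\<Sigma> A\<close> is an extension, and exactness forces its
  realization to be \<open>A \<rightarrow> 0 \<rightarrow> \<dots> \<rightarrow> 0 \<rightarrow> \<Sigma> A\<close>. Every extension is a pull-back and a push-forward of such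
  an identity, and for these the mapping cone of (EA2) and the mapping cocone of (EA2op) are, up to
  signs, the two rotations; this gives (F2) and (F1)(c). Closure under sums, summands and
  isomorphism holds because two exact complexes with chain maps in both directions that fix the
  ends are homotopy equivalent, so that (R0) recognizes distinguished complexes.

  For (F4), the cone of \<open>(f\<^sup>0, f\<^sup>1)\<close> is reduced to the case \<open>f\<^sup>0 = 1\<close>: replace \<open>X\<close> by its sum with
  \<open>Y\<^sup>0 = Y\<^sup>0\<close>, with first differential twisted by \<open>f\<^sup>0\<close>, and \<open>Y\<close> by its sum with
  \<open>X\<^sup>0 \<rightarrow> 0 \<rightarrow> \<dots> \<rightarrow> \<Sigma> X\<^sup>0\<close>. Both start with \<open>X\<^sup>0 \<oplus> Y\<^sup>0\<close>, and (EA2op), applied to their rotations, yields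
  the cone of \<open>f\<close>. (F3) is contained in (F4).
\<close>

section \<open>Calculus in additive categories\<close>

text \<open>Two obstacles shape the proof. Being distinguished is an equality of homotopy classes
  with fixed ends, whereas (R0) yields chain maps and no homotopies. For opposite chain maps f and g
  with identity ends let u = g f. Exactness writes 1 - u as \<phi> d + d \<phi> except in the last
  degree, which is enough to make (1 - u)^2 null-homotopic. As 1 - (1 - u)^2 = 2u - u^2, replacing g
  by 2g - gfg gives a homotopy inverse of f. The other obstacle is that (EA2) and (EA2op) only treat
  morphisms with an identity at one end, and that cone, cocone and rotation distribute signs
  differently. The signs are absorbed by isomorphisms that are +1 or -1 on each component; the sign
  (-1)^n of the rotation is what remains when the n differentials -d of a cone are straightened. For
  (F4), the twisted differential with rows (d, 0) and (f^0, -1) is chosen so that the row [f^1 -d]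
  turns it into [0 d]: the relation between f^0 and f^1 becomes an equation between one extension
  and a push-forward of another.\<close>

context preadditive_category
begin

lemma MorI [intro?]: "\<lbrakk>f \<in> Arr \<C>; src \<C> f = A; tgt \<C> f = B\<rbrakk> \<Longrightarrow> f \<in> Mor \<C> A B"
  by (simp add: Mor_def)

lemma arr_obj [simp]: "f \<in> Arr \<C> \<Longrightarrow> src \<C> f \<in> Obj \<C>" "f \<in> Arr \<C> \<Longrightarrow> tgt \<C> f \<in> Obj \<C>"
  by (rule src_Obj tgt_Obj, assumption)+

lemma idt_arr [simp]:
  assumes "A \<in> Obj \<C>"
  shows "idt \<C> A \<in> Arr \<C>" "src \<C> (idt \<C> A) = A" "tgt \<C> (idt \<C> A) = A"
  using idt_Mor[OF assms] by (simp_all add: Mor_def)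

text \<open>Typing is stated through \<open>Arr\<close>, \<open>src\<close> and \<open>tgt\<close>
  instead of \<open>Mor\<close>: composability then is an equation between objects, and no
  intermediate object has to be guessed.\<close>

lemma cmp_arr [simp]:
  assumes "f \<in> Arr \<C>" "g \<in> Arr \<C>" "tgt \<C> f = src \<C> g"
  shows "g \<cdot> f \<in> Arr \<C>" "src \<C> (g \<cdot> f) = src \<C> f" "tgt \<C> (g \<cdot> f) = tgt \<C> g"
  using cmp_Mor[of f "src \<C> f" "tgt \<C> f" g "tgt \<C> g"] assms by (simp_all add: Mor_def)

lemma cmp_assoc_arr [simp]:
  "\<lbrakk>f \<in> Arr \<C>; g \<in> Arr \<C>; h \<in> Arr \<C>; tgt \<C> f = src \<C> g; tgt \<C> g = src \<C> h\<rbrakk>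
    \<Longrightarrow> (h \<cdot> g) \<cdot> f = h \<cdot> (g \<cdot> f)"
  using cmp_assoc[of f "src \<C> f" "tgt \<C> f" g "tgt \<C> g" h "tgt \<C> h"] by (simp add: Mor_def)

lemma cmp_idt [simp]:
  "\<lbrakk>f \<in> Arr \<C>; src \<C> f = A\<rbrakk> \<Longrightarrow> f \<cdot> idt \<C> A = f"
  "\<lbrakk>f \<in> Arr \<C>; tgt \<C> f = B\<rbrakk> \<Longrightarrow> idt \<C> B \<cdot> f = f"
  using cmp_idt_right[of f A "tgt \<C> f"] cmp_idt_left[of f "src \<C> f" B] by (simp_all add: Mor_def)

lemma zerom_arr [simp]:
  assumes "A \<in> Obj \<C>" "B \<in> Obj \<C>"
  shows "zerom \<C> A B \<in> Arr \<C>" "src \<C> (zerom \<C> A B) = A" "tgt \<C> (zerom \<C> A B) = B"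
proof -
  interpret M: comm_group "Mor_group \<C> A B" using assms by (rule Mor_comm_group)
  have "zerom \<C> A B \<in> Mor \<C> A B" using M.one_closed by (simp add: Mor_group_def)
  thus "zerom \<C> A B \<in> Arr \<C>" "src \<C> (zerom \<C> A B) = A" "tgt \<C> (zerom \<C> A B) = B"
    by (simp_all add: Mor_def)
qed

lemma add_arr [simp]:
  assumes "f \<in> Arr \<C>" "g \<in> Arr \<C>" "src \<C> f = src \<C> g" "tgt \<C> f = tgt \<C> g"
  shows "f \<boxplus> g \<in> Arr \<C>" "src \<C> (f \<boxplus> g) = src \<C> g" "tgt \<C> (f \<boxplus> g) = tgt \<C> g"
proof -
  interpret M: comm_group "Mor_group \<C> (src \<C> g) (tgt \<C> g)"
    using assms by (intro Mor_comm_group) auto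
  have "f \<boxplus> g \<in> Mor \<C> (src \<C> g) (tgt \<C> g)"
    using M.m_closed[of f g] assms by (simp add: Mor_group_def Mor_def)
  thus "f \<boxplus> g \<in> Arr \<C>" "src \<C> (f \<boxplus> g) = src \<C> g" "tgt \<C> (f \<boxplus> g) = tgt \<C> g"
    by (simp_all add: Mor_def)
qed

lemma add_assoc [simp]:
  assumes "f \<in> Arr \<C>" "g \<in> Arr \<C>" "h \<in> Arr \<C>" "src \<C> f = src \<C> g" "tgt \<C> f = tgt \<C> g"
    "src \<C> g = src \<C> h" "tgt \<C> g = tgt \<C> h"
  shows "(f \<boxplus> g) \<boxplus> h = f \<boxplus> (g \<boxplus> h)"
proof -
  interpret M: comm_group "Mor_group \<C> (src \<C> h) (tgt \<C> h)"
    using assms by (intro Mor_comm_group) auto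
  show ?thesis using M.m_assoc[of f g h] assms by (simp add: Mor_group_def Mor_def)
qed

lemma add_commute:
  assumes "f \<in> Arr \<C>" "g \<in> Arr \<C>" "src \<C> f = src \<C> g" "tgt \<C> f = tgt \<C> g"
  shows "f \<boxplus> g = g \<boxplus> f"
proof -
  interpret M: comm_group "Mor_group \<C> (src \<C> g) (tgt \<C> g)"
    using assms by (intro Mor_comm_group) auto
  show ?thesis using M.m_comm[of f g] assms by (simp add: Mor_group_def Mor_def)
qed

lemma add_left_commute:
  assumes "f \<in> Arr \<C>" "g \<in> Arr \<C>" "h \<in> Arr \<C>" "src \<C> f = src \<C> g" "tgt \<C> f = tgt \<C> g"
    "src \<C> g = src \<C> h" "tgt \<C> g = tgt \<C> h"
  shows "f \<boxplus> (g \<boxplus> h) = g \<boxplus> (f \<boxplus> h)"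
  using assms by (metis add_assoc add_commute)

lemmas add_ac = add_commute add_left_commute

lemma add_zerom [simp]:
  assumes "f \<in> Arr \<C>" "src \<C> f = A" "tgt \<C> f = B"
  shows "f \<boxplus> zerom \<C> A B = f" "zerom \<C> A B \<boxplus> f = f"
proof -
  interpret M: comm_group "Mor_group \<C> A B"
    using assms by (intro Mor_comm_group) auto
  show "f \<boxplus> zerom \<C> A B = f" "zerom \<C> A B \<boxplus> f = f"
    using M.r_one[of f] M.l_one[of f] assms by (simp_all add: Mor_group_def Mor_def)
qed

lemma neg_arr [simp]:
  assumes "f \<in> Arr \<C>"
  shows "neg \<C> f \<in> Arr \<C>" "src \<C> (neg \<C> f) = src \<C> f" "tgt \<C> (neg \<C> f) = tgt \<C> f"
proof -
  interpret M: comm_group "Mor_group \<C> (src \<C> f) (tgt \<C> f)"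
    using assms by (intro Mor_comm_group) auto
  have "neg \<C> f \<in> carrier (Mor_group \<C> (src \<C> f) (tgt \<C> f))"
    unfolding neg_def using assms by (intro M.inv_closed) (simp add: Mor_group_def Mor_def)
  thus "neg \<C> f \<in> Arr \<C>" "src \<C> (neg \<C> f) = src \<C> f" "tgt \<C> (neg \<C> f) = tgt \<C> f"
    by (simp_all add: Mor_group_def Mor_def)
qed

lemma add_neg [simp]:
  assumes "f \<in> Arr \<C>"
  shows "f \<boxplus> neg \<C> f = zerom \<C> (src \<C> f) (tgt \<C> f)" "neg \<C> f \<boxplus> f = zerom \<C> (src \<C> f) (tgt \<C> f)"
proof -
  interpret M: comm_group "Mor_group \<C> (src \<C> f) (tgt \<C> f)"
    using assms by (intro Mor_comm_group) auto
  show "f \<boxplus> neg \<C> f = zerom \<C> (src \<C> f) (tgt \<C> f)"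
    "neg \<C> f \<boxplus> f = zerom \<C> (src \<C> f) (tgt \<C> f)"
    unfolding neg_def using M.r_inv[of f] M.l_inv[of f] assms
    by (simp_all add: Mor_group_def Mor_def)
qed

lemma add_neg_cancel [simp]:
  assumes "f \<in> Arr \<C>" "g \<in> Arr \<C>" "src \<C> f = src \<C> g" "tgt \<C> f = tgt \<C> g"
  shows "f \<boxplus> (neg \<C> f \<boxplus> g) = g" "neg \<C> f \<boxplus> (f \<boxplus> g) = g"
  using add_assoc[of f "neg \<C> f" g] add_assoc[of "neg \<C> f" f g] assms by (simp_all del: add_assoc)

lemma add_left_cancel:
  assumes "f \<in> Arr \<C>" "g \<in> Arr \<C>" "h \<in> Arr \<C>" "src \<C> f = src \<C> g" "tgt \<C> f = tgt \<C> g"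
    "src \<C> f = src \<C> h" "tgt \<C> f = tgt \<C> h" "f \<boxplus> g = f \<boxplus> h"
  shows "g = h"
  using assms by (metis add_neg_cancel(2))

lemma neg_unique:
  assumes "f \<in> Arr \<C>" "g \<in> Arr \<C>" "src \<C> f = src \<C> g" "tgt \<C> f = tgt \<C> g"
    "f \<boxplus> g = zerom \<C> (src \<C> f) (tgt \<C> f)"
  shows "neg \<C> f = g"
  by (rule add_left_cancel[of f]) (use assms in simp_all)

lemma neg_neg [simp]: "f \<in> Arr \<C> \<Longrightarrow> neg \<C> (neg \<C> f) = f"
  by (rule neg_unique) simp_all

lemma neg_zerom [simp]: "\<lbrakk>A \<in> Obj \<C>; B \<in> Obj \<C>\<rbrakk> \<Longrightarrow> neg \<C> (zerom \<C> A B) = zerom \<C> A B"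
  by (rule neg_unique) simp_all

lemma cmp_add [simp]:
  "\<lbrakk>f \<in> Arr \<C>; g \<in> Arr \<C>; h \<in> Arr \<C>; src \<C> g = src \<C> h; tgt \<C> g = tgt \<C> h; tgt \<C> f = src \<C> h\<rbrakk>
    \<Longrightarrow> (g \<boxplus> h) \<cdot> f = (g \<cdot> f) \<boxplus> (h \<cdot> f)"
  "\<lbrakk>f \<in> Arr \<C>; g \<in> Arr \<C>; h \<in> Arr \<C>; src \<C> f = src \<C> g; tgt \<C> f = tgt \<C> g; tgt \<C> g = src \<C> h\<rbrakk>
    \<Longrightarrow> h \<cdot> (f \<boxplus> g) = (h \<cdot> f) \<boxplus> (h \<cdot> g)"
  using cmp_add_left[of f "src \<C> f" "src \<C> h" g "tgt \<C> h" h]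
    cmp_add_right[of f "src \<C> g" "tgt \<C> g" g h "tgt \<C> h"]
  by (simp_all add: Mor_def)

lemma cmp_zerom [simp]:
  assumes "A \<in> Obj \<C>" "g \<in> Arr \<C>"
  shows "src \<C> g = B \<Longrightarrow> g \<cdot> zerom \<C> A B = zerom \<C> A (tgt \<C> g)"
    "tgt \<C> g = B \<Longrightarrow> zerom \<C> B A \<cdot> g = zerom \<C> (src \<C> g) A"
proof -
  assume B: "src \<C> g = B"
  let ?z = "zerom \<C> A B"
  show "g \<cdot> ?z = zerom \<C> A (tgt \<C> g)"
    by (rule add_left_cancel[of "g \<cdot> ?z"])
      (use assms B cmp_add(2)[of ?z ?z g] in \<open>auto simp del: cmp_add\<close>)
next
  assume B: "tgt \<C> g = B"
  let ?z = "zerom \<C> B A"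
  show "?z \<cdot> g = zerom \<C> (src \<C> g) A"
    by (rule add_left_cancel[of "?z \<cdot> g"])
      (use assms B cmp_add(1)[of g ?z ?z] in \<open>auto simp del: cmp_add\<close>)
qed

lemma cmp_neg [simp]:
  assumes "f \<in> Arr \<C>" "g \<in> Arr \<C>" "tgt \<C> f = src \<C> g"
  shows "neg \<C> g \<cdot> f = neg \<C> (g \<cdot> f)" "g \<cdot> neg \<C> f = neg \<C> (g \<cdot> f)"
proof -
  have "neg \<C> (g \<cdot> f) = neg \<C> g \<cdot> f" using assms cmp_add(1)[of f g "neg \<C> g"]
    by (intro neg_unique) simp_all
  thus "neg \<C> g \<cdot> f = neg \<C> (g \<cdot> f)" by simp
  have "neg \<C> (g \<cdot> f) = g \<cdot> neg \<C> f" using assms cmp_add(2)[of f "neg \<C> f" g]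
    by (intro neg_unique) simp_all
  thus "g \<cdot> neg \<C> f = neg \<C> (g \<cdot> f)" by simp
qed

lemma neg_add [simp]:
  assumes "f \<in> Arr \<C>" "g \<in> Arr \<C>" "src \<C> f = src \<C> g" "tgt \<C> f = tgt \<C> g"
  shows "neg \<C> (f \<boxplus> g) = neg \<C> f \<boxplus> neg \<C> g"
  using assms add_left_commute[of g "neg \<C> f" "neg \<C> g"] by (intro neg_unique) simp_all

text \<open>Composites are kept nested to the right, where \<open>g \<cdot> f\<close> is not a
  subterm of \<open>g \<cdot> (f \<cdot> h)\<close>. A commuting square is therefore applied to a
  longer composite in this form.\<close>

lemma cmp_cong_right:
  assumes "g \<cdot> f = g' \<cdot> f'" "f \<in> Arr \<C>" "g \<in> Arr \<C>" "f' \<in> Arr \<C>" "g' \<in> Arr \<C>" "h \<in> Arr \<C>"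
    "tgt \<C> f = src \<C> g" "tgt \<C> f' = src \<C> g'" "tgt \<C> h = src \<C> f" "tgt \<C> h = src \<C> f'"
  shows "g \<cdot> (f \<cdot> h) = g' \<cdot> (f' \<cdot> h)"
  using assms by (metis cmp_assoc_arr)

lemma cmp_zerom_right:
  assumes "g \<cdot> f = zerom \<C> A B" "f \<in> Arr \<C>" "g \<in> Arr \<C>" "h \<in> Arr \<C>"
    "tgt \<C> f = src \<C> g" "tgt \<C> h = src \<C> f" "src \<C> f = A" "tgt \<C> g = B"
  shows "g \<cdot> (f \<cdot> h) = zerom \<C> (src \<C> h) B"
  using assms cmp_assoc_arr[of h f g] by (auto simp del: cmp_assoc_arr)

lemma negs_arr [simp]:
  assumes "f \<in> Arr \<C>"
  shows "(neg \<C> ^^ k) f \<in> Arr \<C>" "src \<C> ((neg \<C> ^^ k) f) = src \<C> f"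
    "tgt \<C> ((neg \<C> ^^ k) f) = tgt \<C> f"
proof -
  have "(neg \<C> ^^ k) f \<in> Arr \<C> \<and> src \<C> ((neg \<C> ^^ k) f) = src \<C> f \<and>
    tgt \<C> ((neg \<C> ^^ k) f) = tgt \<C> f"
    by (induction k) (use assms in simp_all)
  thus "(neg \<C> ^^ k) f \<in> Arr \<C>" "src \<C> ((neg \<C> ^^ k) f) = src \<C> f"
    "tgt \<C> ((neg \<C> ^^ k) f) = tgt \<C> f" by simp_all
qed

lemma cmp_negs [simp]:
  assumes "f \<in> Arr \<C>" "g \<in> Arr \<C>" "tgt \<C> f = src \<C> g"
  shows "(neg \<C> ^^ k) g \<cdot> f = (neg \<C> ^^ k) (g \<cdot> f)" "g \<cdot> (neg \<C> ^^ k) f = (neg \<C> ^^ k) (g \<cdot> f)"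
  by (induction k) (use assms in simp_all)

lemma negs_neg [simp]: "(neg \<C> ^^ k) (neg \<C> f) = neg \<C> ((neg \<C> ^^ k) f)"
  by (induction k) simp_all

text \<open>(-1)^k is its own inverse. Hence the comparison maps below carry the same sign in both
  directions.\<close>

lemma negs_negs [simp]: "f \<in> Arr \<C> \<Longrightarrow> (neg \<C> ^^ k) ((neg \<C> ^^ k) f) = f"
  by (induction k) simp_all

lemma negs_zerom [simp]:
  "\<lbrakk>A \<in> Obj \<C>; B \<in> Obj \<C>\<rbrakk> \<Longrightarrow> (neg \<C> ^^ k) (zerom \<C> A B) = zerom \<C> A B"
  by (induction k) simp_all

lemma to_zero_object: "\<lbrakk>is_zero_object \<C> Z; f \<in> Arr \<C>; tgt \<C> f = Z\<rbrakk> \<Longrightarrow> f = zerom \<C> (src \<C> f) Z"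
  unfolding is_zero_object_def by (metis MorI arr_obj(1) zerom_arr)

lemma from_zero_object: "\<lbrakk>is_zero_object \<C> Z; f \<in> Arr \<C>; src \<C> f = Z\<rbrakk> \<Longrightarrow> f = zerom \<C> Z (tgt \<C> f)"
  unfolding is_zero_object_def by (metis MorI arr_obj(2) zerom_arr)

end

section \<open>Biproducts and block matrices\<close>

context additive_category
begin

lemma zero_object: "is_zero_object \<C> (zero_object \<C>)"
  unfolding zero_object_def using ex_zero_object by (rule someI_ex)

lemma zero_object_obj [simp]: "zero_object \<C> \<in> Obj \<C>"
  using zero_object by (simp add: is_zero_object_def)

lemma biproduct:
  assumes "A \<in> Obj \<C>" "B \<in> Obj \<C>"
  shows "is_biproduct \<C> A B (dsum \<C> A B, inj1 \<C> A B, inj2 \<C> A B, pr1 \<C> A B, pr2 \<C> A B)"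
proof -
  have "is_biproduct \<C> A B (biproduct \<C> A B)"
    unfolding biproduct_def using ex_biproduct[OF assms] by (rule someI_ex)
  thus ?thesis
    by (cases "biproduct \<C> A B") (simp add: dsum_def inj1_def inj2_def pr1_def pr2_def)
qed

lemma biproduct_simps [simp]:
  assumes "A \<in> Obj \<C>" "B \<in> Obj \<C>"
  shows "dsum \<C> A B \<in> Obj \<C>"
    "inj1 \<C> A B \<in> Arr \<C>" "src \<C> (inj1 \<C> A B) = A" "tgt \<C> (inj1 \<C> A B) = dsum \<C> A B"
    "inj2 \<C> A B \<in> Arr \<C>" "src \<C> (inj2 \<C> A B) = B" "tgt \<C> (inj2 \<C> A B) = dsum \<C> A B"
    "pr1 \<C> A B \<in> Arr \<C>" "src \<C> (pr1 \<C> A B) = dsum \<C> A B" "tgt \<C> (pr1 \<C> A B) = A"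
    "pr2 \<C> A B \<in> Arr \<C>" "src \<C> (pr2 \<C> A B) = dsum \<C> A B" "tgt \<C> (pr2 \<C> A B) = B"
    "pr1 \<C> A B \<cdot> inj1 \<C> A B = idt \<C> A" "pr2 \<C> A B \<cdot> inj2 \<C> A B = idt \<C> B"
    "pr1 \<C> A B \<cdot> inj2 \<C> A B = zerom \<C> B A" "pr2 \<C> A B \<cdot> inj1 \<C> A B = zerom \<C> A B"
    "(inj1 \<C> A B \<cdot> pr1 \<C> A B) \<boxplus> (inj2 \<C> A B \<cdot> pr2 \<C> A B) = idt \<C> (dsum \<C> A B)"
  using biproduct[OF assms] by (simp_all add: is_biproduct_def Mor_def)

lemma biproduct_cmp [simp]:
  assumes "A \<in> Obj \<C>" "B \<in> Obj \<C>" "f \<in> Arr \<C>"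
  shows "tgt \<C> f = A \<Longrightarrow> pr1 \<C> A B \<cdot> (inj1 \<C> A B \<cdot> f) = f"
    "tgt \<C> f = B \<Longrightarrow> pr2 \<C> A B \<cdot> (inj2 \<C> A B \<cdot> f) = f"
    "tgt \<C> f = B \<Longrightarrow> pr1 \<C> A B \<cdot> (inj2 \<C> A B \<cdot> f) = zerom \<C> (src \<C> f) A"
    "tgt \<C> f = A \<Longrightarrow> pr2 \<C> A B \<cdot> (inj1 \<C> A B \<cdot> f) = zerom \<C> (src \<C> f) B"
  using assms cmp_assoc_arr[of f "inj1 \<C> A B" "pr1 \<C> A B"] cmp_assoc_arr[of f "inj2 \<C> A B" "pr1 \<C> A B"]
    cmp_assoc_arr[of f "inj1 \<C> A B" "pr2 \<C> A B"] cmp_assoc_arr[of f "inj2 \<C> A B" "pr2 \<C> A B"]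
  by (simp_all del: cmp_assoc_arr)

lemma rowm_arr [simp]:
  assumes "f \<in> Arr \<C>" "g \<in> Arr \<C>" "tgt \<C> f = tgt \<C> g"
  shows "rowm \<C> f g \<in> Arr \<C>" "src \<C> (rowm \<C> f g) = dsum \<C> (src \<C> f) (src \<C> g)"
    "tgt \<C> (rowm \<C> f g) = tgt \<C> g"
  using assms by (simp_all add: rowm_def)

lemma colm_arr [simp]:
  assumes "f \<in> Arr \<C>" "g \<in> Arr \<C>" "src \<C> f = src \<C> g"
  shows "colm \<C> f g \<in> Arr \<C>" "src \<C> (colm \<C> f g) = src \<C> g"
    "tgt \<C> (colm \<C> f g) = dsum \<C> (tgt \<C> f) (tgt \<C> g)"
  using assms by (simp_all add: colm_def)

lemma pr_colm [simp]:
  assumes "f \<in> Arr \<C>" "g \<in> Arr \<C>" "src \<C> f = src \<C> g" "tgt \<C> f = A" "tgt \<C> g = B"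
  shows "pr1 \<C> A B \<cdot> colm \<C> f g = f" "pr2 \<C> A B \<cdot> colm \<C> f g = g"
  using assms by (auto simp: colm_def)

lemma rowm_inj [simp]:
  assumes "f \<in> Arr \<C>" "g \<in> Arr \<C>" "tgt \<C> f = tgt \<C> g" "src \<C> f = A" "src \<C> g = B"
  shows "rowm \<C> f g \<cdot> inj1 \<C> A B = f" "rowm \<C> f g \<cdot> inj2 \<C> A B = g"
  using assms by (auto simp: rowm_def)

lemma cmp_rowm [simp]:
  assumes "f \<in> Arr \<C>" "g \<in> Arr \<C>" "h \<in> Arr \<C>" "tgt \<C> f = tgt \<C> g" "tgt \<C> g = src \<C> h"
  shows "h \<cdot> rowm \<C> f g = rowm \<C> (h \<cdot> f) (h \<cdot> g)"
  using assms by (simp add: rowm_def)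

lemma colm_cmp [simp]:
  assumes "f \<in> Arr \<C>" "g \<in> Arr \<C>" "h \<in> Arr \<C>" "src \<C> f = src \<C> g" "src \<C> g = tgt \<C> h"
  shows "colm \<C> f g \<cdot> h = colm \<C> (f \<cdot> h) (g \<cdot> h)"
  using assms by (simp add: colm_def)

lemma rowm_cmp_colm [simp]:
  assumes "f \<in> Arr \<C>" "g \<in> Arr \<C>" "h \<in> Arr \<C>" "k \<in> Arr \<C>" "tgt \<C> f = tgt \<C> g" "src \<C> h = src \<C> k"
    "src \<C> f = tgt \<C> h" "src \<C> g = tgt \<C> k"
  shows "rowm \<C> f g \<cdot> colm \<C> h k = (f \<cdot> h) \<boxplus> (g \<cdot> k)"
  using assms by (simp add: rowm_def)

lemma inj_eq_colm:
  assumes "A \<in> Obj \<C>" "B \<in> Obj \<C>"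
  shows "inj1 \<C> A B = colm \<C> (idt \<C> A) (zerom \<C> A B)" "inj2 \<C> A B = colm \<C> (zerom \<C> B A) (idt \<C> B)"
  using assms by (simp_all add: colm_def)

lemma pr_eq_rowm:
  assumes "A \<in> Obj \<C>" "B \<in> Obj \<C>"
  shows "pr1 \<C> A B = rowm \<C> (idt \<C> A) (zerom \<C> B A)" "pr2 \<C> A B = rowm \<C> (zerom \<C> A B) (idt \<C> B)"
  using assms by (simp_all add: rowm_def)

lemma rowm_add [simp]:
  assumes "f \<in> Arr \<C>" "g \<in> Arr \<C>" "tgt \<C> f = tgt \<C> g" "f' \<in> Arr \<C>" "g' \<in> Arr \<C>" "tgt \<C> f' = tgt \<C> g'"
    "src \<C> f = src \<C> f'" "src \<C> g = src \<C> g'" "tgt \<C> g = tgt \<C> g'"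
  shows "rowm \<C> f g \<boxplus> rowm \<C> f' g' = rowm \<C> (f \<boxplus> f') (g \<boxplus> g')"
  using assms by (simp add: rowm_def add_ac)

lemma colm_add [simp]:
  assumes "f \<in> Arr \<C>" "g \<in> Arr \<C>" "src \<C> f = src \<C> g" "f' \<in> Arr \<C>" "g' \<in> Arr \<C>" "src \<C> f' = src \<C> g'"
    "tgt \<C> f = tgt \<C> f'" "tgt \<C> g = tgt \<C> g'" "src \<C> g = src \<C> g'"
  shows "colm \<C> f g \<boxplus> colm \<C> f' g' = colm \<C> (f \<boxplus> f') (g \<boxplus> g')"
  using assms by (simp add: colm_def add_ac)

lemma neg_rowm [simp]:
  assumes "f \<in> Arr \<C>" "g \<in> Arr \<C>" "tgt \<C> f = tgt \<C> g"
  shows "neg \<C> (rowm \<C> f g) = rowm \<C> (neg \<C> f) (neg \<C> g)"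
  using assms by (simp add: rowm_def)

lemma neg_colm [simp]:
  assumes "f \<in> Arr \<C>" "g \<in> Arr \<C>" "src \<C> f = src \<C> g"
  shows "neg \<C> (colm \<C> f g) = colm \<C> (neg \<C> f) (neg \<C> g)"
  using assms by (simp add: colm_def)

lemma rowm_zerom:
  assumes "A \<in> Obj \<C>" "B \<in> Obj \<C>" "D \<in> Obj \<C>"
  shows "rowm \<C> (zerom \<C> A D) (zerom \<C> B D) = zerom \<C> (dsum \<C> A B) D"
  using assms by (simp add: rowm_def)

lemma idt_dsum:
  assumes "A \<in> Obj \<C>" "B \<in> Obj \<C>"
  shows "idt \<C> (dsum \<C> A B) =
    colm \<C> (rowm \<C> (idt \<C> A) (zerom \<C> B A)) (rowm \<C> (zerom \<C> A B) (idt \<C> B))"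
  using assms by (simp add: colm_def flip: pr_eq_rowm)

lemma matm_arr [simp]:
  assumes "a \<in> Arr \<C>" "b \<in> Arr \<C>" "c \<in> Arr \<C>" "d \<in> Arr \<C>"
    "tgt \<C> a = tgt \<C> b" "tgt \<C> c = tgt \<C> d" "src \<C> a = src \<C> c" "src \<C> b = src \<C> d"
  shows "matm \<C> a b c d \<in> Arr \<C>" "src \<C> (matm \<C> a b c d) = dsum \<C> (src \<C> c) (src \<C> d)"
    "tgt \<C> (matm \<C> a b c d) = dsum \<C> (tgt \<C> b) (tgt \<C> d)"
  using assms by (simp_all add: matm_def)

text \<open>A column times a row expands both to a row of columns and to a column of rows. This
  orientation selects the latter, which is also the form of \<open>matm\<close>, so block matrices
  have one normal form.\<close>

lemma rowm_colm [simp]: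
  assumes "a \<in> Arr \<C>" "b \<in> Arr \<C>" "c \<in> Arr \<C>" "d \<in> Arr \<C>"
    "tgt \<C> a = tgt \<C> b" "tgt \<C> c = tgt \<C> d" "src \<C> a = src \<C> c" "src \<C> b = src \<C> d"
  shows "rowm \<C> (colm \<C> a c) (colm \<C> b d) = colm \<C> (rowm \<C> a b) (rowm \<C> c d)"
  using assms by (simp add: rowm_def colm_def add_ac)

lemma colm_zerom:
  assumes "A \<in> Obj \<C>" "B \<in> Obj \<C>" "D \<in> Obj \<C>"
  shows "colm \<C> (zerom \<C> D A) (zerom \<C> D B) = zerom \<C> D (dsum \<C> A B)"
  using assms by (simp add: colm_def)

lemma negs_rowm [simp]:
  assumes "f \<in> Arr \<C>" "g \<in> Arr \<C>" "tgt \<C> f = tgt \<C> g"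
  shows "(neg \<C> ^^ k) (rowm \<C> f g) = rowm \<C> ((neg \<C> ^^ k) f) ((neg \<C> ^^ k) g)"
  by (induction k) (use assms in simp_all)

lemma negs_colm [simp]:
  assumes "f \<in> Arr \<C>" "g \<in> Arr \<C>" "src \<C> f = src \<C> g"
  shows "(neg \<C> ^^ k) (colm \<C> f g) = colm \<C> ((neg \<C> ^^ k) f) ((neg \<C> ^^ k) g)"
  by (induction k) (use assms in simp_all)

lemmas matrix_simps = matm_def inj_eq_colm pr_eq_rowm idt_dsum rowm_zerom colm_zerom

end

section \<open>Homotopy equivalence of exact complexes\<close>

context preadditive_category
begin

lemma sequenceD:
  assumes "sequence \<C> n X"
  shows "i \<le> Suc n \<Longrightarrow> ob X i \<in> Obj \<C>" "i \<le> n \<Longrightarrow> df X i \<in> Arr \<C>"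
    "i \<le> n \<Longrightarrow> src \<C> (df X i) = ob X i" "i \<le> n \<Longrightarrow> tgt \<C> (df X i) = ob X (Suc i)"
  using assms by (simp_all add: sequence_def Mor_def)

lemma complex_sequence [simp]: "complex \<C> n X \<Longrightarrow> sequence \<C> n X"
  by (simp add: complex_def)

lemmas complexD = sequenceD[OF complex_sequence]

lemma complex_df:
  "\<lbrakk>complex \<C> n X; i < n\<rbrakk> \<Longrightarrow> df X (Suc i) \<cdot> df X i = zerom \<C> (ob X i) (ob X (Suc (Suc i)))"
  by (simp add: complex_def)

lemma chain_mapD:
  assumes "chain_map \<C> n X Y f"
  shows "i \<le> Suc n \<Longrightarrow> f i \<in> Arr \<C>" "i \<le> Suc n \<Longrightarrow> src \<C> (f i) = ob X i"
    "i \<le> Suc n \<Longrightarrow> tgt \<C> (f i) = ob Y i"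
    "i \<le> n \<Longrightarrow> f (Suc i) \<cdot> df X i = df Y i \<cdot> f i"
  using assms by (simp_all add: chain_map_def Mor_def)

lemma chain_map_cmp:
  assumes "sequence \<C> n X" "sequence \<C> n Y" "sequence \<C> n Z"
    "chain_map \<C> n X Y f" "chain_map \<C> n Y Z g"
  shows "chain_map \<C> n X Z (\<lambda>i. g i \<cdot> f i)"
  unfolding chain_map_def
proof (intro conjI allI impI)
  note [simp] = sequenceD[OF assms(1)] sequenceD[OF assms(2)] sequenceD[OF assms(3)]
    chain_mapD(1-3)[OF assms(4)] chain_mapD(1-3)[OF assms(5)]
  show "g i \<cdot> f i \<in> Mor \<C> (ob X i) (ob Z i)" if "i \<le> n + 1" for i
    using that by (simp add: Mor_def)
  show "g (i + 1) \<cdot> f (i + 1) \<cdot> df X i = df Z i \<cdot> (g i \<cdot> f i)" if "i \<le> n" for i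
    using that chain_mapD(4)[OF assms(4), of i]
      cmp_cong_right[OF chain_mapD(4)[OF assms(5), of i], of "f i"] by simp
qed

lemma chain_map_add:
  assumes "sequence \<C> n X" "sequence \<C> n Y" "chain_map \<C> n X Y f" "chain_map \<C> n X Y g"
  shows "chain_map \<C> n X Y (\<lambda>i. f i \<boxplus> g i)"
  using sequenceD[OF assms(1)] sequenceD[OF assms(2)] chain_mapD[OF assms(3)] chain_mapD[OF assms(4)]
  by (auto simp: chain_map_def Mor_def)

lemma chain_map_neg:
  assumes "sequence \<C> n X" "sequence \<C> n Y" "chain_map \<C> n X Y f"
  shows "chain_map \<C> n X Y (\<lambda>i. neg \<C> (f i))"
  using sequenceD[OF assms(1)] sequenceD[OF assms(2)] chain_mapD[OF assms(3)] by (auto simp: chain_map_def Mor_def)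

lemma chain_map_idt: "sequence \<C> n X \<Longrightarrow> chain_map \<C> n X X (\<lambda>i. idt \<C> (ob X i))"
  by (auto simp: chain_map_def Mor_def sequenceD)

text \<open>Exactness of C(X,-) at the terms C(X^i,-) with 1 \<le> i \<le> n, as a factorization
  property. The term C(X^0,-) involves the extension and is the subject of
  \<open>start_exact\<close>.\<close>

definition coexact :: "nat \<Rightarrow> ('a, 'b) seq \<Rightarrow> bool" where
  "coexact n X \<longleftrightarrow> complex \<C> n X \<and> (\<forall>i<n. \<forall>g\<in>Arr \<C>. src \<C> g = ob X (Suc i) \<longrightarrow>
     g \<cdot> df X i = zerom \<C> (ob X i) (tgt \<C> g) \<longrightarrow>
     (\<exists>k\<in>Arr \<C>. src \<C> k = ob X (Suc (Suc i)) \<and> tgt \<C> k = tgt \<C> g \<and> g = k \<cdot> df X (Suc i)))"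

lemma coexactE:
  assumes "coexact n X" "i < n" "g \<in> Arr \<C>" "src \<C> g = ob X (Suc i)" "tgt \<C> g = T"
    "g \<cdot> df X i = zerom \<C> (ob X i) T"
  obtains k where "k \<in> Arr \<C>" "src \<C> k = ob X (Suc (Suc i))" "tgt \<C> k = T"
    "g = k \<cdot> df X (Suc i)"
  using assms unfolding coexact_def by blast

text \<open>
  The map \<open>h\<close> is of the form \<open>\<phi> d + d \<phi>\<close> except in the last degree, where \<open>d \<phi>\<close> need not
  vanish; composing with \<open>h\<close> once more removes this defect.
\<close>

lemma square_null_homotopic:
  assumes X: "coexact n X" and h: "chain_map \<C> n X X h"
    and h0: "h 0 = zerom \<C> (ob X 0) (ob X 0)"
    and h1: "h (Suc n) = zerom \<C> (ob X (Suc n)) (ob X (Suc n))"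
  obtains \<chi> where
    "\<And>i. i \<le> n \<Longrightarrow> \<chi> (Suc i) \<in> Mor \<C> (ob X (Suc i)) (ob X i)"
    "\<chi> 1 \<cdot> df X 0 = zerom \<C> (ob X 0) (ob X 0)"
    "df X n \<cdot> \<chi> (Suc n) = zerom \<C> (ob X (Suc n)) (ob X (Suc n))"
    "\<And>i. i < n \<Longrightarrow> h (Suc i) \<cdot> h (Suc i) =
       (\<chi> (Suc (Suc i)) \<cdot> df X (Suc i)) \<boxplus> (df X i \<cdot> \<chi> (Suc i))"
proof -
  have cX: "complex \<C> n X" using X by (simp add: coexact_def)
  note [simp] = complexD[OF cX] chain_mapD(1-3)[OF h]
  note sq = chain_mapD(4)[OF h]
  \<comment> \<open>The maps \<open>\<phi> 1\<close>, ..., \<open>\<phi> (k + 1)\<close> satisfy the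
    homotopy identity in degrees 1 to k. The last equation drives the induction: it says that
    \<open>h - d \<phi>\<close> in degree k + 1 kills \<open>df X k\<close>, so that it factors
    through the next differential.\<close>
  define P where "P k \<phi> \<longleftrightarrow>
     (\<forall>i\<le>k. \<phi> (Suc i) \<in> Arr \<C> \<and> src \<C> (\<phi> (Suc i)) = ob X (Suc i) \<and> tgt \<C> (\<phi> (Suc i)) = ob X i) \<and>
     (\<forall>i<k. h (Suc i) = (\<phi> (Suc (Suc i)) \<cdot> df X (Suc i)) \<boxplus> (df X i \<cdot> \<phi> (Suc i))) \<and>
     df X k \<cdot> h k = df X k \<cdot> (\<phi> (Suc k) \<cdot> df X k)" for k and \<phi> :: "nat \<Rightarrow> 'b"
  have "k \<le> n \<Longrightarrow> \<exists>\<phi>. P k \<phi>" for k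
  proof (induction k)
    case 0
    have "P 0 (\<lambda>_. zerom \<C> (ob X 1) (ob X 0))" by (simp add: P_def h0)
    thus ?case by blast
  next
    case (Suc k)
    then obtain \<phi> where "P k \<phi>" by auto
    hence [simp]: "i \<le> k \<Longrightarrow> \<phi> (Suc i) \<in> Arr \<C>" "i \<le> k \<Longrightarrow> src \<C> (\<phi> (Suc i)) = ob X (Suc i)"
        "i \<le> k \<Longrightarrow> tgt \<C> (\<phi> (Suc i)) = ob X i"
      and eq: "i < k \<Longrightarrow> h (Suc i) = (\<phi> (Suc (Suc i)) \<cdot> df X (Suc i)) \<boxplus> (df X i \<cdot> \<phi> (Suc i))"
      and dd: "df X k \<cdot> h k = df X k \<cdot> (\<phi> (Suc k) \<cdot> df X k)" for i
      by (auto simp: P_def)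
    have kn: "k < n" using Suc.prems by simp
    let ?g = "h (Suc k) \<boxplus> neg \<C> (df X k \<cdot> \<phi> (Suc k))"
    have g: "?g \<in> Arr \<C>" "src \<C> ?g = ob X (Suc k)" "tgt \<C> ?g = ob X (Suc k)"
      using kn by simp_all
    have gd: "?g \<cdot> df X k = zerom \<C> (ob X k) (ob X (Suc k))"
      using kn sq[of k] dd by simp
    obtain g' where [simp]: "g' \<in> Arr \<C>" "src \<C> g' = ob X (Suc (Suc k))" "tgt \<C> g' = ob X (Suc k)"
      and g': "?g = g' \<cdot> df X (Suc k)"
      by (rule coexactE[OF X kn g gd])
    have hk: "h (Suc k) = (g' \<cdot> df X (Suc k)) \<boxplus> (df X k \<cdot> \<phi> (Suc k))"
      unfolding g'[symmetric] using kn by simp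
    let ?\<phi> = "\<phi>(Suc (Suc k) := g')"
    have "df X (Suc k) \<cdot> h (Suc k) = df X (Suc k) \<cdot> (g' \<cdot> df X (Suc k))"
      unfolding hk using kn cmp_zerom_right[OF complex_df[OF cX kn], of "\<phi> (Suc k)"]
      by simp
    moreover have "h (Suc i) = (?\<phi> (Suc (Suc i)) \<cdot> df X (Suc i)) \<boxplus> (df X i \<cdot> ?\<phi> (Suc i))"
      if "i < Suc k" for i
      using that eq[of i] hk by (cases "i = k") auto
    ultimately have "P (Suc k) ?\<phi>" by (auto simp: P_def le_Suc_eq)
    thus ?case by blast
  qed
  then obtain \<phi> where "P n \<phi>" by blast
  hence [simp]: "i \<le> n \<Longrightarrow> \<phi> (Suc i) \<in> Arr \<C>" "i \<le> n \<Longrightarrow> src \<C> (\<phi> (Suc i)) = ob X (Suc i)"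
      "i \<le> n \<Longrightarrow> tgt \<C> (\<phi> (Suc i)) = ob X i"
    and eq: "i < n \<Longrightarrow> h (Suc i) = (\<phi> (Suc (Suc i)) \<cdot> df X (Suc i)) \<boxplus> (df X i \<cdot> \<phi> (Suc i))" for i
    by (auto simp: P_def)
  show thesis
  proof (rule that)
    \<comment> \<open>Since \<open>h 0\<close> is zero, so is \<open>\<chi> 1\<close>; in the last
      degree \<open>d h \<phi> = h d \<phi>\<close> vanishes with \<open>h (n + 1)\<close>. In
      between, \<open>h\<close> times the homotopy identity is again such an identity because
      \<open>h\<close> commutes with \<open>d\<close>.\<close>
    let ?\<chi> = "\<lambda>i. h (i - 1) \<cdot> \<phi> i"
    show "?\<chi> (Suc i) \<in> Mor \<C> (ob X (Suc i)) (ob X i)" if "i \<le> n" for i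
      using that by (simp add: Mor_def)
    show "?\<chi> 1 \<cdot> df X 0 = zerom \<C> (ob X 0) (ob X 0)"
      using h0 by simp
    show "df X n \<cdot> ?\<chi> (Suc n) = zerom \<C> (ob X (Suc n)) (ob X (Suc n))"
      using cmp_cong_right[OF sq[of n], of "\<phi> (Suc n)"] h1 by simp
    show "h (Suc i) \<cdot> h (Suc i) = (?\<chi> (Suc (Suc i)) \<cdot> df X (Suc i)) \<boxplus> (df X i \<cdot> ?\<chi> (Suc i))"
      if "i < n" for i
      using cmp_cong_right[OF sq[of i], of "\<phi> (Suc i)"] that
      by (subst (2) eq) simp_all
  qed
qed

text \<open>Here v = 2u - u^2 = 1 - (1 - u)^2, and 1 - u vanishes at both ends, so
  \<open>square_null_homotopic\<close> applies to it and bounds the difference between v and the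
  identity.\<close>

lemma homotopic_idt:
  assumes X: "coexact n X" and u: "chain_map \<C> n X X u"
    and u0: "u 0 = idt \<C> (ob X 0)" and u1: "u (Suc n) = idt \<C> (ob X (Suc n))"
    and v: "\<And>i. i \<le> Suc n \<Longrightarrow> v i = (u i \<boxplus> u i) \<boxplus> neg \<C> (u i \<cdot> u i)"
  shows "homotopic \<C> n X X v (\<lambda>i. idt \<C> (ob X i))"
proof -
  have cX [simp]: "complex \<C> n X" using X by (simp add: coexact_def)
  note [simp] = complexD[OF cX] chain_mapD(1-3)[OF u]
  let ?h = "\<lambda>i. idt \<C> (ob X i) \<boxplus> neg \<C> (u i)"
  have "chain_map \<C> n X X ?h"
    using u by (intro chain_map_add chain_map_idt chain_map_neg) simp_all
  moreover have "?h 0 = zerom \<C> (ob X 0) (ob X 0)"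
    "?h (Suc n) = zerom \<C> (ob X (Suc n)) (ob X (Suc n))" using u0 u1 by simp_all
  ultimately obtain \<chi> where \<chi>:
    "\<And>i. i \<le> n \<Longrightarrow> \<chi> (Suc i) \<in> Mor \<C> (ob X (Suc i)) (ob X i)"
    "\<chi> 1 \<cdot> df X 0 = zerom \<C> (ob X 0) (ob X 0)"
    "df X n \<cdot> \<chi> (Suc n) = zerom \<C> (ob X (Suc n)) (ob X (Suc n))"
    "\<And>i. i < n \<Longrightarrow> ?h (Suc i) \<cdot> ?h (Suc i) =
       (\<chi> (Suc (Suc i)) \<cdot> df X (Suc i)) \<boxplus> (df X i \<cdot> \<chi> (Suc i))"
    by (rule square_null_homotopic[OF X]) blast
  show ?thesis unfolding homotopic_def
  proof (intro exI[of _ \<chi>] conjI ballI)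
    show "\<chi> i \<in> Mor \<C> (ob X i) (ob X (i - 1))" if "i \<in> {1..n + 1}" for i
      using \<chi>(1)[of "i - 1"] that by (cases i) auto
    show "idt \<C> (ob X 0) = v 0 \<boxplus> (\<chi> 1 \<cdot> df X 0)" using \<chi>(2) u0 by (simp add: v)
    show "idt \<C> (ob X (n + 1)) = v (n + 1) \<boxplus> (df X n \<cdot> \<chi> (n + 1))" using \<chi>(3) u1 by (simp add: v)
    show "idt \<C> (ob X i) = v i \<boxplus> ((\<chi> (i + 1) \<cdot> df X i) \<boxplus> (df X (i - 1) \<cdot> \<chi> i))"
      if i: "i \<in> {1..n}" for i
    proof -
      obtain j where j: "i = Suc j" "j < n" using i by (cases i) auto
      have "v i \<boxplus> (?h i \<cdot> ?h i) = idt \<C> (ob X i)"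
        using j by (simp add: v add_ac)
      thus ?thesis
        unfolding j(1) \<chi>(4)[OF j(2)] by (simp only: Suc_eq_plus1[symmetric] diff_Suc_1)
    qed
  qed
qed

text \<open>The given \<open>g\<close> need not be a homotopy inverse of \<open>f\<close>; 2g - gfg
  is one. This is a Newton step towards an inverse: with u = gf and v = fg, its composites with
  \<open>f\<close> are 2u - u^2 and 2v - v^2, so the same correction serves both sides.\<close>

lemma homotopy_equivalentI:
  assumes X: "coexact n X" and Y: "coexact n Y"
    and A: "ob X 0 = A" "ob Y 0 = A" and C: "ob X (Suc n) = C" "ob Y (Suc n) = C"
    and f: "chain_map_fixing_ends \<C> n A C X Y f" and g: "chain_map_fixing_ends \<C> n A C Y X g"
  shows "homotopy_equivalent \<C> n A C X Y"
proof -
  have [simp]: "complex \<C> n X" "complex \<C> n Y" using X Y by (simp_all add: coexact_def)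
  note [simp] = complexD[OF this(1)] complexD[OF this(2)]
  have cf: "chain_map \<C> n X Y f" and cg: "chain_map \<C> n Y X g"
    and fe: "f 0 = idt \<C> A" "f (Suc n) = idt \<C> C" and ge: "g 0 = idt \<C> A" "g (Suc n) = idt \<C> C"
    using f g by (simp_all add: chain_map_fixing_ends_def)
  note [simp] = chain_mapD(1-3)[OF cf] chain_mapD(1-3)[OF cg]
  have [simp]: "A \<in> Obj \<C>" "C \<in> Obj \<C>"
    using complexD(1)[of n X 0] complexD(1)[of n X "Suc n"] A C by simp_all
  let ?u = "\<lambda>i. g i \<cdot> f i" and ?v = "\<lambda>i. f i \<cdot> g i"
  let ?g = "\<lambda>i. (g i \<boxplus> g i) \<boxplus> neg \<C> (?u i \<cdot> g i)"
  have cu: "chain_map \<C> n X X ?u"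
    using chain_map_cmp[of n X Y X f g] cf cg by simp
  have cv: "chain_map \<C> n Y Y ?v"
    using chain_map_cmp[of n Y X Y g f] cf cg by simp
  have "chain_map \<C> n Y X ?g"
    using cg cu by (intro chain_map_add chain_map_neg chain_map_cmp[of n Y X X g ?u]) simp_all
  hence "chain_map_fixing_ends \<C> n A C Y X ?g"
    by (simp add: chain_map_fixing_ends_def fe ge)
  moreover have "homotopic \<C> n X X (\<lambda>i. ?g i \<cdot> f i) (\<lambda>i. idt \<C> (ob X i))"
    by (rule homotopic_idt[OF X cu]) (simp_all add: fe ge A C)
  moreover have "homotopic \<C> n Y Y (\<lambda>i. f i \<cdot> ?g i) (\<lambda>i. idt \<C> (ob Y i))"
    by (rule homotopic_idt[OF Y cv]) (simp_all add: fe ge A C)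
  ultimately show ?thesis using f unfolding homotopy_equivalent_def by blast
qed

text \<open>For q d = 0, inserting 1 = f g + \<phi> d + d \<phi> gives q = (q f) g + q \<phi> d.
  Exactness of \<open>X\<close> factors q f through a differential, which then moves past g.\<close>

lemma coexact_homotopy_equivalent:
  assumes X: "coexact n X" and Z: "complex \<C> n Z" and eqv: "homotopy_equivalent \<C> n A C X Z"
  shows "coexact n Z"
  unfolding coexact_def
proof (intro conjI allI impI ballI Z)
  fix i q
  assume i: "i < n" and q [simp]: "q \<in> Arr \<C>" and [simp]: "src \<C> q = ob Z (Suc i)"
    and qd: "q \<cdot> df Z i = zerom \<C> (ob Z i) (tgt \<C> q)"
  have [simp]: "complex \<C> n X" "complex \<C> n Z" using X Z by (simp_all add: coexact_def)
  note [simp] = complexD[OF this(1)] complexD[OF this(2)]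
  obtain f g where f: "chain_map \<C> n X Z f" and g: "chain_map \<C> n Z X g"
    and hom: "homotopic \<C> n Z Z (\<lambda>i. f i \<cdot> g i) (\<lambda>i. idt \<C> (ob Z i))"
    using eqv by (auto simp: homotopy_equivalent_def chain_map_fixing_ends_def)
  note [simp] = chain_mapD(1-3)[OF f] chain_mapD(1-3)[OF g]
  from hom obtain \<phi> where \<phi>: "\<And>i. i \<in> {1..n + 1} \<Longrightarrow> \<phi> i \<in> Mor \<C> (ob Z i) (ob Z (i - 1))"
    "\<And>i. i \<in> {1..n} \<Longrightarrow> idt \<C> (ob Z i) =
      (f i \<cdot> g i) \<boxplus> ((\<phi> (i + 1) \<cdot> df Z i) \<boxplus> (df Z (i - 1) \<cdot> \<phi> i))"
    unfolding homotopic_def by blast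
  have [simp]: "k \<le> n \<Longrightarrow> \<phi> (Suc k) \<in> Arr \<C>" "k \<le> n \<Longrightarrow> src \<C> (\<phi> (Suc k)) = ob Z (Suc k)"
    "k \<le> n \<Longrightarrow> tgt \<C> (\<phi> (Suc k)) = ob Z k" for k
    using \<phi>(1)[of "Suc k"] by (simp_all add: Mor_def)
  have qf: "q \<cdot> f (Suc i) \<in> Arr \<C>" "src \<C> (q \<cdot> f (Suc i)) = ob X (Suc i)"
    "tgt \<C> (q \<cdot> f (Suc i)) = tgt \<C> q"
    using i by simp_all
  have qfd: "(q \<cdot> f (Suc i)) \<cdot> df X i = zerom \<C> (ob X i) (tgt \<C> q)"
    using i chain_mapD(4)[OF f, of i] cmp_zerom_right[OF qd, of "f i"] by simp
  obtain q' where [simp]: "q' \<in> Arr \<C>" "src \<C> q' = ob X (Suc (Suc i))" "tgt \<C> q' = tgt \<C> q"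
    and q': "q \<cdot> f (Suc i) = q' \<cdot> df X (Suc i)"
    by (rule coexactE[OF X i qf qfd])
  let ?k = "(q' \<cdot> g (Suc (Suc i))) \<boxplus> (q \<cdot> \<phi> (Suc (Suc i)))"
  have "q = q \<cdot> idt \<C> (ob Z (Suc i))" by simp
  also have "\<dots> = (q \<cdot> (f (Suc i) \<cdot> g (Suc i))) \<boxplus> (q \<cdot> (\<phi> (Suc (Suc i)) \<cdot> df Z (Suc i)))"
    using i \<phi>(2)[of "Suc i"] cmp_zerom_right[OF qd, of "\<phi> (Suc i)"] by simp
  also have "q \<cdot> (f (Suc i) \<cdot> g (Suc i)) = q' \<cdot> (g (Suc (Suc i)) \<cdot> df Z (Suc i))"
    using i cmp_cong_right[OF q', of "g (Suc i)"] chain_mapD(4)[OF g, of "Suc i"] by simp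
  finally have "q = ?k \<cdot> df Z (Suc i)" using i by simp
  moreover have "?k \<in> Arr \<C>" "src \<C> ?k = ob Z (Suc (Suc i))" "tgt \<C> ?k = tgt \<C> q"
    using i by simp_all
  ultimately show "\<exists>k\<in>Arr \<C>. src \<C> k = ob Z (Suc (Suc i)) \<and> tgt \<C> k = tgt \<C> q \<and>
    q = k \<cdot> df Z (Suc i)" by blast
qed

text \<open>
  Exactness is invariant under homotopy equivalence and turns pairs of opposite chain maps into
  homotopy equivalences, so transitivity of homotopy equivalence is not needed here.
\<close>

lemma homotopy_class_eq:
  assumes X: "coexact n X" and Y: "coexact n Y"
    and A: "ob X 0 = A" "ob Y 0 = A" and C: "ob X (Suc n) = C" "ob Y (Suc n) = C"
    and f: "chain_map_fixing_ends \<C> n A C X Y f" and g: "chain_map_fixing_ends \<C> n A C Y X g"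
  shows "homotopy_class \<C> n A C X = homotopy_class \<C> n A C Y"
proof -
  have sub: "homotopy_class \<C> n A C X \<subseteq> homotopy_class \<C> n A C Y"
    if X: "coexact n X" and Y: "coexact n Y"
      and A: "ob X 0 = A" "ob Y 0 = A" and C: "ob X (Suc n) = C" "ob Y (Suc n) = C"
      and f: "chain_map_fixing_ends \<C> n A C X Y f" and g: "chain_map_fixing_ends \<C> n A C Y X g"
    for X Y :: "('a, 'b) seq" and f g
  proof
    fix Z assume "Z \<in> homotopy_class \<C> n A C X"
    hence Z: "complex \<C> n Z" "ob Z 0 = A" "ob Z (Suc n) = C" and eqv: "homotopy_equivalent \<C> n A C X Z"
      by (auto simp: homotopy_class_def complexes_between_def)
    then obtain p q where p: "chain_map_fixing_ends \<C> n A C X Z p"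
      and q: "chain_map_fixing_ends \<C> n A C Z X q"
      by (auto simp: homotopy_equivalent_def)
    have cZ: "coexact n Z" by (rule coexact_homotopy_equivalent[OF X Z(1) eqv])
    have [simp]: "complex \<C> n X" "complex \<C> n Y" "complex \<C> n Z"
      using X Y Z by (simp_all add: coexact_def)
    note [simp] = complexD[OF this(1)] complexD[OF this(2)] complexD[OF this(3)]
    have [simp]: "A \<in> Obj \<C>" "C \<in> Obj \<C>"
      using complexD(1)[of n X 0] complexD(1)[of n X "Suc n"] A C by simp_all
    have "chain_map_fixing_ends \<C> n A C Y Z (\<lambda>i. p i \<cdot> g i)"
      using p g chain_map_cmp[of n Y X Z g p] by (simp add: chain_map_fixing_ends_def)
    moreover have "chain_map_fixing_ends \<C> n A C Z Y (\<lambda>i. f i \<cdot> q i)"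
      using q f chain_map_cmp[of n Z X Y q f] by (simp add: chain_map_fixing_ends_def)
    ultimately have "homotopy_equivalent \<C> n A C Y Z"
      using homotopy_equivalentI[OF Y cZ] A C Z by simp
    thus "Z \<in> homotopy_class \<C> n A C Y"
      using Z by (simp add: homotopy_class_def complexes_between_def)
  qed
  show ?thesis using sub[OF X Y A C f g] sub[OF Y X A(2,1) C(2,1) g f] by blast
qed

end

section \<open>Exactness of sums and summands\<close>

context preadditive_category
begin

text \<open>The dual condition, exactness of C(-,X). The length is a parameter because the notion is
  applied with m = n + 1 to the complex lengthened by its extension.\<close>

definition exact :: "nat \<Rightarrow> ('a, 'b) seq \<Rightarrow> bool" where
  "exact m X \<longleftrightarrow> complex \<C> m X \<and> (\<forall>i<m. \<forall>f\<in>Arr \<C>. tgt \<C> f = ob X (Suc i) \<longrightarrow>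
     df X (Suc i) \<cdot> f = zerom \<C> (src \<C> f) (ob X (Suc (Suc i))) \<longrightarrow>
     (\<exists>k\<in>Arr \<C>. src \<C> k = src \<C> f \<and> tgt \<C> k = ob X i \<and> f = df X i \<cdot> k))"

lemma exactE:
  assumes "exact m X" "i < m" "f \<in> Arr \<C>" "src \<C> f = S" "tgt \<C> f = ob X (Suc i)"
    "df X (Suc i) \<cdot> f = zerom \<C> S (ob X (Suc (Suc i)))"
  obtains k where "k \<in> Arr \<C>" "src \<C> k = S" "tgt \<C> k = ob X i" "f = df X i \<cdot> k"
  using assms unfolding exact_def by blast

lemma exact_complex: "exact m X \<Longrightarrow> complex \<C> m X"
  by (simp add: exact_def)

lemma coexact_complex: "coexact m X \<Longrightarrow> complex \<C> m X"
  by (simp add: coexact_def)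

text \<open>Neither p1 i1 = 1 nor p2 i1 = 0 is imposed: properties pass to \<open>W\<close> by
  inserting this expression for the identity of \<open>W\<close>.\<close>

definition retract_of_pair :: "nat \<Rightarrow> ('a, 'b) seq \<Rightarrow> (nat \<Rightarrow> 'b) \<Rightarrow> (nat \<Rightarrow> 'b) \<Rightarrow>
    (nat \<Rightarrow> 'b) \<Rightarrow> (nat \<Rightarrow> 'b) \<Rightarrow> bool" where
  "retract_of_pair m W i1 p1 i2 p2 \<longleftrightarrow>
     (\<forall>k\<le>Suc m. (i1 k \<cdot> p1 k) \<boxplus> (i2 k \<cdot> p2 k) = idt \<C> (ob W k))"

lemma retract_of_pair_split:
  assumes "retract_of_pair m W i1 p1 i2 p2" "k \<le> Suc m" "sequence \<C> m W" "sequence \<C> m X" "sequence \<C> m Y"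
    and ch: "chain_map \<C> m X W i1" "chain_map \<C> m W X p1" "chain_map \<C> m Y W i2" "chain_map \<C> m W Y p2"
    and "f \<in> Arr \<C>"
  shows "tgt \<C> f = ob W k \<Longrightarrow> f = (i1 k \<cdot> (p1 k \<cdot> f)) \<boxplus> (i2 k \<cdot> (p2 k \<cdot> f))"
    "src \<C> f = ob W k \<Longrightarrow> f = (f \<cdot> (i1 k \<cdot> p1 k)) \<boxplus> (f \<cdot> (i2 k \<cdot> p2 k))"
proof -
  note [simp] = chain_mapD(1-3)[OF ch(1) assms(2)] chain_mapD(1-3)[OF ch(2) assms(2)]
    chain_mapD(1-3)[OF ch(3) assms(2)] chain_mapD(1-3)[OF ch(4) assms(2)] \<open>f \<in> Arr \<C>\<close>
  have eq: "(i1 k \<cdot> p1 k) \<boxplus> (i2 k \<cdot> p2 k) = idt \<C> (ob W k)"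
    using assms(1,2) by (simp add: retract_of_pair_def)
  show "f = (i1 k \<cdot> (p1 k \<cdot> f)) \<boxplus> (i2 k \<cdot> (p2 k \<cdot> f))" if "tgt \<C> f = ob W k"
    using arg_cong[OF eq, of "\<lambda>h. h \<cdot> f"] that by simp
  show "f = (f \<cdot> (i1 k \<cdot> p1 k)) \<boxplus> (f \<cdot> (i2 k \<cdot> p2 k))" if "src \<C> f = ob W k"
    using arg_cong[OF eq, of "\<lambda>h. f \<cdot> h"] that by simp
qed

lemma complex_retract_of_pair:
  assumes W: "sequence \<C> m W" and X: "complex \<C> m X" and Y: "complex \<C> m Y"
    and ch: "chain_map \<C> m X W i1" "chain_map \<C> m W X p1" "chain_map \<C> m Y W i2" "chain_map \<C> m W Y p2"
    and r: "retract_of_pair m W i1 p1 i2 p2"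
  shows "complex \<C> m W"
  unfolding complex_def
proof (intro conjI W allI impI)
  fix k assume k: "k < m"
  note [simp] = sequenceD[OF W] complexD[OF X] complexD[OF Y]
    chain_mapD(1-3)[OF ch(1)] chain_mapD(1-3)[OF ch(2)]
    chain_mapD(1-3)[OF ch(3)] chain_mapD(1-3)[OF ch(4)]
  note sq = chain_mapD(4)[OF ch(1), symmetric] chain_mapD(4)[OF ch(3), symmetric]
  have "df W (Suc k) \<cdot> df W k \<cdot> (i1 k \<cdot> p1 k) = zerom \<C> (ob W k) (ob W (Suc (Suc k)))"
    using k cmp_cong_right[OF sq(1)[of k], of "p1 k"]
      cmp_cong_right[OF sq(1)[of "Suc k"], of "df X k \<cdot> p1 k"]
      cmp_zerom_right[OF complex_df[OF X k], of "p1 k"] by simp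
  moreover have "df W (Suc k) \<cdot> df W k \<cdot> (i2 k \<cdot> p2 k) = zerom \<C> (ob W k) (ob W (Suc (Suc k)))"
    using k cmp_cong_right[OF sq(2)[of k], of "p2 k"]
      cmp_cong_right[OF sq(2)[of "Suc k"], of "df Y k \<cdot> p2 k"]
      cmp_zerom_right[OF complex_df[OF Y k], of "p2 k"] by simp
  ultimately show "df W (k + 1) \<cdot> df W k = zerom \<C> (ob W k) (ob W (k + 2))"
    using k retract_of_pair_split(2)[OF r _ W complex_sequence[OF X] complex_sequence[OF Y] ch,
        of k "df W (Suc k) \<cdot> df W k"] by simp
qed

text \<open>Exactness of \<open>X\<close> and \<open>Y\<close> factors p1 f and p2 f. As i1 and i2
  commute with the differentials, the factorizations add up to one of f = i1 p1 f + i2 p2 f.\<close>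

lemma exact_retract_of_pair:
  assumes W: "sequence \<C> m W" and X: "exact m X" and Y: "exact m Y"
    and ch: "chain_map \<C> m X W i1" "chain_map \<C> m W X p1" "chain_map \<C> m Y W i2" "chain_map \<C> m W Y p2"
    and r: "retract_of_pair m W i1 p1 i2 p2"
  shows "exact m W"
  unfolding exact_def
proof (intro conjI allI ballI impI)
  note cX = exact_complex[OF X] and cY = exact_complex[OF Y]
  show "complex \<C> m W" by (rule complex_retract_of_pair[OF W cX cY ch r])
  fix i f assume i: "i < m" and f [simp]: "f \<in> Arr \<C>" "tgt \<C> f = ob W (Suc i)"
    and df: "df W (Suc i) \<cdot> f = zerom \<C> (src \<C> f) (ob W (Suc (Suc i)))"
  note [simp] = sequenceD[OF W] complexD[OF cX] complexD[OF cY]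
    chain_mapD(1-3)[OF ch(1)] chain_mapD(1-3)[OF ch(2)]
    chain_mapD(1-3)[OF ch(3)] chain_mapD(1-3)[OF ch(4)]
  note i_sq = chain_mapD(4)[OF ch(1), of i] chain_mapD(4)[OF ch(3), of i]
  note p_sq = chain_mapD(4)[OF ch(2), of "Suc i", symmetric] chain_mapD(4)[OF ch(4), of "Suc i", symmetric]
  have p: "p1 (Suc i) \<cdot> f \<in> Arr \<C>" "src \<C> (p1 (Suc i) \<cdot> f) = src \<C> f"
    "tgt \<C> (p1 (Suc i) \<cdot> f) = ob X (Suc i)" "p2 (Suc i) \<cdot> f \<in> Arr \<C>"
    "src \<C> (p2 (Suc i) \<cdot> f) = src \<C> f" "tgt \<C> (p2 (Suc i) \<cdot> f) = ob Y (Suc i)"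
    using i by simp_all
  have dp1: "df X (Suc i) \<cdot> (p1 (Suc i) \<cdot> f) = zerom \<C> (src \<C> f) (ob X (Suc (Suc i)))"
    using i df cmp_cong_right[OF p_sq(1), of f] by simp
  have dp2: "df Y (Suc i) \<cdot> (p2 (Suc i) \<cdot> f) = zerom \<C> (src \<C> f) (ob Y (Suc (Suc i)))"
    using i df cmp_cong_right[OF p_sq(2), of f] by simp
  obtain k1 where k1: "k1 \<in> Arr \<C>" "src \<C> k1 = src \<C> f" "tgt \<C> k1 = ob X i"
    and k1_eq: "p1 (Suc i) \<cdot> f = df X i \<cdot> k1" by (rule exactE[OF X i p(1-3) dp1])
  obtain k2 where k2: "k2 \<in> Arr \<C>" "src \<C> k2 = src \<C> f" "tgt \<C> k2 = ob Y i"
    and k2_eq: "p2 (Suc i) \<cdot> f = df Y i \<cdot> k2" by (rule exactE[OF Y i p(4-6) dp2])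
  let ?k = "(i1 i \<cdot> k1) \<boxplus> (i2 i \<cdot> k2)"
  have "f = (i1 (Suc i) \<cdot> (p1 (Suc i) \<cdot> f)) \<boxplus> (i2 (Suc i) \<cdot> (p2 (Suc i) \<cdot> f))"
    using i by (intro retract_of_pair_split(1)[OF r _ W complex_sequence[OF cX] complex_sequence[OF cY] ch])
      simp_all
  also have "\<dots> = df W i \<cdot> ?k"
    unfolding k1_eq k2_eq using i k1 k2 cmp_cong_right[OF i_sq(1), of k1]
      cmp_cong_right[OF i_sq(2), of k2] by simp
  finally have "f = df W i \<cdot> ?k" .
  moreover have "?k \<in> Arr \<C>" "src \<C> ?k = src \<C> f" "tgt \<C> ?k = ob W i"
    using i k1 k2 by simp_all
  ultimately show "\<exists>k\<in>Arr \<C>. src \<C> k = src \<C> f \<and> tgt \<C> k = ob W i \<and> f = df W i \<cdot> k"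
    by blast
qed

lemma coexact_retract_of_pair:
  assumes W: "sequence \<C> m W" and X: "coexact m X" and Y: "coexact m Y"
    and ch: "chain_map \<C> m X W i1" "chain_map \<C> m W X p1" "chain_map \<C> m Y W i2" "chain_map \<C> m W Y p2"
    and r: "retract_of_pair m W i1 p1 i2 p2"
  shows "coexact m W"
  unfolding coexact_def
proof (intro conjI allI ballI impI)
  note cX = coexact_complex[OF X] and cY = coexact_complex[OF Y]
  show "complex \<C> m W" by (rule complex_retract_of_pair[OF W cX cY ch r])
  fix i g assume i: "i < m" and g [simp]: "g \<in> Arr \<C>" "src \<C> g = ob W (Suc i)"
    and gd: "g \<cdot> df W i = zerom \<C> (ob W i) (tgt \<C> g)"
  note [simp] = sequenceD[OF W] complexD[OF cX] complexD[OF cY]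
    chain_mapD(1-3)[OF ch(1)] chain_mapD(1-3)[OF ch(2)]
    chain_mapD(1-3)[OF ch(3)] chain_mapD(1-3)[OF ch(4)]
  note i_sq = chain_mapD(4)[OF ch(1), of i] chain_mapD(4)[OF ch(3), of i]
  note p_sq = chain_mapD(4)[OF ch(2), of "Suc i", symmetric] chain_mapD(4)[OF ch(4), of "Suc i", symmetric]
  have p: "g \<cdot> i1 (Suc i) \<in> Arr \<C>" "src \<C> (g \<cdot> i1 (Suc i)) = ob X (Suc i)"
    "tgt \<C> (g \<cdot> i1 (Suc i)) = tgt \<C> g" "g \<cdot> i2 (Suc i) \<in> Arr \<C>"
    "src \<C> (g \<cdot> i2 (Suc i)) = ob Y (Suc i)" "tgt \<C> (g \<cdot> i2 (Suc i)) = tgt \<C> g"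
    using i by simp_all
  have dp1: "(g \<cdot> i1 (Suc i)) \<cdot> df X i = zerom \<C> (ob X i) (tgt \<C> g)"
    using i i_sq(1) cmp_zerom_right[OF gd, of "i1 i"] by simp
  have dp2: "(g \<cdot> i2 (Suc i)) \<cdot> df Y i = zerom \<C> (ob Y i) (tgt \<C> g)"
    using i i_sq(2) cmp_zerom_right[OF gd, of "i2 i"] by simp
  obtain k1 where k1: "k1 \<in> Arr \<C>" "src \<C> k1 = ob X (Suc (Suc i))" "tgt \<C> k1 = tgt \<C> g"
    and k1_eq: "g \<cdot> i1 (Suc i) = k1 \<cdot> df X (Suc i)" by (rule coexactE[OF X i p(1-3) dp1])
  obtain k2 where k2: "k2 \<in> Arr \<C>" "src \<C> k2 = ob Y (Suc (Suc i))" "tgt \<C> k2 = tgt \<C> g"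
    and k2_eq: "g \<cdot> i2 (Suc i) = k2 \<cdot> df Y (Suc i)" by (rule coexactE[OF Y i p(4-6) dp2])
  let ?k = "(k1 \<cdot> p1 (Suc (Suc i))) \<boxplus> (k2 \<cdot> p2 (Suc (Suc i)))"
  have "g = (g \<cdot> (i1 (Suc i) \<cdot> p1 (Suc i))) \<boxplus> (g \<cdot> (i2 (Suc i) \<cdot> p2 (Suc i)))"
    using i by (intro retract_of_pair_split(2)[OF r _ W complex_sequence[OF cX] complex_sequence[OF cY] ch])
      simp_all
  also have "g \<cdot> (i1 (Suc i) \<cdot> p1 (Suc i)) = (k1 \<cdot> p1 (Suc (Suc i))) \<cdot> df W (Suc i)"
    using i k1 p_sq(1) cmp_cong_right[OF k1_eq, of "p1 (Suc i)"] by simp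
  also have "g \<cdot> (i2 (Suc i) \<cdot> p2 (Suc i)) = (k2 \<cdot> p2 (Suc (Suc i))) \<cdot> df W (Suc i)"
    using i k2 p_sq(2) cmp_cong_right[OF k2_eq, of "p2 (Suc i)"] by simp
  also have "(k1 \<cdot> p1 (Suc (Suc i))) \<cdot> df W (Suc i) \<boxplus> (k2 \<cdot> p2 (Suc (Suc i))) \<cdot> df W (Suc i)
      = ?k \<cdot> df W (Suc i)"
    using i k1 k2 by simp
  finally have "g = ?k \<cdot> df W (Suc i)" .
  moreover have "?k \<in> Arr \<C>" "src \<C> ?k = ob W (Suc (Suc i))" "tgt \<C> ?k = tgt \<C> g"
    using i k1 k2 by simp_all
  ultimately show "\<exists>k\<in>Arr \<C>. src \<C> k = ob W (Suc (Suc i)) \<and> tgt \<C> k = tgt \<C> g \<and>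
      g = k \<cdot> df W (Suc i)"
    by blast
qed

text \<open>The Yoneda argument linking the groups in \<open>n_exangle\<close> with factorizations:
  an element of the kernel is tested at its own source, and d e = 0 comes from testing at
  \<open>A\<close>, where \<open>e\<close> is the image of the identity.\<close>

lemma kernel_eq_image:
  assumes d: "d \<in> Arr \<C>" "src \<C> d = B" "tgt \<C> d = D" and e: "e \<in> Arr \<C>" "src \<C> e = A" "tgt \<C> e = B"
  shows "(\<forall>Z\<in>Obj \<C>. kernel (Mor_group \<C> Z B) (Mor_group \<C> Z D) (\<lambda>f. d \<cdot> f) = (\<lambda>f. e \<cdot> f) ` Mor \<C> Z A)
    \<longleftrightarrow> d \<cdot> e = zerom \<C> A D \<and> (\<forall>f\<in>Arr \<C>. tgt \<C> f = B \<longrightarrow> d \<cdot> f = zerom \<C> (src \<C> f) D \<longrightarrow>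
      (\<exists>k\<in>Arr \<C>. src \<C> k = src \<C> f \<and> tgt \<C> k = A \<and> f = e \<cdot> k))" (is "?L \<longleftrightarrow> ?R")
proof
  have AO: "A \<in> Obj \<C>" using e by auto
  assume L: ?L
  have "e \<in> (\<lambda>f. e \<cdot> f) ` Mor \<C> A A"
    using e AO by (intro image_eqI[of _ _ "idt \<C> A"]) (auto simp: Mor_def)
  hence "d \<cdot> e = zerom \<C> A D" using L[rule_format, OF AO, symmetric] by (auto simp: kernel_def Mor_group_def)
  moreover have "\<exists>k\<in>Arr \<C>. src \<C> k = src \<C> f \<and> tgt \<C> k = A \<and> f = e \<cdot> k"
    if "f \<in> Arr \<C>" "tgt \<C> f = B" "d \<cdot> f = zerom \<C> (src \<C> f) D" for f
  proof -
    have "f \<in> kernel (Mor_group \<C> (src \<C> f) B) (Mor_group \<C> (src \<C> f) D) (\<lambda>f. d \<cdot> f)"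
      using that by (simp add: kernel_def Mor_group_def Mor_def)
    thus ?thesis using L[rule_format, of "src \<C> f"] that by (auto simp: Mor_def)
  qed
  ultimately show ?R by blast
next
  assume R: ?R
  show ?L
  proof (intro ballI equalityI subsetI)
    fix Z f assume "Z \<in> Obj \<C>" and "f \<in> kernel (Mor_group \<C> Z B) (Mor_group \<C> Z D) (\<lambda>f. d \<cdot> f)"
    hence "f \<in> Arr \<C>" "src \<C> f = Z" "tgt \<C> f = B" "d \<cdot> f = zerom \<C> (src \<C> f) D"
      by (auto simp: kernel_def Mor_group_def Mor_def)
    thus "f \<in> (\<lambda>f. e \<cdot> f) ` Mor \<C> Z A" using R by (auto simp: Mor_def)
  next
    fix Z f assume "Z \<in> Obj \<C>" and "f \<in> (\<lambda>f. e \<cdot> f) ` Mor \<C> Z A"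
    then obtain k where k: "k \<in> Arr \<C>" "src \<C> k = Z" "tgt \<C> k = A" "f = e \<cdot> k"
      by (auto simp: Mor_def)
    thus "f \<in> kernel (Mor_group \<C> Z B) (Mor_group \<C> Z D) (\<lambda>f. d \<cdot> f)"
      unfolding k(4) using conjunct1[OF R] d e k(1-3) cmp_zerom_right[of d e A D k]
      by (simp add: kernel_def Mor_group_def Mor_def)
  qed
qed

lemma cokernel_eq_image:
  assumes d: "d \<in> Arr \<C>" "src \<C> d = B" "tgt \<C> d = D" and e: "e \<in> Arr \<C>" "src \<C> e = A" "tgt \<C> e = B"
  shows "(\<forall>Z\<in>Obj \<C>. kernel (Mor_group \<C> B Z) (Mor_group \<C> A Z) (\<lambda>g. g \<cdot> e) = (\<lambda>g. g \<cdot> d) ` Mor \<C> D Z)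
    \<longleftrightarrow> d \<cdot> e = zerom \<C> A D \<and> (\<forall>g\<in>Arr \<C>. src \<C> g = B \<longrightarrow> g \<cdot> e = zerom \<C> A (tgt \<C> g) \<longrightarrow>
      (\<exists>k\<in>Arr \<C>. src \<C> k = D \<and> tgt \<C> k = tgt \<C> g \<and> g = k \<cdot> d))" (is "?L \<longleftrightarrow> ?R")
proof
  have DO: "D \<in> Obj \<C>" using d by auto
  assume L: ?L
  have "d \<in> (\<lambda>g. g \<cdot> d) ` Mor \<C> D D"
    using d DO by (intro image_eqI[of _ _ "idt \<C> D"]) (auto simp: Mor_def)
  hence "d \<cdot> e = zerom \<C> A D" using L[rule_format, OF DO, symmetric] by (auto simp: kernel_def Mor_group_def)
  moreover have "\<exists>k\<in>Arr \<C>. src \<C> k = D \<and> tgt \<C> k = tgt \<C> g \<and> g = k \<cdot> d"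
    if "g \<in> Arr \<C>" "src \<C> g = B" "g \<cdot> e = zerom \<C> A (tgt \<C> g)" for g
  proof -
    have "g \<in> kernel (Mor_group \<C> B (tgt \<C> g)) (Mor_group \<C> A (tgt \<C> g)) (\<lambda>g. g \<cdot> e)"
      using that by (simp add: kernel_def Mor_group_def Mor_def)
    thus ?thesis using L[rule_format, of "tgt \<C> g"] that by (auto simp: Mor_def)
  qed
  ultimately show ?R by blast
next
  assume R: ?R
  show ?L
  proof (intro ballI equalityI subsetI)
    fix Z g assume "Z \<in> Obj \<C>" and "g \<in> kernel (Mor_group \<C> B Z) (Mor_group \<C> A Z) (\<lambda>g. g \<cdot> e)"
    hence "g \<in> Arr \<C>" "tgt \<C> g = Z" "src \<C> g = B" "g \<cdot> e = zerom \<C> A (tgt \<C> g)"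
      by (auto simp: kernel_def Mor_group_def Mor_def)
    thus "g \<in> (\<lambda>g. g \<cdot> d) ` Mor \<C> D Z" using R by (auto simp: Mor_def)
  next
    fix Z g assume "Z \<in> Obj \<C>" and "g \<in> (\<lambda>g. g \<cdot> d) ` Mor \<C> D Z"
    then obtain k where k: "k \<in> Arr \<C>" "src \<C> k = D" "tgt \<C> k = Z" "g = k \<cdot> d"
      by (auto simp: Mor_def)
    thus "g \<in> kernel (Mor_group \<C> B Z) (Mor_group \<C> A Z) (\<lambda>g. g \<cdot> e)"
      unfolding k(4) using conjunct1[OF R] d e k(1-3) arr_obj(1)[OF e(1)] by (simp add: kernel_def Mor_group_def Mor_def)
  qed
qed

end

section \<open>Distinguished exangles for the bifunctor of an automorphism\<close>

locale sigma_exangulated = n_exangulated_category \<C> "sigma_bifunctor \<C> \<Sigma>" n s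
  for \<C> :: "('o, 'm) cat" (structure) and \<Sigma> :: "('o, 'm) endo" and n :: nat
    and s :: "'o \<Rightarrow> 'o \<Rightarrow> 'm \<Rightarrow> ('o, 'm) seq set" +
  assumes automorphism: "automorphism \<C> \<Sigma>"
begin

abbreviation E where "E \<equiv> sigma_bifunctor \<C> \<Sigma>"

abbreviation angle where "angle X \<delta> \<equiv> distinguished \<C> E n s X \<delta>"

lemma ball_atLeast1: "(\<forall>i\<in>{1..m}. P i) \<longleftrightarrow> (\<forall>i<m. P (Suc i))" for m :: nat
  by (auto simp: Ball_def dest: Suc_le_D)

section \<open>The automorphism and its bifunctor\<close>

lemma endofunctor: "endofunctor \<C> \<Sigma>"
  using automorphism by (simp add: automorphism_def)

lemma Sigma_arr [simp]:
  "A \<in> Obj \<C> \<Longrightarrow> on_ob \<Sigma> A \<in> Obj \<C>"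
  "f \<in> Arr \<C> \<Longrightarrow> on_arr \<Sigma> f \<in> Arr \<C>"
  "f \<in> Arr \<C> \<Longrightarrow> src \<C> (on_arr \<Sigma> f) = on_ob \<Sigma> (src \<C> f)"
  "f \<in> Arr \<C> \<Longrightarrow> tgt \<C> (on_arr \<Sigma> f) = on_ob \<Sigma> (tgt \<C> f)"
proof -
  have 1: "\<forall>A\<in>Obj \<C>. on_ob \<Sigma> A \<in> Obj \<C>" and
    2: "\<forall>A\<in>Obj \<C>. \<forall>B\<in>Obj \<C>. \<forall>f\<in>Mor \<C> A B. on_arr \<Sigma> f \<in> Mor \<C> (on_ob \<Sigma> A) (on_ob \<Sigma> B)"
    using endofunctor by (simp_all add: endofunctor_def)
  show "A \<in> Obj \<C> \<Longrightarrow> on_ob \<Sigma> A \<in> Obj \<C>" using 1 by blast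
  assume f: "f \<in> Arr \<C>"
  hence "on_arr \<Sigma> f \<in> Mor \<C> (on_ob \<Sigma> (src \<C> f)) (on_ob \<Sigma> (tgt \<C> f))"
    using 2[rule_format, of "src \<C> f" "tgt \<C> f" f] by (simp add: Mor_def)
  thus "on_arr \<Sigma> f \<in> Arr \<C>" "src \<C> (on_arr \<Sigma> f) = on_ob \<Sigma> (src \<C> f)"
    "tgt \<C> (on_arr \<Sigma> f) = on_ob \<Sigma> (tgt \<C> f)" by (simp_all add: Mor_def)
qed

lemma Sigma_idt [simp]: "A \<in> Obj \<C> \<Longrightarrow> on_arr \<Sigma> (idt \<C> A) = idt \<C> (on_ob \<Sigma> A)"
  using endofunctor by (simp add: endofunctor_def)

lemma Sigma_cmp [simp]:
  "\<lbrakk>f \<in> Arr \<C>; g \<in> Arr \<C>; tgt \<C> f = src \<C> g\<rbrakk> \<Longrightarrow> on_arr \<Sigma> (g \<cdot> f) = on_arr \<Sigma> g \<cdot> on_arr \<Sigma> f"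
  using endofunctor by (simp add: endofunctor_def)

text \<open>Faithfulness, from the inverse functor; it allows a map to be recognized as zero after
  \<open>\<Sigma>\<close> has been applied.\<close>

lemma Sigma_eq_iff:
  assumes "f \<in> Arr \<C>" "g \<in> Arr \<C>"
  shows "on_arr \<Sigma> f = on_arr \<Sigma> g \<longleftrightarrow> f = g"
proof -
  obtain \<Omega> :: "('o, 'm) endo" where "\<forall>f\<in>Arr \<C>. on_arr \<Omega> (on_arr \<Sigma> f) = f"
    using automorphism unfolding automorphism_def by blast
  thus ?thesis using assms by metis
qed

lemma push_E:
  assumes "a \<in> Arr \<C>" "\<delta> \<in> Arr \<C>" "src \<C> \<delta> = C" "tgt \<C> \<delta> = on_ob \<Sigma> (src \<C> a)"
  shows "push \<C> E C a \<delta> = on_arr \<Sigma> a \<cdot> \<delta>"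
  using assms by (auto simp: push_def sigma_bifunctor_def)

lemma pull_E:
  assumes "A \<in> Obj \<C>" "c \<in> Arr \<C>" "\<delta> \<in> Arr \<C>" "src \<C> \<delta> = tgt \<C> c" "tgt \<C> \<delta> = on_ob \<Sigma> A"
  shows "pull \<C> E A c \<delta> = \<delta> \<cdot> c"
  using assms by (auto simp: pull_def sigma_bifunctor_def)

lemma carrier_E: "\<delta> \<in> carrier (egrp E C A) \<longleftrightarrow> \<delta> \<in> Mor \<C> C (on_ob \<Sigma> A)"
  by (simp add: sigma_bifunctor_def Mor_group_def)

text \<open>Additivity of \<open>\<Sigma>\<close> is biadditivity of \<open>\<C>(-, \<Sigma> -)\<close>, evaluated at an identity.\<close>

lemma Sigma_add [simp]:
  assumes "f \<in> Arr \<C>" "g \<in> Arr \<C>" "src \<C> f = src \<C> g" "tgt \<C> f = tgt \<C> g"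
  shows "on_arr \<Sigma> (f \<boxplus> g) = on_arr \<Sigma> f \<boxplus> on_arr \<Sigma> g"
  using eact_add_right[of "idt \<C> (on_ob \<Sigma> (src \<C> g))" "on_ob \<Sigma> (src \<C> g)" "on_ob \<Sigma> (src \<C> g)"
      f "src \<C> g" "tgt \<C> g" g "idt \<C> (on_ob \<Sigma> (src \<C> g))"] assms
  by (simp add: sigma_bifunctor_def Mor_group_def Mor_def)

lemma Sigma_zerom [simp]:
  assumes "A \<in> Obj \<C>" "B \<in> Obj \<C>"
  shows "on_arr \<Sigma> (zerom \<C> A B) = zerom \<C> (on_ob \<Sigma> A) (on_ob \<Sigma> B)"
  by (rule add_left_cancel[of "on_arr \<Sigma> (zerom \<C> A B)"])
    (use assms Sigma_add[of "zerom \<C> A B" "zerom \<C> A B"] in \<open>simp_all del: Sigma_add\<close>)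

lemma Sigma_neg [simp]: "f \<in> Arr \<C> \<Longrightarrow> on_arr \<Sigma> (neg \<C> f) = neg \<C> (on_arr \<Sigma> f)"
  using Sigma_add[of f "neg \<C> f"] by (intro neg_unique[symmetric]) (simp_all del: Sigma_add)

lemma Sigma_negs [simp]: "f \<in> Arr \<C> \<Longrightarrow> on_arr \<Sigma> ((neg \<C> ^^ k) f) = (neg \<C> ^^ k) (on_arr \<Sigma> f)"
  by (induction k) simp_all

text \<open>Since \<delta>_sharp sends f to \<delta> f, the first sequence in the definition of an
  n-exangle is C(-,X) continued by C(-,\<Sigma> X^0). Appending \<delta> as one more differential
  makes its exactness a case of \<open>exact\<close>.\<close>

definition ext_seq :: "('o, 'm) seq \<Rightarrow> 'm \<Rightarrow> ('o, 'm) seq" where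
  "ext_seq X \<delta> = \<lparr>ob = (\<lambda>i. if i \<le> Suc n then ob X i else on_ob \<Sigma> (ob X 0)),
                  df = (\<lambda>i. if i \<le> n then df X i else \<delta>)\<rparr>"

definition ext_map :: "(nat \<Rightarrow> 'm) \<Rightarrow> nat \<Rightarrow> 'm" where
  "ext_map f i = (if i \<le> Suc n then f i else on_arr \<Sigma> (f 0))"

text \<open>Exactness at C(X^0,-). The map \<delta>^sharp sends g to (\<Sigma> g) \<delta>, so
  \<delta> is tested against \<open>\<Sigma> g\<close> and not against g; this distinguishes the
  condition from those in \<open>coexact\<close>.\<close>

definition start_exact :: "('o, 'm) seq \<Rightarrow> 'm \<Rightarrow> bool" where
  "start_exact X \<delta> \<longleftrightarrow> on_arr \<Sigma> (df X 0) \<cdot> \<delta> = zerom \<C> (ob X (Suc n)) (on_ob \<Sigma> (ob X 1)) \<and>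
     (\<forall>g\<in>Arr \<C>. src \<C> g = ob X 0 \<longrightarrow>
       on_arr \<Sigma> g \<cdot> \<delta> = zerom \<C> (ob X (Suc n)) (on_ob \<Sigma> (tgt \<C> g)) \<longrightarrow>
       (\<exists>k\<in>Arr \<C>. src \<C> k = ob X 1 \<and> tgt \<C> k = tgt \<C> g \<and> g = k \<cdot> df X 0))"

lemma ext_seq_simps [simp]:
  "i \<le> Suc n \<Longrightarrow> ob (ext_seq X \<delta>) i = ob X i" "ob (ext_seq X \<delta>) (Suc (Suc n)) = on_ob \<Sigma> (ob X 0)"
  "i \<le> n \<Longrightarrow> df (ext_seq X \<delta>) i = df X i" "df (ext_seq X \<delta>) (Suc n) = \<delta>"
  by (simp_all add: ext_seq_def)

lemma sequence_ext_seq: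
  assumes "sequence \<C> n X" "\<delta> \<in> Arr \<C>" "src \<C> \<delta> = ob X (Suc n)" "tgt \<C> \<delta> = on_ob \<Sigma> (ob X 0)"
  shows "sequence \<C> (Suc n) (ext_seq X \<delta>)"
  using sequenceD[OF assms(1)] assms(2-)
  by (auto simp: sequence_def Mor_def ext_seq_def not_le le_Suc_eq)

lemma start_exact_iff:
  assumes X: "complex \<C> n X" and \<delta>: "\<delta> \<in> Arr \<C>" "src \<C> \<delta> = ob X (Suc n)" "tgt \<C> \<delta> = on_ob \<Sigma> (ob X 0)"
  shows "(\<forall>Z\<in>Obj \<C>. kernel (Mor_group \<C> (ob X 0) Z) (egrp E (ob X (n + 1)) Z)
      (\<lambda>g. push \<C> E (ob X (n + 1)) g \<delta>) = (\<lambda>g. g \<cdot> df X 0) ` Mor \<C> (ob X 1) Z)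
    \<longleftrightarrow> start_exact X \<delta>" (is "?L \<longleftrightarrow> ?R")
proof -
  note [simp] = complexD[OF X] \<delta>
  have [simp]: "ob X (Suc 0) \<in> Obj \<C>" using n_pos by simp
  have in_kernel: "g \<in> kernel (Mor_group \<C> (ob X 0) Z) (egrp E (ob X (n + 1)) Z)
      (\<lambda>g. push \<C> E (ob X (n + 1)) g \<delta>) \<longleftrightarrow> g \<in> Arr \<C> \<and> src \<C> g = ob X 0 \<and> tgt \<C> g = Z \<and>
      on_arr \<Sigma> g \<cdot> \<delta> = zerom \<C> (ob X (Suc n)) (on_ob \<Sigma> Z)" for g Z
    using push_E[of g \<delta>] by (auto simp: kernel_def Mor_group_def sigma_bifunctor_def Mor_def)
  show ?thesis
  proof
    assume L: ?L
    have "df X 0 \<in> (\<lambda>g. g \<cdot> df X 0) ` Mor \<C> (ob X 1) (ob X 1)"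
      by (intro image_eqI[of _ _ "idt \<C> (ob X 1)"]) (simp_all add: Mor_def)
    hence "on_arr \<Sigma> (df X 0) \<cdot> \<delta> = zerom \<C> (ob X (Suc n)) (on_ob \<Sigma> (ob X 1))"
      using L[rule_format, of "ob X 1", symmetric] in_kernel by simp
    moreover have "\<exists>k\<in>Arr \<C>. src \<C> k = ob X 1 \<and> tgt \<C> k = tgt \<C> g \<and> g = k \<cdot> df X 0"
      if "g \<in> Arr \<C>" "src \<C> g = ob X 0"
        "on_arr \<Sigma> g \<cdot> \<delta> = zerom \<C> (ob X (Suc n)) (on_ob \<Sigma> (tgt \<C> g))" for g
    proof -
      have "g \<in> (\<lambda>g. g \<cdot> df X 0) ` Mor \<C> (ob X 1) (tgt \<C> g)"
        using L[rule_format, of "tgt \<C> g"] in_kernel[of g "tgt \<C> g"] that by simp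
      thus ?thesis by (auto simp: Mor_def)
    qed
    ultimately show ?R by (simp add: start_exact_def)
  next
    assume R: ?R
    show ?L
    proof (intro ballI equalityI subsetI)
      fix Z g assume "Z \<in> Obj \<C>" and "g \<in> kernel (Mor_group \<C> (ob X 0) Z) (egrp E (ob X (n + 1)) Z)
        (\<lambda>g. push \<C> E (ob X (n + 1)) g \<delta>)"
      thus "g \<in> (\<lambda>g. g \<cdot> df X 0) ` Mor \<C> (ob X 1) Z"
        using R unfolding in_kernel start_exact_def by (auto simp: Mor_def)
    next
      fix Z g assume "Z \<in> Obj \<C>" and "g \<in> (\<lambda>g. g \<cdot> df X 0) ` Mor \<C> (ob X 1) Z"
      then obtain k where k: "k \<in> Arr \<C>" "src \<C> k = ob X 1" "tgt \<C> k = Z" and g: "g = k \<cdot> df X 0"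
        by (auto simp: Mor_def)
      have "on_arr \<Sigma> (df X 0) \<cdot> \<delta> = zerom \<C> (ob X (Suc n)) (on_ob \<Sigma> (ob X 1))"
        using R by (simp add: start_exact_def)
      thus "g \<in> kernel (Mor_group \<C> (ob X 0) Z) (egrp E (ob X (n + 1)) Z)
        (\<lambda>g. push \<C> E (ob X (n + 1)) g \<delta>)"
        unfolding in_kernel g using k n_pos by simp
    qed
  qed
qed

text \<open>The three conjuncts are the first sequence, the terms of the second from degree 1 to n,
  and its term in degree 0. The type of \<delta> is hidden on the right: it is part of the
  lengthened sequence being a complex.\<close>

lemma n_exangle_iff:
  "n_exangle \<C> E n X \<delta> \<longleftrightarrow> exact (Suc n) (ext_seq X \<delta>) \<and> coexact n X \<and> start_exact X \<delta>"
  (is "?L \<longleftrightarrow> ?R")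
proof -
  let ?Y = "ext_seq X \<delta>"
  have typed: "\<delta> \<in> Arr \<C>" "src \<C> \<delta> = ob X (Suc n)" "tgt \<C> \<delta> = on_ob \<Sigma> (ob X 0)"
    if "exact (Suc n) ?Y"
    using sequenceD(2-4)[of "Suc n" ?Y "Suc n"] that
    by (simp_all add: exact_def)
  have main: "?L \<longleftrightarrow> ?R"
    if X: "complex \<C> n X" and \<delta> [simp]: "\<delta> \<in> Arr \<C>" "src \<C> \<delta> = ob X (Suc n)"
      "tgt \<C> \<delta> = on_ob \<Sigma> (ob X 0)"
  proof -
    note [simp] = complexD[OF X]
    have Y: "sequence \<C> (Suc n) ?Y" by (rule sequence_ext_seq) (use X in simp_all)
    note Yd = sequenceD[OF Y]
    have ker_end: "kernel (Mor_group \<C> Z (ob X (n + 1))) (egrp E Z (ob X 0)) (\<lambda>f. pull \<C> E (ob X 0) f \<delta>)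
        = kernel (Mor_group \<C> Z (ob ?Y (Suc n))) (Mor_group \<C> Z (ob ?Y (Suc (Suc n)))) (\<lambda>f. df ?Y (Suc n) \<cdot> f)"
      for Z
      using pull_E[of "ob X 0" _ \<delta>]
      by (auto simp: kernel_def Mor_group_def sigma_bifunctor_def Mor_def)
    have "(\<forall>Z\<in>Obj \<C>.
        (\<forall>i\<in>{1..n}.
           kernel (Mor_group \<C> Z (ob X i)) (Mor_group \<C> Z (ob X (i + 1))) (\<lambda>f. df X i \<cdot> f)
           = (\<lambda>f. df X (i - 1) \<cdot> f) ` Mor \<C> Z (ob X (i - 1))) \<and>
        kernel (Mor_group \<C> Z (ob X (n + 1))) (egrp E Z (ob X 0)) (\<lambda>f. pull \<C> E (ob X 0) f \<delta>)
        = (\<lambda>f. df X n \<cdot> f) ` Mor \<C> Z (ob X n))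
      \<longleftrightarrow> (\<forall>i<Suc n. \<forall>Z\<in>Obj \<C>. kernel (Mor_group \<C> Z (ob ?Y (Suc i)))
            (Mor_group \<C> Z (ob ?Y (Suc (Suc i)))) (\<lambda>f. df ?Y (Suc i) \<cdot> f)
           = (\<lambda>f. df ?Y i \<cdot> f) ` Mor \<C> Z (ob ?Y i))"
      unfolding ker_end
      unfolding ball_atLeast1 All_less_Suc by (auto simp: n_pos)
    also have "\<dots> \<longleftrightarrow> exact (Suc n) ?Y"
      unfolding exact_def complex_def using Y Yd
        kernel_eq_image[of "df ?Y (Suc i)" "ob ?Y (Suc i)" "ob ?Y (Suc (Suc i))" "df ?Y i" "ob ?Y i" for i]
      by (simp add: all_conj_distrib imp_conjR del: ext_seq_simps)
    finally have 1: "(\<forall>Z\<in>Obj \<C>.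
        (\<forall>i\<in>{1..n}.
           kernel (Mor_group \<C> Z (ob X i)) (Mor_group \<C> Z (ob X (i + 1))) (\<lambda>f. df X i \<cdot> f)
           = (\<lambda>f. df X (i - 1) \<cdot> f) ` Mor \<C> Z (ob X (i - 1))) \<and>
        kernel (Mor_group \<C> Z (ob X (n + 1))) (egrp E Z (ob X 0)) (\<lambda>f. pull \<C> E (ob X 0) f \<delta>)
        = (\<lambda>f. df X n \<cdot> f) ` Mor \<C> Z (ob X n)) \<longleftrightarrow> exact (Suc n) ?Y" .
    have "(\<forall>Z\<in>Obj \<C>. \<forall>i\<in>{1..n}.
        kernel (Mor_group \<C> (ob X i) Z) (Mor_group \<C> (ob X (i - 1)) Z) (\<lambda>g. g \<cdot> df X (i - 1))
           = (\<lambda>g. g \<cdot> df X i) ` Mor \<C> (ob X (i + 1)) Z)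
      \<longleftrightarrow> (\<forall>i<n. \<forall>Z\<in>Obj \<C>. kernel (Mor_group \<C> (ob X (Suc i)) Z) (Mor_group \<C> (ob X i) Z)
         (\<lambda>g. g \<cdot> df X i) = (\<lambda>g. g \<cdot> df X (Suc i)) ` Mor \<C> (ob X (Suc (Suc i))) Z)"
      unfolding ball_atLeast1 by auto
    also have "\<dots> \<longleftrightarrow> coexact n X"
      unfolding coexact_def using X complex_df[OF X]
        cokernel_eq_image[of "df X (Suc i)" "ob X (Suc i)" "ob X (Suc (Suc i))" "df X i" "ob X i" for i]
      by simp
    finally have 2: "(\<forall>Z\<in>Obj \<C>. \<forall>i\<in>{1..n}.
        kernel (Mor_group \<C> (ob X i) Z) (Mor_group \<C> (ob X (i - 1)) Z) (\<lambda>g. g \<cdot> df X (i - 1))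
           = (\<lambda>g. g \<cdot> df X i) ` Mor \<C> (ob X (i + 1)) Z) \<longleftrightarrow> coexact n X" .
    have "\<delta> \<in> carrier (egrp E (ob X (n + 1)) (ob X 0))" by (simp add: carrier_E Mor_def)
    thus ?thesis
      unfolding n_exangle_def 1 ball_conj_distrib[of "Obj \<C>" "\<lambda>Z. \<forall>i\<in>{1..n}.
        kernel (Mor_group \<C> (ob X i) Z) (Mor_group \<C> (ob X (i - 1)) Z) (\<lambda>g. g \<cdot> df X (i - 1))
           = (\<lambda>g. g \<cdot> df X i) ` Mor \<C> (ob X (i + 1)) Z"] 2 start_exact_iff[OF X \<delta>]
      using X by blast
  qed
  show ?thesis
  proof
    assume L: ?L
    hence "complex \<C> n X" "\<delta> \<in> Arr \<C>" "src \<C> \<delta> = ob X (Suc n)" "tgt \<C> \<delta> = on_ob \<Sigma> (ob X 0)"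
      by (simp_all add: n_exangle_def carrier_E Mor_def)
    thus ?R using main L by blast
  next
    assume R: ?R
    hence "complex \<C> n X" by (simp add: coexact_def)
    thus ?L using main typed R by blast
  qed
qed

section \<open>Realizations, lifts and recognition of angles\<close>

lemma angle_complex: "angle X \<delta> \<Longrightarrow> complex \<C> n X"
  by (simp add: distinguished_def)

lemma angleD:
  assumes "angle X \<delta>"
  shows "\<delta> \<in> Arr \<C>" "src \<C> \<delta> = ob X (Suc n)" "tgt \<C> \<delta> = on_ob \<Sigma> (ob X 0)"
    "i \<le> Suc n \<Longrightarrow> ob X i \<in> Obj \<C>" "i \<le> n \<Longrightarrow> df X i \<in> Arr \<C>"
    "i \<le> n \<Longrightarrow> src \<C> (df X i) = ob X i" "i \<le> n \<Longrightarrow> tgt \<C> (df X i) = ob X (Suc i)"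
  using assms complexD[OF angle_complex[OF assms]] by (simp_all add: distinguished_def carrier_E Mor_def)

lemma angle_exact:
  assumes "angle X \<delta>"
  shows "exact (Suc n) (ext_seq X \<delta>)" "coexact n X" "start_exact X \<delta>"
  using R1[OF assms] by (simp_all add: n_exangle_iff)

lemma mem_angles:
  "(X, \<delta>) \<in> distinguished_sigma_sequences \<C> \<Sigma> n s \<longleftrightarrow> angle X \<delta>"
  by (auto simp: distinguished_sigma_sequences_def sigma_sequences_def distinguished_def complex_def carrier_E)

lemma mem_sigma_sequences:
  "(X, \<delta>) \<in> sigma_sequences \<C> \<Sigma> n \<longleftrightarrow> sequence \<C> n X \<and> \<delta> \<in> Arr \<C> \<and>
    src \<C> \<delta> = ob X (Suc n) \<and> tgt \<C> \<delta> = on_ob \<Sigma> (ob X 0)"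
  by (auto simp: sigma_sequences_def Mor_def)

lemma sigma_morphism_iff:
  "sigma_morphism \<C> \<Sigma> n (X, \<delta>) (Y, \<rho>) f \<longleftrightarrow>
    chain_map \<C> n X Y f \<and> on_arr \<Sigma> (f 0) \<cdot> \<delta> = \<rho> \<cdot> f (Suc n)"
  by (simp add: sigma_morphism_def chain_map_def)

lemma chain_map_ext:
  assumes X: "sequence \<C> n X" and "\<delta> \<in> Arr \<C>" "src \<C> \<delta> = ob X (Suc n)" "tgt \<C> \<delta> = on_ob \<Sigma> (ob X 0)"
    and Y: "sequence \<C> n Y" and "\<rho> \<in> Arr \<C>" "src \<C> \<rho> = ob Y (Suc n)" "tgt \<C> \<rho> = on_ob \<Sigma> (ob Y 0)"
    and f: "sigma_morphism \<C> \<Sigma> n (X, \<delta>) (Y, \<rho>) f"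
  shows "chain_map \<C> (Suc n) (ext_seq X \<delta>) (ext_seq Y \<rho>) (ext_map f)"
proof -
  have ch: "chain_map \<C> n X Y f" and sq: "on_arr \<Sigma> (f 0) \<cdot> \<delta> = \<rho> \<cdot> f (Suc n)"
    using f by (simp_all add: sigma_morphism_iff)
  note [simp] = sequenceD[OF X] sequenceD[OF Y] chain_mapD[OF ch]
  show ?thesis
    unfolding chain_map_def
  proof (intro conjI allI impI)
    show "ext_map f i \<in> Mor \<C> (ob (ext_seq X \<delta>) i) (ob (ext_seq Y \<rho>) i)" if "i \<le> Suc n + 1" for i
      using that assms by (cases "i \<le> Suc n") (auto simp: Mor_def ext_seq_def ext_map_def)
    show "ext_map f (i + 1) \<cdot> df (ext_seq X \<delta>) i = df (ext_seq Y \<rho>) i \<cdot> ext_map f i"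
      if "i \<le> Suc n" for i
      using that sq by (cases "i \<le> n") (auto simp: not_le le_Suc_eq ext_map_def)
  qed
qed

lemma ex_angle:
  assumes "\<delta> \<in> Arr \<C>" "tgt \<C> \<delta> = on_ob \<Sigma> A" "A \<in> Obj \<C>"
  obtains X where "angle X \<delta>" "ob X 0 = A" "ob X (Suc n) = src \<C> \<delta>"
proof -
  have \<delta>: "\<delta> \<in> carrier (egrp E (src \<C> \<delta>) A)"
    using assms by (simp add: carrier_E Mor_def)
  obtain X where "X \<in> complexes_between \<C> n A (src \<C> \<delta>)" "s (src \<C> \<delta>) A \<delta> = homotopy_class \<C> n A (src \<C> \<delta>) X"
    using realizes[OF _ _ \<delta>] assms by auto
  thus thesis
    using \<delta> by (intro that[of X]) (auto simp: complexes_between_def distinguished_def)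
qed

text \<open>For this bifunctor a morphism of extensions is precisely the last square of a morphism
  of \<Sigma>-sequences, so (R0) fills in the inner components once the two outer ones are
  given.\<close>

lemma ex_lift:
  assumes X: "angle X \<delta>" and Y: "angle Y \<rho>"
    and a: "a \<in> Arr \<C>" "src \<C> a = ob X 0" "tgt \<C> a = ob Y 0"
    and c: "c \<in> Arr \<C>" "src \<C> c = ob X (Suc n)" "tgt \<C> c = ob Y (Suc n)"
    and eq: "on_arr \<Sigma> a \<cdot> \<delta> = \<rho> \<cdot> c"
  obtains f where "chain_map \<C> n X Y f" "f 0 = a" "f (Suc n) = c"
proof -
  have "push \<C> E (ob X (n + 1)) a \<delta> = pull \<C> E (ob Y 0) c \<rho>"
    using angleD[OF X] angleD[OF Y] a c eq by (simp add: push_E pull_E)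
  thus thesis using R0[OF X Y, of a c] a c that by (auto simp: Mor_def)
qed

text \<open>\<open>Z\<close> realizes \<omega>, and both complexes are exact in their inner terms,
  so the two chain maps with identity ends force equal homotopy classes.\<close>

lemma angleI:
  assumes W: "n_exangle \<C> E n W \<omega>" and Z: "angle Z \<omega>"
    and ends: "ob Z 0 = ob W 0" "ob Z (Suc n) = ob W (Suc n)"
    and f: "chain_map \<C> n Z W f" "f 0 = idt \<C> (ob W 0)" "f (Suc n) = idt \<C> (ob W (Suc n))"
    and g: "chain_map \<C> n W Z g" "g 0 = idt \<C> (ob W 0)" "g (Suc n) = idt \<C> (ob W (Suc n))"
  shows "angle W \<omega>"
proof -
  have cW: "coexact n W" using W by (simp add: n_exangle_iff)
  have "homotopy_class \<C> n (ob W 0) (ob W (Suc n)) Z = homotopy_class \<C> n (ob W 0) (ob W (Suc n)) W"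
    by (rule homotopy_class_eq[where f = f and g = g, OF angle_exact(2)[OF Z] cW])
      (use ends f g in \<open>simp_all add: chain_map_fixing_ends_def\<close>)
  thus ?thesis
    using Z ends coexact_complex[OF cW] by (simp add: distinguished_def)
qed

lemma start_exactE:
  assumes "start_exact X \<delta>" "g \<in> Arr \<C>" "src \<C> g = ob X 0" "tgt \<C> g = T"
    "on_arr \<Sigma> g \<cdot> \<delta> = zerom \<C> (ob X (Suc n)) (on_ob \<Sigma> T)"
  obtains k where "k \<in> Arr \<C>" "src \<C> k = ob X (Suc 0)" "tgt \<C> k = T" "g = k \<cdot> df X 0"
  using assms unfolding start_exact_def One_nat_def by blast

text \<open>
  Direct sums, direct summands and isomorphic copies of angles all arise as sequences \<open>W\<close> with
  maps from and to two angles such that \<open>i1 p1 + i2 p2 = 1\<close>; a retract of one angle is the case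
  \<open>i2 = p2 = 0\<close>. Splicing the lifts of the end components gives the maps between \<open>W\<close>
  and a realization of its last morphism.
\<close>

lemma angle_retract_of_pair:
  assumes X: "angle X \<delta>" and Y: "angle Y \<rho>" and W: "(W, \<omega>) \<in> sigma_sequences \<C> \<Sigma> n"
    and i1: "sigma_morphism \<C> \<Sigma> n (X, \<delta>) (W, \<omega>) i1" and p1: "sigma_morphism \<C> \<Sigma> n (W, \<omega>) (X, \<delta>) p1"
    and i2: "sigma_morphism \<C> \<Sigma> n (Y, \<rho>) (W, \<omega>) i2" and p2: "sigma_morphism \<C> \<Sigma> n (W, \<omega>) (Y, \<rho>) p2"
    and r: "retract_of_pair n W i1 p1 i2 p2"
  shows "angle W \<omega>"
proof -
  have sW: "sequence \<C> n W" and \<omega>: "\<omega> \<in> Arr \<C>" "src \<C> \<omega> = ob W (Suc n)" "tgt \<C> \<omega> = on_ob \<Sigma> (ob W 0)"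
    using W by (simp_all add: mem_sigma_sequences)
  have ch: "chain_map \<C> n X W i1" "chain_map \<C> n W X p1" "chain_map \<C> n Y W i2" "chain_map \<C> n W Y p2"
    and sq: "on_arr \<Sigma> (i1 0) \<cdot> \<delta> = \<omega> \<cdot> i1 (Suc n)" "on_arr \<Sigma> (p1 0) \<cdot> \<omega> = \<delta> \<cdot> p1 (Suc n)"
      "on_arr \<Sigma> (i2 0) \<cdot> \<rho> = \<omega> \<cdot> i2 (Suc n)" "on_arr \<Sigma> (p2 0) \<cdot> \<omega> = \<rho> \<cdot> p2 (Suc n)"
    using i1 p1 i2 p2 by (simp_all add: sigma_morphism_iff)
  note cX = angle_complex[OF X] and cY = angle_complex[OF Y]
  note sX = complex_sequence[OF cX] and sY = complex_sequence[OF cY]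
  note [simp] = sequenceD[OF sW] angleD[OF X] angleD[OF Y] \<omega>
    chain_mapD(1-3)[OF ch(1)] chain_mapD(1-3)[OF ch(2)]
    chain_mapD(1-3)[OF ch(3)] chain_mapD(1-3)[OF ch(4)]
  have [simp]: "i \<le> n \<Longrightarrow> ob X (Suc i) \<in> Obj \<C>" "i \<le> n \<Longrightarrow> ob Y (Suc i) \<in> Obj \<C>"
    "i \<le> n \<Longrightarrow> ob W (Suc i) \<in> Obj \<C>" for i by simp_all
  have sum: "(i1 k \<cdot> p1 k) \<boxplus> (i2 k \<cdot> p2 k) = idt \<C> (ob W k)" if "k \<le> Suc n" for k
    using r that by (simp add: retract_of_pair_def)
  \<comment> \<open>Exactness of \<open>W\<close> has to be known before it can be compared with a
    realization. In the added degree, the relation i1 p1 + i2 p2 = 1 is the image under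
    \<open>\<Sigma>\<close> of the one in degree 0.\<close>
  have "exact (Suc n) (ext_seq W \<omega>)"
  proof (rule exact_retract_of_pair[OF _ angle_exact(1)[OF X] angle_exact(1)[OF Y]])
    show "sequence \<C> (Suc n) (ext_seq W \<omega>)" by (rule sequence_ext_seq[OF sW \<omega>])
    show "chain_map \<C> (Suc n) (ext_seq X \<delta>) (ext_seq W \<omega>) (ext_map i1)"
      by (rule chain_map_ext[OF sX _ _ _ sW \<omega> i1]) simp_all
    show "chain_map \<C> (Suc n) (ext_seq W \<omega>) (ext_seq X \<delta>) (ext_map p1)"
      by (rule chain_map_ext[OF sW \<omega> sX _ _ _ p1]) simp_all
    show "chain_map \<C> (Suc n) (ext_seq Y \<rho>) (ext_seq W \<omega>) (ext_map i2)"
      by (rule chain_map_ext[OF sY _ _ _ sW \<omega> i2]) simp_all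
    show "chain_map \<C> (Suc n) (ext_seq W \<omega>) (ext_seq Y \<rho>) (ext_map p2)"
      by (rule chain_map_ext[OF sW \<omega> sY _ _ _ p2]) simp_all
    have "(on_arr \<Sigma> (i1 0) \<cdot> on_arr \<Sigma> (p1 0)) \<boxplus> (on_arr \<Sigma> (i2 0) \<cdot> on_arr \<Sigma> (p2 0)) =
        idt \<C> (on_ob \<Sigma> (ob W 0))"
      using arg_cong[OF sum[of 0], of "on_arr \<Sigma>"] by simp
    thus "retract_of_pair (Suc n) (ext_seq W \<omega>) (ext_map i1) (ext_map p1) (ext_map i2) (ext_map p2)"
      using sum by (auto simp: retract_of_pair_def ext_map_def ext_seq_def le_Suc_eq)
  qed
  moreover have "coexact n W"
    by (rule coexact_retract_of_pair[OF sW angle_exact(2)[OF X] angle_exact(2)[OF Y] ch r])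
  moreover have "start_exact W \<omega>"
    unfolding start_exact_def One_nat_def
  proof (intro conjI ballI impI)
    have dX: "on_arr \<Sigma> (df X 0) \<cdot> \<delta> = zerom \<C> (ob X (Suc n)) (on_ob \<Sigma> (ob X (Suc 0)))"
      and dY: "on_arr \<Sigma> (df Y 0) \<cdot> \<rho> = zerom \<C> (ob Y (Suc n)) (on_ob \<Sigma> (ob Y (Suc 0)))"
      using angle_exact(3)[OF X] angle_exact(3)[OF Y] by (simp_all add: start_exact_def)
    have i1d: "on_arr \<Sigma> (df W 0) \<cdot> on_arr \<Sigma> (i1 0) = on_arr \<Sigma> (i1 (Suc 0)) \<cdot> on_arr \<Sigma> (df X 0)"
      using arg_cong[OF chain_mapD(4)[OF ch(1), of 0], of "on_arr \<Sigma>"] by simp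
    have i2d: "on_arr \<Sigma> (df W 0) \<cdot> on_arr \<Sigma> (i2 0) = on_arr \<Sigma> (i2 (Suc 0)) \<cdot> on_arr \<Sigma> (df Y 0)"
      using arg_cong[OF chain_mapD(4)[OF ch(3), of 0], of "on_arr \<Sigma>"] by simp
    \<comment> \<open>Inserting the identity in degree n + 1 and moving i1 and i2 across the last
      squares expresses \<omega> through \<delta> and \<rho>, both of which are killed by \<Sigma>
      d.\<close>
    have "\<omega> = (\<omega> \<cdot> (i1 (Suc n) \<cdot> p1 (Suc n))) \<boxplus> (\<omega> \<cdot> (i2 (Suc n) \<cdot> p2 (Suc n)))"
      by (rule retract_of_pair_split(2)[OF r _ sW sX sY ch]) simp_all
    also have "\<dots> = (on_arr \<Sigma> (i1 0) \<cdot> (\<delta> \<cdot> p1 (Suc n))) \<boxplus> (on_arr \<Sigma> (i2 0) \<cdot> (\<rho> \<cdot> p2 (Suc n)))"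
      using cmp_cong_right[OF sq(1), of "p1 (Suc n)"] cmp_cong_right[OF sq(3), of "p2 (Suc n)"] by simp
    finally have \<omega>_eq: "\<omega> = \<dots>" .
    show "on_arr \<Sigma> (df W 0) \<cdot> \<omega> = zerom \<C> (ob W (Suc n)) (on_ob \<Sigma> (ob W (Suc 0)))"
      by (subst \<omega>_eq)
        (use cmp_cong_right[OF i1d, of "\<delta> \<cdot> p1 (Suc n)"] cmp_cong_right[OF i2d, of "\<rho> \<cdot> p2 (Suc n)"]
          cmp_zerom_right[OF dX, of "p1 (Suc n)"] cmp_zerom_right[OF dY, of "p2 (Suc n)"] in simp)
    fix g assume g [simp]: "g \<in> Arr \<C>" "src \<C> g = ob W 0"
      and g\<omega>: "on_arr \<Sigma> g \<cdot> \<omega> = zerom \<C> (ob W (Suc n)) (on_ob \<Sigma> (tgt \<C> g))"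
    have t: "g \<cdot> i1 0 \<in> Arr \<C>" "src \<C> (g \<cdot> i1 0) = ob X 0" "tgt \<C> (g \<cdot> i1 0) = tgt \<C> g"
      "g \<cdot> i2 0 \<in> Arr \<C>" "src \<C> (g \<cdot> i2 0) = ob Y 0" "tgt \<C> (g \<cdot> i2 0) = tgt \<C> g"
      by simp_all
    have z1: "on_arr \<Sigma> (g \<cdot> i1 0) \<cdot> \<delta> = zerom \<C> (ob X (Suc n)) (on_ob \<Sigma> (tgt \<C> g))"
      using sq(1) cmp_zerom_right[OF g\<omega>, of "i1 (Suc n)"] by simp
    have z2: "on_arr \<Sigma> (g \<cdot> i2 0) \<cdot> \<rho> = zerom \<C> (ob Y (Suc n)) (on_ob \<Sigma> (tgt \<C> g))"
      using sq(3) cmp_zerom_right[OF g\<omega>, of "i2 (Suc n)"] by simp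
    obtain k1 where k1: "k1 \<in> Arr \<C>" "src \<C> k1 = ob X (Suc 0)" "tgt \<C> k1 = tgt \<C> g" and k1_eq: "g \<cdot> i1 0 = k1 \<cdot> df X 0"
      by (rule start_exactE[OF angle_exact(3)[OF X] t(1-3) z1])
    obtain k2 where k2: "k2 \<in> Arr \<C>" "src \<C> k2 = ob Y (Suc 0)" "tgt \<C> k2 = tgt \<C> g" and k2_eq: "g \<cdot> i2 0 = k2 \<cdot> df Y 0"
      by (rule start_exactE[OF angle_exact(3)[OF Y] t(4-6) z2])
    let ?k = "(k1 \<cdot> p1 (Suc 0)) \<boxplus> (k2 \<cdot> p2 (Suc 0))"
    have "g = (g \<cdot> (i1 0 \<cdot> p1 0)) \<boxplus> (g \<cdot> (i2 0 \<cdot> p2 0))"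
      by (rule retract_of_pair_split(2)[OF r _ sW sX sY ch]) simp_all
    also have "g \<cdot> (i1 0 \<cdot> p1 0) = k1 \<cdot> p1 (Suc 0) \<cdot> df W 0"
      using k1 cmp_cong_right[OF k1_eq, of "p1 0"] chain_mapD(4)[OF ch(2), of 0] by simp
    also have "g \<cdot> (i2 0 \<cdot> p2 0) = k2 \<cdot> p2 (Suc 0) \<cdot> df W 0"
      using k2 cmp_cong_right[OF k2_eq, of "p2 0"] chain_mapD(4)[OF ch(4), of 0] by simp
    also have "k1 \<cdot> p1 (Suc 0) \<cdot> df W 0 \<boxplus> k2 \<cdot> p2 (Suc 0) \<cdot> df W 0 = ?k \<cdot> df W 0"
      using k1 k2 by simp
    finally have "g = ?k \<cdot> df W 0" .
    moreover have "?k \<in> Arr \<C>" "src \<C> ?k = ob W (Suc 0)" "tgt \<C> ?k = tgt \<C> g"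
      using k1 k2 by simp_all
    ultimately show "\<exists>k\<in>Arr \<C>. src \<C> k = ob W (Suc 0) \<and> tgt \<C> k = tgt \<C> g \<and> g = k \<cdot> df W 0"
      by blast
  qed
  ultimately have exW: "n_exangle \<C> E n W \<omega>" by (simp add: n_exangle_iff)
  obtain Z where Z: "angle Z \<omega>" and [simp]: "ob Z 0 = ob W 0" "ob Z (Suc n) = ob W (Suc n)"
    by (rule ex_angle[of \<omega> "ob W 0"]) simp_all
  note sZ = complex_sequence[OF angle_complex[OF Z]]
  obtain q1 where q1: "chain_map \<C> n Z X q1" "q1 0 = p1 0" "q1 (Suc n) = p1 (Suc n)"
    by (rule ex_lift[OF Z X, of "p1 0" "p1 (Suc n)"]) (use sq in simp_all)
  obtain q2 where q2: "chain_map \<C> n Z Y q2" "q2 0 = p2 0" "q2 (Suc n) = p2 (Suc n)"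
    by (rule ex_lift[OF Z Y, of "p2 0" "p2 (Suc n)"]) (use sq in simp_all)
  obtain j1 where j1: "chain_map \<C> n X Z j1" "j1 0 = i1 0" "j1 (Suc n) = i1 (Suc n)"
    by (rule ex_lift[OF X Z, of "i1 0" "i1 (Suc n)"]) (use sq in simp_all)
  obtain j2 where j2: "chain_map \<C> n Y Z j2" "j2 0 = i2 0" "j2 (Suc n) = i2 (Suc n)"
    by (rule ex_lift[OF Y Z, of "i2 0" "i2 (Suc n)"]) (use sq in simp_all)
  show ?thesis
  \<comment> \<open>The lifts agree with p1, p2, i1, i2 at both ends, so each sum below has ends i1
    p1 + i2 p2 = 1.\<close>
  proof (rule angleI[OF exW Z])
    show "chain_map \<C> n Z W (\<lambda>k. (i1 k \<cdot> q1 k) \<boxplus> (i2 k \<cdot> q2 k))"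
      by (intro chain_map_add chain_map_cmp[OF sZ sX sW q1(1) ch(1)]
          chain_map_cmp[OF sZ sY sW q2(1) ch(3)] sZ sW)
    show "chain_map \<C> n W Z (\<lambda>k. (j1 k \<cdot> p1 k) \<boxplus> (j2 k \<cdot> p2 k))"
      by (intro chain_map_add chain_map_cmp[OF sW sX sZ ch(2) j1(1)]
          chain_map_cmp[OF sW sY sZ ch(4) j2(1)] sZ sW)
  qed (use sum q1(2,3) q2(2,3) j1(2,3) j2(2,3) in simp_all)
qed

text \<open>The form in which sequences are compared below: \<open>W\<close> may differ from a known
  angle by signs or by zero summands, and a single composite has to be checked.\<close>

lemma angle_retract:
  assumes X: "angle X \<delta>" and W: "(W, \<omega>) \<in> sigma_sequences \<C> \<Sigma> n"
    and i: "sigma_morphism \<C> \<Sigma> n (X, \<delta>) (W, \<omega>) i" and p: "sigma_morphism \<C> \<Sigma> n (W, \<omega>) (X, \<delta>) p"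
    and r: "\<And>k. k \<le> Suc n \<Longrightarrow> i k \<cdot> p k = idt \<C> (ob W k)"
  shows "angle W \<omega>"
proof -
  have sW: "sequence \<C> n W" and \<omega>: "\<omega> \<in> Arr \<C>" "src \<C> \<omega> = ob W (Suc n)" "tgt \<C> \<omega> = on_ob \<Sigma> (ob W 0)"
    using W by (simp_all add: mem_sigma_sequences)
  note [simp] = sequenceD[OF sW] angleD[OF X] \<omega>
  show ?thesis
  proof (rule angle_retract_of_pair[OF X X W i p])
    show "sigma_morphism \<C> \<Sigma> n (X, \<delta>) (W, \<omega>) (\<lambda>k. zerom \<C> (ob X k) (ob W k))"
      "sigma_morphism \<C> \<Sigma> n (W, \<omega>) (X, \<delta>) (\<lambda>k. zerom \<C> (ob W k) (ob X k))"
      by (auto simp: sigma_morphism_iff chain_map_def Mor_def)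
    show "retract_of_pair n W i p (\<lambda>k. zerom \<C> (ob X k) (ob W k)) (\<lambda>k. zerom \<C> (ob W k) (ob X k))"
      by (simp add: retract_of_pair_def r)
  qed
qed

section \<open>Trivial angles and suspensions\<close>

lemma angle_initial_trivial:
  assumes A: "A \<in> Obj \<C>"
  shows "angle (initial_trivial \<C> A) (zerom \<C> (zero_object \<C>) (on_ob \<Sigma> A))"
  using R2_initial[OF A] A n_pos
  by (auto simp: distinguished_def complex_def sequence_def initial_trivial_def carrier_E Mor_def
      sigma_bifunctor_def Mor_group_def Let_def)

definition suspension_seq :: "'o \<Rightarrow> ('o, 'm) seq" where
  "suspension_seq A = (let X = (\<lambda>i. if i = 0 then A else if i \<le> n then zero_object \<C> else on_ob \<Sigma> A)
     in \<lparr>ob = X, df = (\<lambda>i. zerom \<C> (X i) (X (Suc i)))\<rparr>)"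

lemma suspension_seq_simps [simp]:
  "ob (suspension_seq A) 0 = A" "ob (suspension_seq A) (Suc n) = on_ob \<Sigma> A"
  "\<lbrakk>i \<le> n; i \<noteq> 0\<rbrakk> \<Longrightarrow> ob (suspension_seq A) i = zero_object \<C>"
  "df (suspension_seq A) i = zerom \<C> (ob (suspension_seq A) i) (ob (suspension_seq A) (Suc i))"
  by (simp_all add: suspension_seq_def Let_def)

lemma suspension_seq_obj [simp]: "A \<in> Obj \<C> \<Longrightarrow> ob (suspension_seq A) i \<in> Obj \<C>"
  by (simp add: suspension_seq_def Let_def)

lemma angle_suspension_seq:
  assumes A [simp]: "A \<in> Obj \<C>"
  shows "angle (suspension_seq A) (idt \<C> (on_ob \<Sigma> A))"
proof -
  let ?T = "suspension_seq A" and ?\<iota> = "idt \<C> (on_ob \<Sigma> A)"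
  have T: "complex \<C> n ?T"
    by (auto simp: complex_def sequence_def Mor_def)
  have "exact (Suc n) (ext_seq ?T ?\<iota>)"
    unfolding exact_def
  proof (intro conjI allI ballI impI)
    show "complex \<C> (Suc n) (ext_seq ?T ?\<iota>)"
      unfolding complex_def using complex_df[OF T] sequence_ext_seq[of ?T ?\<iota>] T
      by (auto simp: less_Suc_eq)
    fix i f assume i: "i < Suc n" and f [simp]: "f \<in> Arr \<C>" "tgt \<C> f = ob (ext_seq ?T ?\<iota>) (Suc i)"
      and df: "df (ext_seq ?T ?\<iota>) (Suc i) \<cdot> f = zerom \<C> (src \<C> f) (ob (ext_seq ?T ?\<iota>) (Suc (Suc i)))"
    \<comment> \<open>All cocycles vanish: in the last degree because the differential is an
      identity, in the others because they end in a zero object.\<close>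
    have "f = zerom \<C> (src \<C> f) (ob ?T (Suc i))"
    proof (cases "i = n")
      case True thus ?thesis using df f by simp
    next
      case False thus ?thesis using i f to_zero_object[OF zero_object, of f] by simp
    qed
    hence "f = df (ext_seq ?T ?\<iota>) i \<cdot> zerom \<C> (src \<C> f) (ob ?T i)"
      using i by simp
    thus "\<exists>k\<in>Arr \<C>. src \<C> k = src \<C> f \<and> tgt \<C> k = ob (ext_seq ?T ?\<iota>) i \<and> f = df (ext_seq ?T ?\<iota>) i \<cdot> k"
      using i by (intro bexI[of _ "zerom \<C> (src \<C> f) (ob ?T i)"] conjI) simp_all
  qed
  moreover have "coexact n ?T"
    unfolding coexact_def
  proof (intro conjI T allI ballI impI)
    fix i g assume i: "i < n" and g [simp]: "g \<in> Arr \<C>" "src \<C> g = ob ?T (Suc i)"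
    have "g = zerom \<C> (ob ?T (Suc i)) (tgt \<C> g)"
      using i from_zero_object[OF zero_object, of g] by simp
    hence "g = zerom \<C> (ob ?T (Suc (Suc i))) (tgt \<C> g) \<cdot> df ?T (Suc i)" by simp
    thus "\<exists>k\<in>Arr \<C>. src \<C> k = ob ?T (Suc (Suc i)) \<and> tgt \<C> k = tgt \<C> g \<and> g = k \<cdot> df ?T (Suc i)"
      by (intro bexI[of _ "zerom \<C> (ob ?T (Suc (Suc i))) (tgt \<C> g)"] conjI) simp_all
  qed
  moreover have "start_exact ?T ?\<iota>"
    unfolding start_exact_def
  proof (intro conjI ballI impI)
    show "on_arr \<Sigma> (df ?T 0) \<cdot> ?\<iota> = zerom \<C> (ob ?T (Suc n)) (on_ob \<Sigma> (ob ?T 1))" by simp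
    fix g assume g [simp]: "g \<in> Arr \<C>" "src \<C> g = ob ?T 0"
      and "on_arr \<Sigma> g \<cdot> ?\<iota> = zerom \<C> (ob ?T (Suc n)) (on_ob \<Sigma> (tgt \<C> g))"
    hence "on_arr \<Sigma> g = on_arr \<Sigma> (zerom \<C> A (tgt \<C> g))" by simp
    hence "g = zerom \<C> A (tgt \<C> g)" by (subst (asm) Sigma_eq_iff) simp_all
    hence "g = zerom \<C> (ob ?T 1) (tgt \<C> g) \<cdot> df ?T 0" by simp
    thus "\<exists>k\<in>Arr \<C>. src \<C> k = ob ?T 1 \<and> tgt \<C> k = tgt \<C> g \<and> g = k \<cdot> df ?T 0"
      by (intro bexI[of _ "zerom \<C> (ob ?T 1) (tgt \<C> g)"] conjI) simp_all
  qed
  ultimately have ex: "n_exangle \<C> E n ?T ?\<iota>" by (simp add: n_exangle_iff)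
  obtain Z where Z: "angle Z ?\<iota>" and Z0: "ob Z 0 = A" and Z1: "ob Z (Suc n) = on_ob \<Sigma> A"
    by (rule ex_angle[of ?\<iota> A]) simp_all
  note [simp] = angleD(4-7)[OF Z] Z0 Z1
  \<comment> \<open>With an identity as extension, (\<Sigma> d^0) \<delta> = 0 and \<delta> d^n = 0
    kill the outer differentials of any realization. Hence identities at the ends and zeros in
    between are chain maps in both directions, whatever \<open>Z\<close> looks like inside.\<close>
  have "on_arr \<Sigma> (df Z 0) = on_arr \<Sigma> (zerom \<C> A (ob Z (Suc 0)))"
    using angle_exact(3)[OF Z] by (simp add: start_exact_def)
  hence d0 [simp]: "df Z 0 = zerom \<C> A (ob Z (Suc 0))" by (subst (asm) Sigma_eq_iff) simp_all
  have dn [simp]: "df Z n = zerom \<C> (ob Z n) (on_ob \<Sigma> A)"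
    using complex_df[OF exact_complex[OF angle_exact(1)[OF Z]], of n] by simp
  let ?f = "\<lambda>i. if i = 0 then idt \<C> A else if i = Suc n then idt \<C> (on_ob \<Sigma> A) else zerom \<C> (ob Z i) (ob ?T i)"
  let ?g = "\<lambda>i. if i = 0 then idt \<C> A else if i = Suc n then idt \<C> (on_ob \<Sigma> A) else zerom \<C> (ob ?T i) (ob Z i)"
  show ?thesis
  proof (rule angleI[OF ex Z])
    show "chain_map \<C> n Z ?T ?f"
      using n_pos by (auto simp: chain_map_def Mor_def)
    show "chain_map \<C> n ?T Z ?g"
      using n_pos by (auto simp: chain_map_def Mor_def)
  qed simp_all
qed

section \<open>Columns into a suspended sum\<close>

lemma sigma_colm_arr [simp]:
  assumes "f \<in> Arr \<C>" "g \<in> Arr \<C>" "src \<C> f = src \<C> g" "A \<in> Obj \<C>" "B \<in> Obj \<C>"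
    "tgt \<C> f = on_ob \<Sigma> A" "tgt \<C> g = on_ob \<Sigma> B"
  shows "sigma_colm \<C> \<Sigma> A B f g \<in> Arr \<C>" "src \<C> (sigma_colm \<C> \<Sigma> A B f g) = src \<C> g"
    "tgt \<C> (sigma_colm \<C> \<Sigma> A B f g) = on_ob \<Sigma> (dsum \<C> A B)"
  using assms by (simp_all add: sigma_colm_def)

lemma sigma_colm_cmp [simp]:
  assumes "f \<in> Arr \<C>" "g \<in> Arr \<C>" "src \<C> f = src \<C> g" "A \<in> Obj \<C>" "B \<in> Obj \<C>"
    "tgt \<C> f = on_ob \<Sigma> A" "tgt \<C> g = on_ob \<Sigma> B" "h \<in> Arr \<C>" "tgt \<C> h = src \<C> g"
  shows "sigma_colm \<C> \<Sigma> A B f g \<cdot> h = sigma_colm \<C> \<Sigma> A B (f \<cdot> h) (g \<cdot> h)"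
  using assms by (simp add: sigma_colm_def)

lemma Sigma_colm_cmp [simp]:
  assumes "a \<in> Arr \<C>" "b \<in> Arr \<C>" "src \<C> a = src \<C> b" "h \<in> Arr \<C>" "tgt \<C> h = on_ob \<Sigma> (src \<C> b)"
  shows "on_arr \<Sigma> (colm \<C> a b) \<cdot> h = sigma_colm \<C> \<Sigma> (tgt \<C> a) (tgt \<C> b) (on_arr \<Sigma> a \<cdot> h) (on_arr \<Sigma> b \<cdot> h)"
  using assms by (simp add: sigma_colm_def colm_def)

text \<open>\<open>\<Sigma> (A \<oplus> B)\<close> need not be the chosen sum of
  \<open>\<Sigma> A\<close> and \<open>\<Sigma> B\<close>. Its injections are the images of
  \<open>inj1\<close> and \<open>inj2\<close>, and functoriality evaluates the row on each of
  them.\<close>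

lemma Sigma_rowm_cmp [simp]:
  assumes "a \<in> Arr \<C>" "b \<in> Arr \<C>" "tgt \<C> a = tgt \<C> b" "src \<C> a = A" "src \<C> b = B"
    "f \<in> Arr \<C>" "g \<in> Arr \<C>" "src \<C> f = src \<C> g" "A \<in> Obj \<C>" "B \<in> Obj \<C>"
    "tgt \<C> f = on_ob \<Sigma> A" "tgt \<C> g = on_ob \<Sigma> B"
  shows "on_arr \<Sigma> (rowm \<C> a b) \<cdot> sigma_colm \<C> \<Sigma> A B f g = (on_arr \<Sigma> a \<cdot> f) \<boxplus> (on_arr \<Sigma> b \<cdot> g)"
proof -
  have 1: "on_arr \<Sigma> (rowm \<C> a b) \<cdot> on_arr \<Sigma> (inj1 \<C> A B) = on_arr \<Sigma> a"
    using assms(1-5,9,10) by (subst Sigma_cmp[symmetric]) simp_all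
  have 2: "on_arr \<Sigma> (rowm \<C> a b) \<cdot> on_arr \<Sigma> (inj2 \<C> A B) = on_arr \<Sigma> b"
    using assms(1-5,9,10) by (subst Sigma_cmp[symmetric]) simp_all
  have 3: "on_arr \<Sigma> (rowm \<C> a b) \<cdot> (on_arr \<Sigma> (inj1 \<C> A B) \<cdot> f) = on_arr \<Sigma> a \<cdot> f"
    using arg_cong[OF 1, of "\<lambda>h. h \<cdot> f"] assms by simp
  have 4: "on_arr \<Sigma> (rowm \<C> a b) \<cdot> (on_arr \<Sigma> (inj2 \<C> A B) \<cdot> g) = on_arr \<Sigma> b \<cdot> g"
    using arg_cong[OF 2, of "\<lambda>h. h \<cdot> g"] assms by simp
  show ?thesis using assms 3 4 by (simp add: sigma_colm_def)
qed

lemma neg_sigma_colm [simp]: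
  assumes "f \<in> Arr \<C>" "g \<in> Arr \<C>" "src \<C> f = src \<C> g" "A \<in> Obj \<C>" "B \<in> Obj \<C>"
    "tgt \<C> f = on_ob \<Sigma> A" "tgt \<C> g = on_ob \<Sigma> B"
  shows "neg \<C> (sigma_colm \<C> \<Sigma> A B f g) = sigma_colm \<C> \<Sigma> A B (neg \<C> f) (neg \<C> g)"
  using assms by (simp add: sigma_colm_def)

lemma negs_sigma_colm [simp]:
  assumes "f \<in> Arr \<C>" "g \<in> Arr \<C>" "src \<C> f = src \<C> g" "A \<in> Obj \<C>" "B \<in> Obj \<C>"
    "tgt \<C> f = on_ob \<Sigma> A" "tgt \<C> g = on_ob \<Sigma> B"
  shows "(neg \<C> ^^ k) (sigma_colm \<C> \<Sigma> A B f g) = sigma_colm \<C> \<Sigma> A B ((neg \<C> ^^ k) f) ((neg \<C> ^^ k) g)"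
  by (induction k) (use assms in simp_all)

section \<open>Sums, summands and rotations of angles\<close>

lemma sigma_dsum:
  assumes X: "(X, \<delta>) \<in> sigma_sequences \<C> \<Sigma> n" and Y: "(Y, \<rho>) \<in> sigma_sequences \<C> \<Sigma> n"
  shows "sigma_dsum \<C> \<Sigma> n (X, \<delta>) (Y, \<rho>) \<in> sigma_sequences \<C> \<Sigma> n" (is "?S \<in> _")
    "sigma_morphism \<C> \<Sigma> n (X, \<delta>) (sigma_dsum \<C> \<Sigma> n (X, \<delta>) (Y, \<rho>)) (\<lambda>i. inj1 \<C> (ob X i) (ob Y i))"
    "sigma_morphism \<C> \<Sigma> n (sigma_dsum \<C> \<Sigma> n (X, \<delta>) (Y, \<rho>)) (X, \<delta>) (\<lambda>i. pr1 \<C> (ob X i) (ob Y i))"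
    "sigma_morphism \<C> \<Sigma> n (Y, \<rho>) (sigma_dsum \<C> \<Sigma> n (X, \<delta>) (Y, \<rho>)) (\<lambda>i. inj2 \<C> (ob X i) (ob Y i))"
    "sigma_morphism \<C> \<Sigma> n (sigma_dsum \<C> \<Sigma> n (X, \<delta>) (Y, \<rho>)) (Y, \<rho>) (\<lambda>i. pr2 \<C> (ob X i) (ob Y i))"
proof -
  have sX: "sequence \<C> n X" and [simp]: "\<delta> \<in> Arr \<C>" "src \<C> \<delta> = ob X (Suc n)" "tgt \<C> \<delta> = on_ob \<Sigma> (ob X 0)"
    and sY: "sequence \<C> n Y" and [simp]: "\<rho> \<in> Arr \<C>" "src \<C> \<rho> = ob Y (Suc n)" "tgt \<C> \<rho> = on_ob \<Sigma> (ob Y 0)"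
    using X Y by (simp_all add: mem_sigma_sequences)
  note [simp] = sequenceD[OF sX] sequenceD[OF sY]
  show "?S \<in> sigma_sequences \<C> \<Sigma> n"
    by (auto simp: sigma_dsum_def mem_sigma_sequences sequence_def Mor_def)
  show "sigma_morphism \<C> \<Sigma> n (X, \<delta>) ?S (\<lambda>i. inj1 \<C> (ob X i) (ob Y i))"
    "sigma_morphism \<C> \<Sigma> n ?S (X, \<delta>) (\<lambda>i. pr1 \<C> (ob X i) (ob Y i))"
    "sigma_morphism \<C> \<Sigma> n (Y, \<rho>) ?S (\<lambda>i. inj2 \<C> (ob X i) (ob Y i))"
    "sigma_morphism \<C> \<Sigma> n ?S (Y, \<rho>) (\<lambda>i. pr2 \<C> (ob X i) (ob Y i))"
    unfolding sigma_dsum_def sigma_morphism_def by (auto simp: Mor_def matrix_simps)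
qed

lemma angles_iso:
  assumes "S \<in> distinguished_sigma_sequences \<C> \<Sigma> n s" "T \<in> sigma_sequences \<C> \<Sigma> n"
    "sigma_isomorphic \<C> \<Sigma> n S T"
  shows "T \<in> distinguished_sigma_sequences \<C> \<Sigma> n s"
proof -
  obtain X \<delta> Y \<rho> where ST: "S = (X, \<delta>)" "T = (Y, \<rho>)" by (cases S, cases T)
  obtain f g where "sigma_morphism \<C> \<Sigma> n (X, \<delta>) (Y, \<rho>) f" "sigma_morphism \<C> \<Sigma> n (Y, \<rho>) (X, \<delta>) g"
    "\<And>i. i \<le> Suc n \<Longrightarrow> f i \<cdot> g i = idt \<C> (ob Y i)"
    using assms(3) by (auto simp: sigma_isomorphic_def ST)
  thus ?thesis using assms(1,2) angle_retract[of X \<delta> Y \<rho> f g] by (simp add: ST mem_angles)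
qed

lemma angles_dsum:
  assumes "S \<in> distinguished_sigma_sequences \<C> \<Sigma> n s" "T \<in> distinguished_sigma_sequences \<C> \<Sigma> n s"
  shows "sigma_dsum \<C> \<Sigma> n S T \<in> distinguished_sigma_sequences \<C> \<Sigma> n s"
proof -
  obtain X \<delta> Y \<rho> where ST: "S = (X, \<delta>)" "T = (Y, \<rho>)" by (cases S, cases T)
  obtain W \<omega> where W: "sigma_dsum \<C> \<Sigma> n (X, \<delta>) (Y, \<rho>) = (W, \<omega>)" by fastforce
  have obW: "ob W = (\<lambda>i. dsum \<C> (ob X i) (ob Y i))" using W by (auto simp: sigma_dsum_def)
  have X: "angle X \<delta>" and Y: "angle Y \<rho>" using assms by (simp_all add: ST mem_angles)
  have "(X, \<delta>) \<in> sigma_sequences \<C> \<Sigma> n" "(Y, \<rho>) \<in> sigma_sequences \<C> \<Sigma> n"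
    using assms by (auto simp: ST distinguished_sigma_sequences_def)
  note D = sigma_dsum[OF this, unfolded W]
  have "angle W \<omega>"
    by (rule angle_retract_of_pair[OF X Y D])
      (use angleD(4)[OF X] angleD(4)[OF Y] in \<open>simp add: retract_of_pair_def obW\<close>)
  thus ?thesis by (simp add: ST W mem_angles)
qed

text \<open>The sum is an angle as an isomorphic copy of \<open>T\<close>, and the first summand is
  a retract of it through its projection and injection.\<close>

lemma angles_summand:
  assumes S: "S \<in> sigma_sequences \<C> \<Sigma> n" "S' \<in> sigma_sequences \<C> \<Sigma> n"
    and T: "T \<in> distinguished_sigma_sequences \<C> \<Sigma> n s" "sigma_isomorphic \<C> \<Sigma> n T (sigma_dsum \<C> \<Sigma> n S S')"
  shows "S \<in> distinguished_sigma_sequences \<C> \<Sigma> n s"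
proof -
  obtain X \<delta> Y \<rho> where SS: "S = (X, \<delta>)" "S' = (Y, \<rho>)" by (cases S, cases S')
  obtain W \<omega> where W: "sigma_dsum \<C> \<Sigma> n (X, \<delta>) (Y, \<rho>) = (W, \<omega>)" by fastforce
  note D = sigma_dsum[OF S[unfolded SS], unfolded W]
  have "(W, \<omega>) \<in> distinguished_sigma_sequences \<C> \<Sigma> n s"
    using angles_iso[OF T(1) _ T(2)] D(1) by (simp add: SS W)
  hence "angle W \<omega>" by (simp add: mem_angles)
  moreover have "pr1 \<C> (ob X k) (ob Y k) \<cdot> inj1 \<C> (ob X k) (ob Y k) = idt \<C> (ob X k)" if "k \<le> Suc n" for k
    using S that sequenceD(1)[of n X] sequenceD(1)[of n Y] by (simp add: SS mem_sigma_sequences)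
  ultimately have "angle X \<delta>"
    using angle_retract[OF _ _ D(3) D(2)] S by (simp add: SS)
  thus ?thesis by (simp add: SS mem_angles)
qed

section \<open>Rotation in both directions\<close>

lemma rotation_eq:
  "rotation \<C> \<Sigma> n (X, \<delta>) = (\<lparr>ob = (\<lambda>i. if i \<le> n then ob X (i + 1) else on_ob \<Sigma> (ob X 0)),
     df = (\<lambda>i. if i < n then df X (i + 1) else \<delta>)\<rparr>, (neg \<C> ^^ n) (on_arr \<Sigma> (df X 0)))"
  by (simp add: rotation_def)

lemma rotation_sigma_sequences:
  assumes "(X, \<delta>) \<in> sigma_sequences \<C> \<Sigma> n"
  shows "rotation \<C> \<Sigma> n (X, \<delta>) \<in> sigma_sequences \<C> \<Sigma> n"
proof -
  have sX: "sequence \<C> n X" and [simp]: "\<delta> \<in> Arr \<C>" "src \<C> \<delta> = ob X (Suc n)" "tgt \<C> \<delta> = on_ob \<Sigma> (ob X 0)"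
    using assms by (simp_all add: mem_sigma_sequences)
  note [simp] = sequenceD[OF sX]
  show ?thesis
    unfolding rotation_eq mem_sigma_sequences by (auto simp: sequence_def Mor_def)
qed

lemma angle_rotation:
  assumes X: "angle X \<delta>"
  shows "rotation \<C> \<Sigma> n (X, \<delta>) \<in> distinguished_sigma_sequences \<C> \<Sigma> n s"
proof -
  let ?A = "ob X 0" and ?Y = "suspension_seq (ob X 0)"
  let ?\<iota> = "idt \<C> (on_ob \<Sigma> ?A)"
  note [simp] = angleD[OF X]
  have [simp]: "i \<le> n \<Longrightarrow> ob X (Suc i) \<in> Obj \<C>" for i by simp
  have Y: "angle ?Y ?\<iota>" by (rule angle_suspension_seq) simp
  \<comment> \<open>(EA2) is applied with \<rho> the identity of \<Sigma> X^0 and c = \<delta>. Its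
    pull-back is \<delta> itself, and the extension of the cone is \<Sigma> d^0, the last morphism
    of the rotation up to sign.\<close>
  have [simp]: "pull \<C> E ?A \<delta> ?\<iota> = \<delta>" "push \<C> E (on_ob \<Sigma> ?A) (df X 0) ?\<iota> = on_arr \<Sigma> (df X 0)"
    by (simp_all add: pull_E push_E)
  obtain f where ch: "chain_map \<C> n X ?Y f" and fn: "f (Suc n) = \<delta>"
    and M: "angle (mapping_cone \<C> n X ?Y f) (on_arr \<Sigma> (df X 0))"
    using EA2[of ?A "ob X (Suc n)" "on_ob \<Sigma> ?A" ?\<iota> \<delta> X ?Y] X Y
    by (auto simp: carrier_E Mor_def)
  obtain R \<omega> where R: "rotation \<C> \<Sigma> n (X, \<delta>) = (R, \<omega>)" by fastforce
  have R_eq: "ob R = (\<lambda>i. if i \<le> n then ob X (Suc i) else on_ob \<Sigma> ?A)"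
    "df R = (\<lambda>i. if i < n then df X (Suc i) else \<delta>)" "\<omega> = (neg \<C> ^^ n) (on_arr \<Sigma> (df X 0))"
    using R by (auto simp: rotation_eq)
  note fD = chain_mapD(1-3)[OF ch]
  have f0: "f i = zerom \<C> (ob X i) (zero_object \<C>)" if "i \<le> n" "i \<noteq> 0" for i
    using to_zero_object[OF zero_object, of "f i"] fD[of i] that by simp
  \<comment> \<open>The cone has differentials -d up to degree n - 1, but \<delta> unchanged in
    degree n. So the sign is (-1)^k up to k = n and stays (-1)^n in degree n + 1, which accounts for
    the factor (-1)^n in the last morphism.\<close>
  let ?i = "\<lambda>k. if k = 0 then idt \<C> (ob X 1) else
    if k \<le> n then (neg \<C> ^^ k) (pr1 \<C> (ob X (Suc k)) (ob ?Y k)) else (neg \<C> ^^ n) ?\<iota>"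
  let ?p = "\<lambda>k. if k = 0 then idt \<C> (ob X 1) else
    if k \<le> n then (neg \<C> ^^ k) (inj1 \<C> (ob X (Suc k)) (ob ?Y k)) else (neg \<C> ^^ n) ?\<iota>"
  have "angle R \<omega>"
  proof (rule angle_retract[OF M])
    show "(R, \<omega>) \<in> sigma_sequences \<C> \<Sigma> n"
      using rotation_sigma_sequences[of X \<delta>] X
      by (simp add: R mem_sigma_sequences angle_complex)
    show "sigma_morphism \<C> \<Sigma> n (mapping_cone \<C> n X ?Y f, on_arr \<Sigma> (df X 0)) (R, \<omega>) ?i"
      unfolding sigma_morphism_def using n_pos
      by (auto simp: mapping_cone_def R_eq Mor_def fn f0 matrix_simps not_less le_Suc_eq)
    show "sigma_morphism \<C> \<Sigma> n (R, \<omega>) (mapping_cone \<C> n X ?Y f, on_arr \<Sigma> (df X 0)) ?p"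
      unfolding sigma_morphism_def using n_pos
      by (auto simp: mapping_cone_def R_eq Mor_def fn f0 matrix_simps not_less le_Suc_eq)
    show "?i k \<cdot> ?p k = idt \<C> (ob R k)" if "k \<le> Suc n" for k
      using that by (auto simp: R_eq le_Suc_eq)
  qed
  thus ?thesis by (simp add: R mem_angles)
qed

lemma negs_commute: "(neg \<C> ^^ k) ((neg \<C> ^^ m) f) = (neg \<C> ^^ m) ((neg \<C> ^^ k) f)"
  by (metis add.commute comp_apply funpow_add)

lemma Sigma_colm:
  assumes "a \<in> Arr \<C>" "b \<in> Arr \<C>" "src \<C> a = src \<C> b"
  shows "on_arr \<Sigma> (colm \<C> a b) = sigma_colm \<C> \<Sigma> (tgt \<C> a) (tgt \<C> b) (on_arr \<Sigma> a) (on_arr \<Sigma> b)"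
  using assms by (simp add: sigma_colm_def colm_def)

lemma angle_of_rotation:
  assumes X: "(X, \<delta>) \<in> sigma_sequences \<C> \<Sigma> n"
    and rot: "rotation \<C> \<Sigma> n (X, \<delta>) \<in> distinguished_sigma_sequences \<C> \<Sigma> n s"
  shows "angle X \<delta>"
proof -
  have sX: "sequence \<C> n X" and [simp]: "\<delta> \<in> Arr \<C>" "src \<C> \<delta> = ob X (Suc n)" "tgt \<C> \<delta> = on_ob \<Sigma> (ob X 0)"
    using X by (simp_all add: mem_sigma_sequences)
  note [simp] = sequenceD[OF sX]
  have [simp]: "i \<le> n \<Longrightarrow> ob X (Suc i) \<in> Obj \<C>" for i by simp
  \<comment> \<open>With this sign in \<open>?a\<close>, the push-forward of the identity of
    \<Sigma> X^0 along \<open>?a\<close> is exactly the last morphism of the rotation.\<close>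
  let ?A = "ob X 0" and ?Z = "zero_object \<C>" and ?a = "(neg \<C> ^^ n) (df X 0)"
  let ?T = "suspension_seq ?A" and ?\<iota> = "idt \<C> (on_ob \<Sigma> ?A)"
  obtain R \<omega> where R: "rotation \<C> \<Sigma> n (X, \<delta>) = (R, \<omega>)" by fastforce
  have R_eq: "ob R = (\<lambda>i. if i \<le> n then ob X (Suc i) else on_ob \<Sigma> ?A)"
    "df R = (\<lambda>i. if i < n then df X (Suc i) else \<delta>)" "\<omega> = (neg \<C> ^^ n) (on_arr \<Sigma> (df X 0))"
    using R by (auto simp: rotation_eq)
  have aR: "angle R \<omega>" using rot by (simp add: R mem_angles)
  have T: "angle ?T ?\<iota>" by (rule angle_suspension_seq) simp
  have [simp]: "push \<C> E (on_ob \<Sigma> ?A) ?a ?\<iota> = \<omega>" "pull \<C> E ?A \<delta> ?\<iota> = \<delta>"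
    by (simp_all add: pull_E push_E R_eq)
  obtain h where ch: "chain_map \<C> n ?T R h" and h0: "h 0 = ?a"
    and M: "angle (mapping_cocone \<C> n ?T R h) \<delta>"
    using EA2_op[of ?A "ob X (Suc 0)" "on_ob \<Sigma> ?A" ?\<iota> ?a ?T R] T aR
    by (auto simp: carrier_E Mor_def R_eq)
  have h_zero: "h i = zerom \<C> ?Z (ob X (Suc i))" if "i \<le> n" "i \<noteq> 0" for i
    using from_zero_object[OF zero_object, of "h i"] chain_mapD(1-3)[OF ch, of i] that by (simp add: R_eq)
  let ?M = "mapping_cocone \<C> n ?T R h"
  have ob_M: "ob ?M i = (if i = 0 then ?A else if i \<le> n then dsum \<C> ?Z (ob X i) else ob X (Suc n))" for i
    by (cases i) (auto simp: mapping_cocone_def R_eq)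
  have df_M: "df ?M i = (if i = 0 then colm \<C> (zerom \<C> ?A ?Z) ?a
      else if i < n then matm \<C> (zerom \<C> ?Z ?Z) (zerom \<C> (ob X i) ?Z) (zerom \<C> ?Z (ob X (Suc i))) (neg \<C> (df X i))
      else rowm \<C> (zerom \<C> ?Z (ob X (Suc n))) (neg \<C> (df X n)))" if "i \<le> n" for i
    using that n_pos h_zero[of n] by (cases i) (auto simp: mapping_cocone_def R_eq h0 h_zero)
  \<comment> \<open>The cocone has first differential (-1)^n d^0 and -d^k for 1 \<le> k \<le> n. The
    product of these signs is 1, so both ends can be identities, as the common extension \<delta>
    demands; the signs in between are (-1)^(n+1+k).\<close>
  let ?i = "\<lambda>k. if k = 0 then idt \<C> ?A else
    if k \<le> n then (neg \<C> ^^ n) (neg \<C> ((neg \<C> ^^ k) (pr2 \<C> ?Z (ob X k)))) else idt \<C> (ob X (Suc n))"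
  let ?p = "\<lambda>k. if k = 0 then idt \<C> ?A else
    if k \<le> n then (neg \<C> ^^ n) (neg \<C> ((neg \<C> ^^ k) (inj2 \<C> ?Z (ob X k)))) else idt \<C> (ob X (Suc n))"
  show ?thesis
  proof (rule angle_retract[OF M X])
    show "sigma_morphism \<C> \<Sigma> n (?M, \<delta>) (X, \<delta>) ?i"
      unfolding sigma_morphism_def using n_pos
      by (auto simp: ob_M df_M Mor_def matrix_simps not_less le_Suc_eq)
    show "sigma_morphism \<C> \<Sigma> n (X, \<delta>) (?M, \<delta>) ?p"
      unfolding sigma_morphism_def using n_pos
      by (auto simp: ob_M df_M Mor_def matrix_simps not_less le_Suc_eq)
    show "?i k \<cdot> ?p k = idt \<C> (ob X k)" if "k \<le> Suc n" for k
      using that negs_commute[of n k] by (auto simp: le_Suc_eq)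
  qed
qed

section \<open>Good morphisms\<close>

lemma initial_trivial_simps [simp]:
  "ob (initial_trivial \<C> A) 0 = A" "ob (initial_trivial \<C> A) (Suc 0) = A"
  "ob (initial_trivial \<C> A) (Suc (Suc i)) = zero_object \<C>"
  "df (initial_trivial \<C> A) 0 = idt \<C> A"
  "df (initial_trivial \<C> A) (Suc i) =
    zerom \<C> (ob (initial_trivial \<C> A) (Suc i)) (ob (initial_trivial \<C> A) (Suc (Suc i)))"
  by (simp_all add: initial_trivial_def Let_def)

text \<open>The sum of \<open>X\<close> and the trivial angle B = B, transported along the
  involution of X^0 \<oplus> B with rows (1, 0) and (f, -1). The entry -1 is what lets the row
  [f^1 -d] produce [0 d] later.\<close>

definition twisted_source :: "('o, 'm) seq \<Rightarrow> 'o \<Rightarrow> 'm \<Rightarrow> ('o, 'm) seq" where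
  "twisted_source X B f =
    \<lparr>ob = (\<lambda>i. if i = 0 then dsum \<C> (ob X 0) B else if i = 1 then dsum \<C> (ob X 1) B else ob X i),
     df = (\<lambda>i. if i = 0 then matm \<C> (df X 0) (zerom \<C> B (ob X 1)) f (neg \<C> (idt \<C> B))
       else if i = 1 then rowm \<C> (df X 1) (zerom \<C> B (ob X 2)) else df X i)\<rparr>"

lemma angle_twisted_source:
  assumes X: "angle X \<delta>" and f [simp]: "f \<in> Arr \<C>" "src \<C> f = ob X 0" "tgt \<C> f = B"
  shows "angle (twisted_source X B f) (sigma_colm \<C> \<Sigma> (ob X 0) B \<delta> (on_arr \<Sigma> f \<cdot> \<delta>))"
    (is "angle ?P ?\<omega>")
proof -
  note [simp] = angleD[OF X]
  have B [simp]: "B \<in> Obj \<C>" using arr_obj(2)[OF f(1)] f(3) by simp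
  have n0: "Suc 0 \<le> n" "0 < n" using n_pos by simp_all
  have [simp]: "i \<le> n \<Longrightarrow> ob X (Suc i) \<in> Obj \<C>" for i by simp
  have [simp]: "ob X (Suc 0) \<in> Obj \<C>" "ob X (Suc (Suc 0)) \<in> Obj \<C>" "df X (Suc 0) \<in> Arr \<C>"
    "src \<C> (df X (Suc 0)) = ob X (Suc 0)" "tgt \<C> (df X (Suc 0)) = ob X (Suc (Suc 0))" using n0 by simp_all
  let ?B = "initial_trivial \<C> B" and ?Z = "zero_object \<C>"
  have less2: "i = 0 \<or> i = Suc 0 \<or> (\<exists>j. i = Suc (Suc j))" for i by (metis not0_implies_Suc)
  have cases3: "(\<forall>i\<le>m. Q i) \<longleftrightarrow> Q 0 \<and> Q (Suc 0) \<and> (\<forall>i. Suc (Suc i) \<le> m \<longrightarrow> Q (Suc (Suc i)))"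
    if "Suc 0 \<le> m" for Q m using that less2 by (metis le0)
  have P_eq [simp]: "ob ?P 0 = dsum \<C> (ob X 0) B" "ob ?P (Suc 0) = dsum \<C> (ob X (Suc 0)) B"
    "ob ?P (Suc (Suc i)) = ob X (Suc (Suc i))"
    "df ?P 0 = matm \<C> (df X 0) (zerom \<C> B (ob X (Suc 0))) f (neg \<C> (idt \<C> B))"
    "df ?P (Suc 0) = rowm \<C> (df X (Suc 0)) (zerom \<C> B (ob X (Suc (Suc 0))))"
    "df ?P (Suc (Suc i)) = df X (Suc (Suc i))" for i
    by (simp_all add: twisted_source_def numeral_2_eq_2)
  obtain m where m: "n = Suc m" using n0 by (cases n) auto
  \<comment> \<open>Injections and projections of the sum, composed in degree 0 with the involution.
    The summand B = B has zero objects above degree 1, which are dropped.\<close>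
  let ?i1 = "\<lambda>k. if k = 0 then colm \<C> (idt \<C> (ob X 0)) f else
    if k = 1 then inj1 \<C> (ob X 1) B else idt \<C> (ob X k)"
  let ?p1 = "\<lambda>k. if k = 0 then pr1 \<C> (ob X 0) B else
    if k = 1 then pr1 \<C> (ob X 1) B else idt \<C> (ob X k)"
  let ?i2 = "\<lambda>k. if k = 0 then neg \<C> (inj2 \<C> (ob X 0) B) else
    if k = 1 then inj2 \<C> (ob X 1) B else zerom \<C> ?Z (ob X k)"
  let ?p2 = "\<lambda>k. if k = 0 then rowm \<C> f (neg \<C> (idt \<C> B)) else
    if k = 1 then pr2 \<C> (ob X 1) B else zerom \<C> (ob X k) ?Z"
  show ?thesis
  proof (rule angle_retract_of_pair[OF X angle_initial_trivial[OF B]])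
    have "sequence \<C> n ?P"
      unfolding sequence_def using n0
      by (subst (1 2) cases3) (auto simp: Mor_def matrix_simps)
    thus "(?P, ?\<omega>) \<in> sigma_sequences \<C> \<Sigma> n"
      by (simp add: mem_sigma_sequences) (simp add: m)
    show "sigma_morphism \<C> \<Sigma> n (X, \<delta>) (?P, ?\<omega>) ?i1"
      "sigma_morphism \<C> \<Sigma> n (?P, ?\<omega>) (X, \<delta>) ?p1"
      "sigma_morphism \<C> \<Sigma> n (initial_trivial \<C> B, zerom \<C> ?Z (on_ob \<Sigma> B)) (?P, ?\<omega>) ?i2"
      "sigma_morphism \<C> \<Sigma> n (?P, ?\<omega>) (initial_trivial \<C> B, zerom \<C> ?Z (on_ob \<Sigma> B)) ?p2"
      unfolding sigma_morphism_def split using n0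
      by (subst (1 2) cases3; auto simp: Mor_def matrix_simps m)+
    show "retract_of_pair n ?P ?i1 ?p1 ?i2 ?p2"
      unfolding retract_of_pair_def
      using colm_cmp[of "idt \<C> (ob X 0)" f "rowm \<C> (idt \<C> (ob X 0)) (zerom \<C> B (ob X 0))"]
      by (subst cases3) (auto simp: inj_eq_colm pr_eq_rowm idt_dsum)
  qed
qed

text \<open>The sum of \<open>Y\<close> with the suspension sequence of \<open>A\<close>, without
  the zero summands in degrees 1 to n. Dropping them gives the later cocone literally the objects of
  the cone.\<close>

definition twisted_target :: "'o \<Rightarrow> ('o, 'm) seq \<Rightarrow> ('o, 'm) seq" where
  "twisted_target A Y =
    \<lparr>ob = (\<lambda>i. if i = 0 then dsum \<C> A (ob Y 0) else if i \<le> n then ob Y i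
       else dsum \<C> (on_ob \<Sigma> A) (ob Y (Suc n))),
     df = (\<lambda>i. if i = 0 then rowm \<C> (zerom \<C> A (ob Y 1)) (df Y 0)
       else if i < n then df Y i else colm \<C> (zerom \<C> (ob Y n) (on_ob \<Sigma> A)) (df Y n))\<rparr>"

lemma angle_twisted_target:
  assumes Y: "angle Y \<rho>" and A [simp]: "A \<in> Obj \<C>"
  shows "angle (twisted_target A Y) (sigma_colm \<C> \<Sigma> A (ob Y 0)
    (rowm \<C> (idt \<C> (on_ob \<Sigma> A)) (zerom \<C> (ob Y (Suc n)) (on_ob \<Sigma> A)))
    (rowm \<C> (zerom \<C> (on_ob \<Sigma> A) (on_ob \<Sigma> (ob Y 0))) \<rho>))"
    (is "angle ?Q ?\<omega>")
proof -
  note [simp] = angleD[OF Y]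
  have n0: "Suc 0 \<le> n" "0 < n" using n_pos by simp_all
  have [simp]: "i \<le> n \<Longrightarrow> ob Y (Suc i) \<in> Obj \<C>" for i by simp
  have [simp]: "ob Y (Suc 0) \<in> Obj \<C>" using n0 by simp
  have last: "\<lbrakk>\<not> Suc i \<le> n; i \<le> n\<rbrakk> \<Longrightarrow> i = n" for i by simp
  let ?A = "suspension_seq A" and ?Z = "zero_object \<C>"
  let ?i1 = "\<lambda>k. if k = 0 then inj1 \<C> A (ob Y 0) else
    if k \<le> n then zerom \<C> ?Z (ob Y k) else inj1 \<C> (on_ob \<Sigma> A) (ob Y (Suc n))"
  let ?p1 = "\<lambda>k. if k = 0 then pr1 \<C> A (ob Y 0) else
    if k \<le> n then zerom \<C> (ob Y k) ?Z else pr1 \<C> (on_ob \<Sigma> A) (ob Y (Suc n))"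
  let ?i2 = "\<lambda>k. if k = 0 then inj2 \<C> A (ob Y 0) else
    if k \<le> n then idt \<C> (ob Y k) else inj2 \<C> (on_ob \<Sigma> A) (ob Y (Suc n))"
  let ?p2 = "\<lambda>k. if k = 0 then pr2 \<C> A (ob Y 0) else
    if k \<le> n then idt \<C> (ob Y k) else pr2 \<C> (on_ob \<Sigma> A) (ob Y (Suc n))"
  show ?thesis
  proof (rule angle_retract_of_pair[OF angle_suspension_seq[OF A] Y])
    show "(?Q, ?\<omega>) \<in> sigma_sequences \<C> \<Sigma> n"
      using n0 by (auto simp: mem_sigma_sequences sequence_def Mor_def twisted_target_def)
    show "sigma_morphism \<C> \<Sigma> n (?A, idt \<C> (on_ob \<Sigma> A)) (?Q, ?\<omega>) ?i1"
      "sigma_morphism \<C> \<Sigma> n (?Q, ?\<omega>) (?A, idt \<C> (on_ob \<Sigma> A)) ?p1"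
      "sigma_morphism \<C> \<Sigma> n (Y, \<rho>) (?Q, ?\<omega>) ?i2"
      "sigma_morphism \<C> \<Sigma> n (?Q, ?\<omega>) (Y, \<rho>) ?p2"
      unfolding sigma_morphism_def split using n0
      by (auto simp: Mor_def matrix_simps twisted_target_def Sigma_colm not_less le_Suc_eq dest: last)
    show "retract_of_pair n ?Q ?i1 ?p1 ?i2 ?p2"
      by (auto simp: retract_of_pair_def matrix_simps twisted_target_def le_Suc_eq)
  qed
qed

text \<open>The images under \<open>\<Sigma>\<close> of the two projections recover the
  entries.\<close>

lemma sigma_colm_eqD:
  assumes eq: "sigma_colm \<C> \<Sigma> A B f g = sigma_colm \<C> \<Sigma> A B f' g'"
    and "A \<in> Obj \<C>" "B \<in> Obj \<C>" "f \<in> Arr \<C>" "g \<in> Arr \<C>" "f' \<in> Arr \<C>" "g' \<in> Arr \<C>"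
    "src \<C> f = src \<C> g" "src \<C> f' = src \<C> g'" "tgt \<C> f = on_ob \<Sigma> A" "tgt \<C> g = on_ob \<Sigma> B"
    "tgt \<C> f' = on_ob \<Sigma> A" "tgt \<C> g' = on_ob \<Sigma> B"
  shows "f = f'" "g = g'"
  using assms(2-) arg_cong[OF eq, of "\<lambda>h. on_arr \<Sigma> (rowm \<C> (idt \<C> A) (zerom \<C> B A)) \<cdot> h"]
    arg_cong[OF eq, of "\<lambda>h. on_arr \<Sigma> (rowm \<C> (zerom \<C> A B) (idt \<C> B)) \<cdot> h"] by simp_all

lemma colm_eta:
  assumes "h \<in> Arr \<C>" "tgt \<C> h = dsum \<C> A B" "A \<in> Obj \<C>" "B \<in> Obj \<C>"
  shows "colm \<C> (pr1 \<C> A B \<cdot> h) (pr2 \<C> A B \<cdot> h) = h"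
proof -
  have "colm \<C> (pr1 \<C> A B \<cdot> h) (pr2 \<C> A B \<cdot> h) = colm \<C> (pr1 \<C> A B) (pr2 \<C> A B) \<cdot> h"
    using assms by simp
  also have "colm \<C> (pr1 \<C> A B) (pr2 \<C> A B) = idt \<C> (dsum \<C> A B)"
    using assms by (simp add: colm_def)
  finally show ?thesis using assms by simp
qed

text \<open>
  The row \<open>[f\<^sup>1 -d]\<close> is compatible with the identity of \<open>X\<^sup>0 \<oplus> Y\<^sup>0\<close>. The mapping cocone obtained from
  it has the objects of the cone of \<open>f\<close> and the same differentials up to signs.
\<close>

lemma good_morphism:
  assumes X: "angle X \<delta>" and Y: "angle Y \<rho>"
    and f0 [simp]: "f0 \<in> Arr \<C>" "src \<C> f0 = ob X 0" "tgt \<C> f0 = ob Y 0"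
    and f1 [simp]: "f1 \<in> Arr \<C>" "src \<C> f1 = ob X 1" "tgt \<C> f1 = ob Y 1"
    and f01: "f1 \<cdot> df X 0 = df Y 0 \<cdot> f0"
  shows "\<exists>f. f 0 = f0 \<and> f 1 = f1 \<and> sigma_morphism \<C> \<Sigma> n (X, \<delta>) (Y, \<rho>) f \<and>
    sigma_cone \<C> \<Sigma> n (X, \<delta>) (Y, \<rho>) f \<in> distinguished_sigma_sequences \<C> \<Sigma> n s"
proof -
  note [simp] = angleD[OF X] angleD[OF Y]
  have n0 [simp]: "Suc 0 \<le> n" "0 < n" "n \<noteq> 0" using n_pos by simp_all
  have [simp]: "i \<le> n \<Longrightarrow> ob X (Suc i) \<in> Obj \<C>" "i \<le> n \<Longrightarrow> ob Y (Suc i) \<in> Obj \<C>" for i by simp_all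
  have [simp]: "ob X (Suc 0) \<in> Obj \<C>" "ob Y (Suc 0) \<in> Obj \<C>"
    "src \<C> f1 = ob X (Suc 0)" "tgt \<C> f1 = ob Y (Suc 0)" using f1 by simp_all
  let ?P = "twisted_source X (ob Y 0) f0" and ?Q = "twisted_target (ob X 0) Y"
  let ?A = "dsum \<C> (ob X 0) (ob Y 0)"
  define \<omega>P where "\<omega>P = sigma_colm \<C> \<Sigma> (ob X 0) (ob Y 0) \<delta> (on_arr \<Sigma> f0 \<cdot> \<delta>)"
  define \<omega>Q where "\<omega>Q = sigma_colm \<C> \<Sigma> (ob X 0) (ob Y 0)
    (rowm \<C> (idt \<C> (on_ob \<Sigma> (ob X 0))) (zerom \<C> (ob Y (Suc n)) (on_ob \<Sigma> (ob X 0))))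
    (rowm \<C> (zerom \<C> (on_ob \<Sigma> (ob X 0)) (on_ob \<Sigma> (ob Y 0))) \<rho>)"
  have P: "angle ?P \<omega>P" unfolding \<omega>P_def by (rule angle_twisted_source[OF X]) simp_all
  have Q: "angle ?Q \<omega>Q" unfolding \<omega>Q_def by (rule angle_twisted_target[OF Y]) simp
  obtain RP \<rho>P where RP: "rotation \<C> \<Sigma> n (?P, \<omega>P) = (RP, \<rho>P)" by fastforce
  obtain RQ \<rho>Q where RQ: "rotation \<C> \<Sigma> n (?Q, \<omega>Q) = (RQ, \<rho>Q)" by fastforce
  have aRP: "angle RP \<rho>P" and aRQ: "angle RQ \<rho>Q"
    using angle_rotation[OF P] angle_rotation[OF Q] by (simp_all add: RP RQ mem_angles)
  let ?dP0 = "matm \<C> (df X 0) (zerom \<C> (ob Y 0) (ob X (Suc 0))) f0 (neg \<C> (idt \<C> (ob Y 0)))"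
  let ?dQ0 = "rowm \<C> (zerom \<C> (ob X 0) (ob Y (Suc 0))) (df Y 0)"
  have RP_eq: "ob RP = (\<lambda>i. if i = 0 then dsum \<C> (ob X (Suc 0)) (ob Y 0) else
        if i \<le> n then ob X (Suc i) else on_ob \<Sigma> ?A)"
    "df RP = (\<lambda>i. if i = 0 then rowm \<C> (df X (Suc 0)) (zerom \<C> (ob Y 0) (ob X (Suc (Suc 0)))) else
        if i < n then df X (Suc i) else \<omega>P)" "\<rho>P = (neg \<C> ^^ n) (on_arr \<Sigma> ?dP0)"
    using RP by (auto simp: rotation_eq twisted_source_def numeral_2_eq_2)
  have RQ_eq: "ob RQ = (\<lambda>i. if i < n then ob Y (Suc i) else
        if i = n then dsum \<C> (on_ob \<Sigma> (ob X 0)) (ob Y (Suc n)) else on_ob \<Sigma> ?A)"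
    "df RQ = (\<lambda>i. if i < n then if Suc i < n then df Y (Suc i) else
        colm \<C> (zerom \<C> (ob Y n) (on_ob \<Sigma> (ob X 0))) (df Y n) else \<omega>Q)"
    "\<rho>Q = (neg \<C> ^^ n) (on_arr \<Sigma> ?dQ0)"
    using RQ by (auto simp: rotation_eq twisted_target_def)
  \<comment> \<open>On X^0 the two terms f^1 d and -d f^0 cancel, on Y^0 the two signs do. So
    \<open>?g\<close> carries the first differential of \<open>?P\<close> to that of
    \<open>?Q\<close>, and \<rho>P to \<rho>Q after applying \<open>\<Sigma>\<close> and the common
    sign.\<close>
  let ?g = "rowm \<C> f1 (neg \<C> (df Y 0))"
  have [simp]: "df X 0 \<in> Arr \<C>" "df Y 0 \<in> Arr \<C>" by simp_all
  have g: "?g \<cdot> ?dP0 = ?dQ0"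
    using f01 by (simp add: matm_def)
  have \<omega>Q [simp]: "\<omega>Q \<in> Arr \<C>" "src \<C> \<omega>Q = dsum \<C> (on_ob \<Sigma> (ob X 0)) (ob Y (Suc n))"
    "tgt \<C> \<omega>Q = on_ob \<Sigma> ?A" by (simp_all add: \<omega>Q_def)
  have push: "push \<C> E (on_ob \<Sigma> ?A) ?g \<rho>P = \<rho>Q"
    using arg_cong[OF g, of "on_arr \<Sigma>"] by (simp add: push_E RP_eq(3) RQ_eq(3))
  have \<rho>P [simp]: "\<rho>P \<in> Arr \<C>" "src \<C> \<rho>P = on_ob \<Sigma> ?A" "tgt \<C> \<rho>P = on_ob \<Sigma> (dsum \<C> (ob X (Suc 0)) (ob Y 0))"
    by (simp_all add: RP_eq(3))
  have pull: "pull \<C> E (dsum \<C> (ob X (Suc 0)) (ob Y 0)) \<omega>Q \<rho>P = \<rho>P \<cdot> \<omega>Q"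
    by (simp add: pull_E)
  \<comment> \<open>The cocone has RP^i \<oplus> RQ^(i-1) = X^(i+1) \<oplus> Y^i in degrees 1 to n,
    with X^1 \<oplus> Y^0 in front and \<Sigma> X^0 \<oplus> Y^(n+1) at the end: the objects of the
    cone.\<close>
  obtain h where h: "chain_map \<C> n RP RQ h" and h0: "h 0 = ?g" and h1: "h (Suc n) = idt \<C> (on_ob \<Sigma> ?A)"
    and M: "angle (mapping_cocone \<C> n RP RQ h) (\<rho>P \<cdot> \<omega>Q)"
    using EA2_op[of "dsum \<C> (ob X (Suc 0)) (ob Y 0)" "ob Y (Suc 0)" "on_ob \<Sigma> ?A" \<rho>P ?g RP RQ]
      aRP aRQ push pull
    by (auto simp: carrier_E Mor_def RP_eq(1,2) RQ_eq(1,2))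
  let ?M = "mapping_cocone \<C> n RP RQ h"
  have hn [simp]: "h n \<in> Arr \<C>" "src \<C> (h n) = ob X (Suc n)"
    "tgt \<C> (h n) = dsum \<C> (on_ob \<Sigma> (ob X 0)) (ob Y (Suc n))"
    using chain_mapD(1-3)[OF h, of n] by (simp_all add: RP_eq RQ_eq)
  let ?u = "pr1 \<C> (on_ob \<Sigma> (ob X 0)) (ob Y (Suc n)) \<cdot> h n"
  let ?v = "pr2 \<C> (on_ob \<Sigma> (ob X 0)) (ob Y (Suc n)) \<cdot> h n"
  have h_eta: "h n = colm \<C> ?u ?v" by (simp add: colm_eta)
  \<comment> \<open>The last square of h, whose final component is an identity. Comparing entries
    gives u = \<delta>, as in the last differential of the cone, and \<rho> v = (\<Sigma> f^0)
    \<delta>, which closes the desired morphism with v in degree n + 1.\<close>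
  have "\<omega>P = \<omega>Q \<cdot> colm \<C> ?u ?v"
    using chain_mapD(4)[OF h, of n] h1 unfolding h_eta[symmetric]
    by (simp add: RP_eq RQ_eq \<omega>P_def)
  also have "\<dots> = sigma_colm \<C> \<Sigma> (ob X 0) (ob Y 0) ?u (\<rho> \<cdot> ?v)"
    by (simp add: \<omega>Q_def del: cmp_assoc_arr)
  finally have "sigma_colm \<C> \<Sigma> (ob X 0) (ob Y 0) \<delta> (on_arr \<Sigma> f0 \<cdot> \<delta>) =
      sigma_colm \<C> \<Sigma> (ob X 0) (ob Y 0) ?u (\<rho> \<cdot> ?v)" by (simp add: \<omega>P_def)
  note uv = sigma_colm_eqD[OF this]
  have u: "?u = \<delta>" by (rule uv(1)[symmetric]) simp_all
  have v: "\<rho> \<cdot> ?v = on_arr \<Sigma> f0 \<cdot> \<delta>" by (rule uv(2)[symmetric]) simp_all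
  \<comment> \<open>The index shifts by one since h lives on rotations. Degrees 1 and n + 1 are set
    apart: there h is the row [f^1 -d] and the column with entries \<delta> and v.\<close>
  define F where "F i = (if i = 0 then f0 else if i = 1 then f1 else if i \<le> n then h (i - 1) else ?v)" for i
  have hn_eq: "h n = colm \<C> \<delta> ?v" using h_eta u by simp
  have F_simps [simp]: "F 0 = f0" "F (Suc 0) = f1" "F (Suc n) = ?v"
    "\<lbrakk>i \<le> n; i \<noteq> 0; i \<noteq> Suc 0\<rbrakk> \<Longrightarrow> F i = h (i - Suc 0)" for i by (auto simp: F_def)
  have F: "F i \<in> Arr \<C> \<and> src \<C> (F i) = ob X i \<and> tgt \<C> (F i) = ob Y i" if i: "i \<le> Suc n" for i
  proof -
    consider "i = 0" | "i = Suc 0" | "i = Suc n" | j where "i = Suc j" "j < n" "j \<noteq> 0"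
      using i by (cases i) (auto simp: le_less)
    thus ?thesis
      using chain_mapD(1-3)[OF h, of "i - 1"] by cases (simp_all add: RP_eq RQ_eq)
  qed
  note [simp] = F[THEN conjunct1] F[THEN conjunct2, THEN conjunct1] F[THEN conjunct2, THEN conjunct2]
  have F_sq: "F (Suc i) \<cdot> df X i = df Y i \<cdot> F i" if i: "i \<le> n" for i
  proof -
    \<comment> \<open>For i = 1 the square of h is restricted to X^1 by an injection, for i = n it
      is projected to Y^(n+1); when n = 1, both are done at once.\<close>
    consider "i = 0" | "i = Suc 0" "i < n" | "i = Suc 0" "i = n" |
      j where "i = Suc j" "i < n" "j \<noteq> 0" | j where "i = Suc j" "i = n" "j \<noteq> 0"
      using i by (cases i) (auto simp: le_less)
    thus ?thesis
    proof cases
      case 1 thus ?thesis using f01 by simp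
    next
      case 2
      have [simp]: "h (Suc 0) \<in> Arr \<C>" "src \<C> (h (Suc 0)) = ob X (Suc (Suc 0))"
        "tgt \<C> (h (Suc 0)) = ob Y (Suc (Suc 0))" "df X (Suc 0) \<in> Arr \<C>"
        using 2 chain_mapD(1-3)[OF h, of "Suc 0"] by (simp_all add: RP_eq RQ_eq)
      have "h (Suc 0) \<cdot> rowm \<C> (df X (Suc 0)) (zerom \<C> (ob Y 0) (ob X (Suc (Suc 0)))) =
          df Y (Suc 0) \<cdot> ?g"
        using chain_mapD(4)[OF h, of 0] 2 h0 by (simp add: RP_eq RQ_eq)
      from arg_cong[OF this, of "\<lambda>k. k \<cdot> inj1 \<C> (ob X (Suc 0)) (ob Y 0)"]
      show ?thesis using 2 by simp
    next
      case 3
      have eq: "h n \<cdot> rowm \<C> (df X n) (zerom \<C> (ob Y 0) (ob X (Suc n))) =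
          colm \<C> (zerom \<C> (ob Y n) (on_ob \<Sigma> (ob X 0))) (df Y n) \<cdot> ?g"
        using chain_mapD(4)[OF h, of 0] 3 h0 by (simp add: RP_eq RQ_eq)
      have t: "src \<C> f1 = ob X n" "tgt \<C> f1 = ob Y n" "tgt \<C> (df Y 0) = ob Y n"
        "df X n \<in> Arr \<C>" using 3 by simp_all
      from arg_cong[OF eq, of "\<lambda>k. k \<cdot> inj1 \<C> (ob X n) (ob Y 0)"]
      have "h n \<cdot> df X n = colm \<C> (zerom \<C> (ob Y n) (on_ob \<Sigma> (ob X 0))) (df Y n) \<cdot> f1"
        using t by simp
      from arg_cong[OF this, of "\<lambda>k. pr2 \<C> (on_ob \<Sigma> (ob X 0)) (ob Y (Suc n)) \<cdot> k"]
      have "?v \<cdot> df X n = df Y n \<cdot> f1" using t by simp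
      moreover have "F n = f1" using F_simps(2) 3 by simp
      ultimately show ?thesis unfolding 3(2) by (simp del: cmp_assoc_arr)
    next
      case 4
      thus ?thesis using chain_mapD(4)[OF h, of j] by (simp add: RP_eq RQ_eq)
    next
      case 5
      have [simp]: "h j \<in> Arr \<C>" "src \<C> (h j) = ob X n" "tgt \<C> (h j) = ob Y n"
        using 5 chain_mapD(1-3)[OF h, of j] by (simp_all add: RP_eq RQ_eq)
      have "h n \<cdot> df X n = colm \<C> (zerom \<C> (ob Y n) (on_ob \<Sigma> (ob X 0))) (df Y n) \<cdot> h j"
        using chain_mapD(4)[OF h, of j] 5 by (simp add: RP_eq RQ_eq)
      from arg_cong[OF this, of "\<lambda>k. pr2 \<C> (on_ob \<Sigma> (ob X 0)) (ob Y (Suc n)) \<cdot> k"]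
      have "?v \<cdot> df X n = df Y n \<cdot> h j" by simp
      moreover have "F n = h j" using F_simps(4)[of n] 5 by (simp del: F_simps)
      ultimately show ?thesis unfolding 5(2) by (simp del: cmp_assoc_arr)
    qed
  qed
  have mor: "sigma_morphism \<C> \<Sigma> n (X, \<delta>) (Y, \<rho>) F"
    unfolding sigma_morphism_iff chain_map_def using F F_sq v by (simp add: Mor_def)
  obtain W \<omega> where W: "sigma_cone \<C> \<Sigma> n (X, \<delta>) (Y, \<rho>) F = (W, \<omega>)" by fastforce
  let ?X = "ext_seq X \<delta>"
  have sX: "sequence \<C> (Suc n) ?X"
    by (rule sequence_ext_seq) (simp_all add: angle_complex[OF X])
  have [simp]: "i \<le> Suc n \<Longrightarrow> ob ?X (Suc i) \<in> Obj \<C>" for i using sequenceD(1)[OF sX, of "Suc i"] by simp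
  have dX [simp]: "i \<le> n \<Longrightarrow> df ?X (Suc i) \<in> Arr \<C>" "i \<le> n \<Longrightarrow> src \<C> (df ?X (Suc i)) = ob X (Suc i)"
    "i \<le> n \<Longrightarrow> tgt \<C> (df ?X (Suc i)) = ob ?X (Suc (Suc i))" for i
    using sequenceD(2-4)[OF sX, of "Suc i"] by simp_all
  have W_eq: "ob W = (\<lambda>i. dsum \<C> (ob ?X (Suc i)) (ob Y i))"
    "df W = (\<lambda>i. matm \<C> (neg \<C> (df ?X (Suc i))) (zerom \<C> (ob Y i) (ob ?X (Suc (Suc i)))) (F (Suc i)) (df Y i))"
    "\<omega> = sigma_colm \<C> \<Sigma> (ob X (Suc 0)) (ob Y 0)
        (rowm \<C> (neg \<C> (on_arr \<Sigma> (df X 0))) (zerom \<C> (ob Y (Suc n)) (on_ob \<Sigma> (ob X (Suc 0)))))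
        (rowm \<C> (on_arr \<Sigma> f0) \<rho>)"
    using W by (auto simp: sigma_cone_def Let_def ext_seq_def numeral_2_eq_2)
  have ob_M: "ob ?M i = dsum \<C> (ob ?X (Suc i)) (ob Y i)" if i: "i \<le> Suc n" for i
  proof -
    consider "i = 0" | "i = Suc n" | j where "i = Suc j" "j < n"
      using i by (cases i) (auto simp: le_less)
    thus ?thesis by cases (simp_all add: mapping_cocone_def RP_eq RQ_eq)
  qed
  have df_M: "df ?M i = matm \<C> (df ?X (Suc i)) (zerom \<C> (ob Y i) (ob ?X (Suc (Suc i)))) (F (Suc i)) (neg \<C> (df Y i))"
    if i: "i \<le> n" for i
  proof -
    consider "i = 0" | "i = n" "i \<noteq> 0" | j where "i = Suc j" "i < n"
      using i by (cases i) (auto simp: le_less)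
    thus ?thesis
    proof cases
      case 1 thus ?thesis by (simp add: mapping_cocone_def RP_eq RQ_eq h0 matm_def)
    next
      case 2
      then obtain j where j: "n = Suc j" by (cases n) auto
      have "df ?M n = rowm \<C> (h n) (neg \<C> (colm \<C> (zerom \<C> (ob Y n) (on_ob \<Sigma> (ob X 0))) (df Y n)))"
        by (simp add: mapping_cocone_def RP_eq RQ_eq j)
      also have "\<dots> = matm \<C> \<delta> (zerom \<C> (ob Y n) (on_ob \<Sigma> (ob X 0))) ?v (neg \<C> (df Y n))"
        by (subst hn_eq) (simp add: matm_def del: cmp_assoc_arr)
      finally show ?thesis using 2 by simp
    next
      case 3 thus ?thesis by (simp add: mapping_cocone_def RP_eq RQ_eq)
    qed
  qed
  \<comment> \<open>The cocone has entries d_X, f, -d_Y where the cone has -d_X, f, d_Y. Conjugation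
    by diag(1, -1) flips the sign of f alone, and the alternating factor (-1)^i flips all
    three.\<close>
  let ?e = "\<lambda>i. (neg \<C> ^^ i) (matm \<C> (idt \<C> (ob ?X (Suc i))) (zerom \<C> (ob Y i) (ob ?X (Suc i)))
    (zerom \<C> (ob ?X (Suc i)) (ob Y i)) (neg \<C> (idt \<C> (ob Y i))))"
  have "angle W \<omega>"
  proof (rule angle_retract[OF M])
    show "(W, \<omega>) \<in> sigma_sequences \<C> \<Sigma> n"
      by (auto simp: mem_sigma_sequences W_eq sequence_def Mor_def simp del: F_simps)
    show "sigma_morphism \<C> \<Sigma> n (?M, \<rho>P \<cdot> \<omega>Q) (W, \<omega>) ?e"
      unfolding sigma_morphism_def split
    proof (intro conjI allI impI)
      show "?e i \<in> Mor \<C> (ob ?M i) (ob W i)" if "i \<le> n + 1" for i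
        using that by (simp add: ob_M W_eq Mor_def)
      show "?e (i + 1) \<cdot> df ?M i = df W i \<cdot> ?e i" if "i \<le> n" for i
        using that by (simp add: df_M W_eq matm_def del: F_simps)
      show "on_arr \<Sigma> (?e 0) \<cdot> (\<rho>P \<cdot> \<omega>Q) = \<omega> \<cdot> ?e (n + 1)"
        by (simp add: W_eq \<omega>Q_def RP_eq(3) matm_def)
    qed
    show "sigma_morphism \<C> \<Sigma> n (W, \<omega>) (?M, \<rho>P \<cdot> \<omega>Q) ?e"
      unfolding sigma_morphism_def split
    proof (intro conjI allI impI)
      show "?e i \<in> Mor \<C> (ob W i) (ob ?M i)" if "i \<le> n + 1" for i
        using that by (simp add: ob_M W_eq Mor_def)
      show "?e (i + 1) \<cdot> df W i = df ?M i \<cdot> ?e i" if "i \<le> n" for i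
        using that by (simp add: df_M W_eq matm_def del: F_simps)
      show "on_arr \<Sigma> (?e 0) \<cdot> \<omega> = (\<rho>P \<cdot> \<omega>Q) \<cdot> ?e (n + 1)"
        by (simp add: W_eq \<omega>Q_def RP_eq(3) matm_def)
    qed
    show "?e k \<cdot> ?e k = idt \<C> (ob W k)" if "k \<le> Suc n" for k
      using that by (simp add: W_eq matm_def idt_dsum)
  qed
  thus ?thesis using mor by (intro exI[of _ F]) (simp add: W mem_angles)
qed

section \<open>Verification of the axioms\<close>

lemma n_angulated: "n_angulated_category \<C> \<Sigma> n (distinguished_sigma_sequences \<C> \<Sigma> n s)"
proof unfold_locales
  let ?angles = "distinguished_sigma_sequences \<C> \<Sigma> n s"
  show "n \<ge> 1" by (rule n_pos)
  show "automorphism \<C> \<Sigma>" by (rule automorphism)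
  show "?angles \<subseteq> sigma_sequences \<C> \<Sigma> n" by (auto simp: distinguished_sigma_sequences_def)
  show "T \<in> ?angles" if "S \<in> ?angles" "T \<in> sigma_sequences \<C> \<Sigma> n" "sigma_isomorphic \<C> \<Sigma> n S T" for S T
    using that by (rule angles_iso)
  show "sigma_dsum \<C> \<Sigma> n S T \<in> ?angles" if "S \<in> ?angles" "T \<in> ?angles" for S T
    using that by (rule angles_dsum)
  show "S \<in> ?angles" if "S \<in> sigma_sequences \<C> \<Sigma> n" "S' \<in> sigma_sequences \<C> \<Sigma> n" "T \<in> ?angles"
    "sigma_isomorphic \<C> \<Sigma> n T (sigma_dsum \<C> \<Sigma> n S S')" for S S' T
    using that by (rule angles_summand)
  show "(initial_trivial \<C> A, zerom \<C> (zero_object \<C>) (on_ob \<Sigma> A)) \<in> ?angles" if "A \<in> Obj \<C>" for A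
    using angle_initial_trivial[OF that] by (simp add: mem_angles)
  show F2: "S \<in> ?angles \<longleftrightarrow> rotation \<C> \<Sigma> n S \<in> ?angles" if "S \<in> sigma_sequences \<C> \<Sigma> n" for S
    using that angle_rotation[of "fst S" "snd S"] angle_of_rotation[of "fst S" "snd S"]
    by (cases S) (auto simp: mem_angles)
  show "\<exists>X \<delta>. (X, \<delta>) \<in> ?angles \<and> df X 0 = f"
    if AB [simp]: "A \<in> Obj \<C>" "B \<in> Obj \<C>" and f: "f \<in> Mor \<C> A B" for A B f
  proof -
    have [simp]: "f \<in> Arr \<C>" "src \<C> f = A" "tgt \<C> f = B" using f by (simp_all add: Mor_def)
    \<comment> \<open>A sequence beginning with f has a rotation ending in (-1)^n \<Sigma> f. Such a
      rotation is obtained by realizing that extension in E(\<Sigma> A, B), and putting f in front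
      of it undoes the rotation.\<close>
    obtain X where X: "angle X ((neg \<C> ^^ n) (on_arr \<Sigma> f))" "ob X 0 = B" "ob X (Suc n) = on_ob \<Sigma> A"
      by (rule ex_angle[of "(neg \<C> ^^ n) (on_arr \<Sigma> f)" B]) simp_all
    note [simp] = angleD(4-7)[OF X(1)] X(2,3)
    let ?W = "\<lparr>ob = (\<lambda>i. if i = 0 then A else ob X (i - 1)),
      df = (\<lambda>i. if i = 0 then f else df X (i - 1))\<rparr>"
    have W: "(?W, df X n) \<in> sigma_sequences \<C> \<Sigma> n"
      using n_pos by (auto simp: mem_sigma_sequences sequence_def Mor_def)
    obtain R \<omega> where R: "rotation \<C> \<Sigma> n (?W, df X n) = (R, \<omega>)" by fastforce
    have R_eq: "ob R i = ob X i" if "i \<le> Suc n" for i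
      using R that by (auto simp: rotation_eq le_Suc_eq)
    have R_eq': "df R i = df X i" if "i \<le> n" for i
      using R that by (auto simp: rotation_eq le_less)
    have R_eq'': "\<omega> = (neg \<C> ^^ n) (on_arr \<Sigma> f)"
      using R by (auto simp: rotation_eq)
    \<comment> \<open>The rotation of \<open>?W\<close> and \<open>X\<close> agree in all meaningful
      degrees but need not be equal as records, hence the passage through identity maps.\<close>
    have "sigma_morphism \<C> \<Sigma> n (X, \<omega>) (R, \<omega>) (\<lambda>i. idt \<C> (ob X i))"
      "sigma_morphism \<C> \<Sigma> n (R, \<omega>) (X, \<omega>) (\<lambda>i. idt \<C> (ob X i))"
      unfolding sigma_morphism_iff chain_map_def by (simp_all add: R_eq R_eq' R_eq'' Mor_def)
    hence "angle R \<omega>"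
      using angle_retract[of X \<omega> R \<omega>] X(1) rotation_sigma_sequences[OF W]
      by (simp add: R R_eq R_eq'')
    hence "rotation \<C> \<Sigma> n (?W, df X n) \<in> ?angles" by (simp add: R mem_angles)
    hence "(?W, df X n) \<in> ?angles" using F2[OF W] by simp
    thus ?thesis by (intro exI[of _ ?W] exI[of _ "df X n"]) simp
  qed
  show F4: "\<exists>f. f 0 = f0 \<and> f 1 = f1 \<and> sigma_morphism \<C> \<Sigma> n (X, \<delta>) (Y, \<rho>) f \<and>
      sigma_cone \<C> \<Sigma> n (X, \<delta>) (Y, \<rho>) f \<in> ?angles"
    if "(X, \<delta>) \<in> ?angles" "(Y, \<rho>) \<in> ?angles" "f0 \<in> Mor \<C> (ob X 0) (ob Y 0)" "f1 \<in> Mor \<C> (ob X 1) (ob Y 1)"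
      "f1 \<cdot> df X 0 = df Y 0 \<cdot> f0" for X \<delta> Y \<rho> f0 f1
    using that good_morphism[of X \<delta> Y \<rho> f0 f1] by (simp add: mem_angles Mor_def)
  show "\<exists>f. f 0 = f0 \<and> f 1 = f1 \<and> sigma_morphism \<C> \<Sigma> n (X, \<delta>) (Y, \<rho>) f"
    if "(X, \<delta>) \<in> ?angles" "(Y, \<rho>) \<in> ?angles" "f0 \<in> Mor \<C> (ob X 0) (ob Y 0)" "f1 \<in> Mor \<C> (ob X 1) (ob Y 1)"
      "f1 \<cdot> df X 0 = df Y 0 \<cdot> f0" for X \<delta> Y \<rho> f0 f1
    using F4[OF that] by blast
qed

end

theorem proposition4p8:
  fixes \<C> :: "('o, 'm) cat" and \<Sigma> :: "('o, 'm) endo" and n :: nat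
    and s :: "'o \<Rightarrow> 'o \<Rightarrow> 'm \<Rightarrow> ('o, 'm) seq set"
  assumes "n \<ge> 1"
    and "additive_category \<C>"
    and "automorphism \<C> \<Sigma>"
    and "exact_realization \<C> (sigma_bifunctor \<C> \<Sigma>) n s"
    and "n_exangulated_category \<C> (sigma_bifunctor \<C> \<Sigma>) n s"
  shows "n_angulated_category \<C> \<Sigma> n (distinguished_sigma_sequences \<C> \<Sigma> n s)"
  using assms(3,5)
  by (intro sigma_exangulated.n_angulated sigma_exangulated.intro sigma_exangulated_axioms.intro)

end
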